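(* Let $D\subset\mathbb C^n$ be a bounded domain and $\varphi\in C^2(D)$ real-valued. Assume that there is a non-zero $f\in A^2(D,\varphi)$ that is Skoda divisible with respect to $\varphi$. Then $\varphi$ is plurisubharmonic on $D$.
   Context: $\mathcal O(D)$ is the space of holomorphic functions on $D$, $dV$ is Lebesgue measure, and $A^2(D,\varphi)=\{f\in\mathcal O(D):\int_D|f|^2e^{-\varphi}\,dV<\infty\}$. For a holomorphic tuple $g=(g_1,\dots,g_m)\in\mathcal O(D)^{\oplus m}$ and $h=(h_1,\dots,h_m)\in\mathcal O(D)^{\oplus m}$ write $g\cdot h=\sum_{j=1}^m g_jh_j$, $|g|^2=\sum_j|g_j|^2$, $|h|^2=\sum_j|h_j|^2$, $p=\min\{n,m-1\}$. For $\varepsilon>0$ set $$\psi_{g,\varepsilon}=p(1+\varepsilon)\log|g|^2,\qquad J_{\varphi,g,\varepsilon}(f)=\int_D\frac{|f|^2}{|g|^2}e^{-\varphi-\psi_{g,\varepsilon}}\,dV .$$ Definition. Let $\varphi\in L^1_{\mathrm{loc}}(D)$ and $f\in\mathcal O(D)$. We say that $f$ is Skoda divisible with respect to $\varphi$ if, for every $m\geqslant1$, every $g\in\mathcal O(D)^{\oplus m}$ whose components have no common zero in $D$, and every $\varepsilon>0$ satisfying $J_{\varphi,g,\varepsilon}(f)<\infty$, there is $h\in\mathcal O(D)^{\oplus m}$ such that $g\cdot h=f$ and $$\int_D|h|^2e^{-\varphi-\psi_{g,\varepsilon}}\,dV\leqslant\left(1+\frac1\varepsilon\right)J_{\varphi,g,\varepsilon}(f).$$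 *)

theory Defs
  imports "HOL-Analysis.Analysis"
begin

text \<open>
  Complex \<open>n\<close>-space is \<^typ>\<open>complex ^ 'n\<close> with \<open>n = CARD('n)\<close>. Functions on \<open>D\<close> are total
  functions of which only the values on \<open>D\<close> matter.
\<close>

text \<open>
  Frechet differentiability at every point with a complex-linear derivative; additivity of \<open>L\<close>
  is part of \<^const>\<open>has_derivative\<close>. Meant for open \<open>D\<close>.
\<close>
definition holomorphic_fun_on :: "(complex ^ 'n \<Rightarrow> complex) \<Rightarrow> (complex ^ 'n) set \<Rightarrow> bool"
    (infix \<open>holomorphic'_fun'_on\<close> 50)
  where "f holomorphic_fun_on D \<longleftrightarrow>
    (\<forall>z\<in>D. \<exists>L. (f has_derivative L) (at z) \<and> (\<forall>c v. L (c *s v) = c * L v))"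

text \<open>Class \<open>C\<^sup>2\<close> in the real sense, for open \<open>D\<close>.\<close>
definition C2_on :: "('a::real_normed_vector \<Rightarrow> real) \<Rightarrow> 'a set \<Rightarrow> bool"
    (infix \<open>C2'_on\<close> 50)
  where "u C2_on D \<longleftrightarrow>
    (\<exists>(u' :: 'a \<Rightarrow> 'a \<Rightarrow>\<^sub>L real) (u'' :: 'a \<Rightarrow> 'a \<Rightarrow>\<^sub>L ('a \<Rightarrow>\<^sub>L real)).
      (\<forall>x\<in>D. (u has_derivative blinfun_apply (u' x)) (at x)) \<and>
      (\<forall>x\<in>D. (u' has_derivative blinfun_apply (u'' x)) (at x)) \<and>
      continuous_on D u'')"

text \<open>
  Plurisubharmonicity of a real-valued (nowhere \<open>-\<infinity>\<close>) function on an open set: upper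
  semicontinuity and the sub-mean value inequality over every closed affine disc contained in
  \<open>D\<close>. An upper semicontinuous function is bounded above on a circle, so its mean always exists
  in \<open>[-\<infinity>, \<infinity>)\<close>; as the value at the centre is finite, the inequality for the extended mean is
  the conjunction of integrability and the inequality for the Lebesgue integral.
\<close>
definition plurisubharmonic_on :: "(complex ^ 'n \<Rightarrow> real) \<Rightarrow> (complex ^ 'n) set \<Rightarrow> bool"
    (infix \<open>plurisubharmonic'_on\<close> 50)
  where "u plurisubharmonic_on D \<longleftrightarrow>
    (\<forall>z\<in>D. \<forall>t > u z. \<forall>\<^sub>F x in at z within D. u x < t) \<and>
    (\<forall>a w. (\<forall>c. cmod c \<le> 1 \<longrightarrow> a + c *s w \<in> D) \<longrightarrow>
      set_integrable lborel {0..2 * pi} (\<lambda>\<theta>. u (a + cis \<theta> *s w)) \<and>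
      u a \<le> (1 / (2 * pi)) * (LINT \<theta>:{0..2 * pi}|lborel. u (a + cis \<theta> *s w)))"

definition L1_loc_on :: "(complex ^ 'n \<Rightarrow> real) \<Rightarrow> (complex ^ 'n) set \<Rightarrow> bool"
    (infix \<open>L1'_loc'_on\<close> 50)
  where "u L1_loc_on D \<longleftrightarrow> (\<forall>K. compact K \<and> K \<subseteq> D \<longrightarrow> set_integrable lebesgue K u)"

definition weighted_bergman :: "(complex ^ 'n) set \<Rightarrow> (complex ^ 'n \<Rightarrow> real) \<Rightarrow> (complex ^ 'n \<Rightarrow> complex) set"
  where "weighted_bergman D \<phi> =
    {f. f holomorphic_fun_on D \<and>
        (\<integral>\<^sup>+z\<in>D. ennreal ((cmod (f z))\<^sup>2 * exp (- \<phi> z)) \<partial>lebesgue) < \<infinity>}"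

text \<open>
  An \<open>m\<close>-tuple of functions is a family indexed by \<^typ>\<open>nat\<close>, of which only the members with
  index below \<open>m\<close> are used.
\<close>
definition tuple_normsq :: "nat \<Rightarrow> (nat \<Rightarrow> complex ^ 'n \<Rightarrow> complex) \<Rightarrow> complex ^ 'n \<Rightarrow> real"
  where "tuple_normsq m g z = (\<Sum>j<m. (cmod (g j z))\<^sup>2)"

definition skoda_weight ::
    "nat \<Rightarrow> (nat \<Rightarrow> complex ^ 'n \<Rightarrow> complex) \<Rightarrow> real \<Rightarrow> complex ^ 'n \<Rightarrow> real"
  where "skoda_weight m g \<epsilon> z =
    real (min CARD('n) (m - 1)) * (1 + \<epsilon>) * ln (tuple_normsq m g z)"

definition skoda_J ::
    "(complex ^ 'n) set \<Rightarrow> (complex ^ 'n \<Rightarrow> real) \<Rightarrow> nat \<Rightarrow> (nat \<Rightarrow> complex ^ 'n \<Rightarrow> complex) \<Rightarrow>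
      real \<Rightarrow> (complex ^ 'n \<Rightarrow> complex) \<Rightarrow> ennreal"
  where "skoda_J D \<phi> m g \<epsilon> f =
    (\<integral>\<^sup>+z\<in>D. ennreal ((cmod (f z))\<^sup>2 / tuple_normsq m g z * exp (- \<phi> z - skoda_weight m g \<epsilon> z))
      \<partial>lebesgue)"

definition skoda_divisible ::
    "(complex ^ 'n) set \<Rightarrow> (complex ^ 'n \<Rightarrow> real) \<Rightarrow> (complex ^ 'n \<Rightarrow> complex) \<Rightarrow> bool"
  where "skoda_divisible D \<phi> f \<longleftrightarrow>
    \<phi> L1_loc_on D \<and> f holomorphic_fun_on D \<and>
    (\<forall>m g \<epsilon>.
      m \<ge> 1 \<and> (\<forall>j<m. g j holomorphic_fun_on D) \<and> (\<forall>z\<in>D. \<exists>j<m. g j z \<noteq> 0) \<and>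
      \<epsilon> > 0 \<and> skoda_J D \<phi> m g \<epsilon> f < \<infinity> \<longrightarrow>
      (\<exists>h. (\<forall>j<m. h j holomorphic_fun_on D) \<and>
           (\<forall>z\<in>D. (\<Sum>j<m. g j z * h j z) = f z) \<and>
           (\<integral>\<^sup>+z\<in>D. ennreal (tuple_normsq m h z * exp (- \<phi> z - skoda_weight m g \<epsilon> z)) \<partial>lebesgue)
             \<le> ennreal (1 + 1 / \<epsilon>) * skoda_J D \<phi> m g \<epsilon> f))"

end

theory Submission
  imports Defs "HOL-Complex_Analysis.Complex_Analysis"
begin

text \<open>
  A \<open>C\<^sup>2\<close> function is plurisubharmonic once its Levi form is nonnegative
  (\<open>plurisubharmonic_on_if_levi_nonneg\<close>). Suppose the Levi form of \<open>\<phi>\<close> is negative at a point in a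
  direction \<open>\<xi>\<close>. This persists on a neighbourhood, and the zero set of \<open>f\<close> has empty interior
  (\<open>holomorphic_fun_identity\<close>), so it happens at some \<open>a\<close> with \<open>f a \<noteq> 0\<close>.

  Skoda divisibility is tested on \<open>g = e\<^sup>A (1, w\<^sub>1, \<dots>, w\<^sub>n)\<close>, where \<open>w\<close> are linear coordinates centred
  at \<open>a\<close>, with \<open>\<epsilon> = N \<rightarrow> \<infinity>\<close>. Here \<open>p = n\<close>, so with \<open>s = n (1 + N)\<close> the weight contains
  \<open>(1 + |w|\<^sup>2)\<^sup>-\<^sup>s\<close> and all energies concentrate at \<open>a\<close>. The scalar \<open>e\<^sup>A\<close> replaces \<open>\<phi>\<close> by
  \<open>\<phi> + 2 Re \<Lambda>\<close> for a complex affine function \<open>\<Lambda>\<close> which does not depend on \<open>N\<close>; it is chosen so that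
  the new weight together with \<open>|f|\<^sup>2\<close> is stationary at \<open>a\<close>. Removing from \<open>|h|\<^sup>2\<close> its pointwise
  minimum \<open>|f|\<^sup>2 / |g|\<^sup>2\<close> turns the factor \<open>1 + 1/N\<close> into \<open>1/N\<close> (\<open>skoda_energy_comparison\<close>):
  the excess energy of \<open>h\<close> is at most \<open>1/N\<close> times the energy of \<open>f\<close>.

  The excess energy is bounded below without knowing \<open>h\<close>. On a circle \<open>\<theta> \<mapsto> e\<^sup>i\<^sup>\<theta> w\<close> the equation
  \<open>h\<^sub>0 + \<Sum>\<^sub>j w\<^sub>j h\<^sub>j = f\<close> can be rotated so that the excess is the square norm of a vector which is
  holomorphic in \<open>e\<^sup>i\<^sup>\<theta>\<close>; its mean is at least the value at the centre, and that value is determined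
  by \<open>f a\<close> (\<open>division_energy_lower_bound\<close>). In suitable coordinates, and after normalization, the
  circle invariant part of the twisted weight is \<open>1 + \<tau> |w\<^sub>k|\<^sup>2\<close> up to \<open>\<eta> |w|\<^sup>2\<close>, with \<open>\<tau> > 0\<close> fixed and \<open>\<eta>\<close> as small as desired
  (\<open>negative_levi_direction_normal_form\<close>): the coordinates are long in the direction \<open>\<xi>\<close> and short in
  the others, which makes \<open>\<xi>\<close> dominate. Altogether, up to terms that are exponentially small in \<open>N\<close>,

    \<open>N \<integral> |w|\<^sup>2 (1 + \<tau> |w\<^sub>k|\<^sup>2 - \<eta> |w|\<^sup>2) / (1 + |w|\<^sup>2)\<^sup>s\<^sup>+\<^sup>1 \<le> \<integral> (1 + \<tau> |w\<^sub>k|\<^sup>2 + 4 \<eta> |w|\<^sup>2) / (1 + |w|\<^sup>2)\<^sup>s\<^sup>+\<^sup>1\<close>.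

  For \<open>\<tau> = \<eta> = 0\<close> this is an equality up to a boundary term, because for \<open>\<phi> = 0\<close> and \<open>f = 1\<close> on the whole space
  the Skoda estimate is attained by \<open>h = (1, 0, \<dots>, 0)\<close>. So only the first order in \<open>\<tau>\<close> counts.
  The moments \<open>M\<^sub>j = \<integral> |w|\<^sup>2\<^sup>j / (1 + |w|\<^sup>2)\<^sup>s\<^sup>+\<^sup>1\<close> satisfy \<open>n M\<^sub>0 \<approx> n N M\<^sub>1\<close> and
  \<open>(n + 1) M\<^sub>1 \<approx> (n N - 1) M\<^sub>2\<close> (\<open>moment_flux_inequality\<close>), so the left side carries \<open>\<tau>\<close> with the
  factor \<open>(n + 1) M\<^sub>1 / n\<^sup>2\<close> and the right side only with \<open>n M\<^sub>1 / n\<^sup>2\<close>; this is absurd for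
  small \<open>\<eta>\<close> and large \<open>N\<close> (\<open>radial_inequality_contradiction\<close>).
\<close>

section \<open>Linear changes of variables and circle averages\<close>

lemma nn_integral_lborel_translate:
  fixes F :: "'a::euclidean_space \<Rightarrow> ennreal"
  assumes [measurable]: "F \<in> borel_measurable borel"
  shows "(\<integral>\<^sup>+x. F (x + v) \<partial>lborel) = (\<integral>\<^sup>+x. F x \<partial>lborel)"
proof -
  have "(\<integral>\<^sup>+x. F x \<partial>lborel) = (\<integral>\<^sup>+x. F x \<partial>distr lborel borel ((+) v))"
    by (simp add: lborel_distr_plus)
  also have "\<dots> = (\<integral>\<^sup>+x. F (v + x) \<partial>lborel)"
    by (rule nn_integral_distr) auto
  finally show ?thesis by (simp add: add.commute)
qed

text \<open>
  Uniqueness of translation invariant measures, in the form needed for substitution. With \<open>B\<close> the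
  unit ball, Fubini evaluates the double integral of \<open>1\<^sub>B(T y) F(x + T y)\<close> in two ways: translating
  \<open>x\<close> gives the left side; translating \<open>y\<close> by \<open>S x\<close> first gives the right side, because the integral
  of \<open>1\<^sub>B(T y - x)\<close> over \<open>x\<close> is the volume of a unit ball for every \<open>y\<close>.
\<close>
lemma nn_integral_lborel_linear_aux:
  fixes T S :: "'a::euclidean_space \<Rightarrow> 'a" and F :: "'a \<Rightarrow> ennreal"
  assumes T: "linear T" and S: "linear S" and TS: "\<And>x. T (S x) = x"
    and [measurable]: "F \<in> borel_measurable borel"
  shows "(\<integral>\<^sup>+x. F x \<partial>lborel) * emeasure lborel (T -` ball 0 1)
       = emeasure lborel (ball (0::'a) 1) * (\<integral>\<^sup>+y. F (T y) \<partial>lborel)"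
proof -
  have Tm[measurable]: "T \<in> borel_measurable borel"
    using T by (intro borel_measurable_continuous_onI linear_continuous_on) (simp add: linear_conv_bounded_linear)
  define I :: "'a \<Rightarrow> ennreal" where "I = indicator (ball 0 1)"
  have Im[measurable]: "I \<in> borel_measurable borel"
    unfolding I_def by (rule borel_measurable_indicator) simp
  have vs: "T -` ball 0 1 \<in> sets borel"
    using measurable_sets[OF Tm, of "ball 0 1"] by simp
  have "emeasure lborel (T -` ball 0 1) = (\<integral>\<^sup>+y. indicator (T -` ball 0 1) y \<partial>lborel)"
    using vs by simp
  also have "\<dots> = (\<integral>\<^sup>+y. I (T y) \<partial>lborel)"
    by (intro nn_integral_cong) (auto simp: I_def indicator_def)
  finally have e1: "emeasure lborel (T -` ball 0 1) = (\<integral>\<^sup>+y. I (T y) \<partial>lborel)" .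
  have "(\<integral>\<^sup>+x. F x \<partial>lborel) * emeasure lborel (T -` ball 0 1)
      = (\<integral>\<^sup>+y. I (T y) * (\<integral>\<^sup>+x. F x \<partial>lborel) \<partial>lborel)"
    unfolding e1 by (subst nn_integral_multc) (auto simp: mult.commute)
  also have "\<dots> = (\<integral>\<^sup>+y. I (T y) * (\<integral>\<^sup>+x. F (x + T y) \<partial>lborel) \<partial>lborel)"
    by (simp add: nn_integral_lborel_translate)
  also have "\<dots> = (\<integral>\<^sup>+y. (\<integral>\<^sup>+x. I (T y) * F (x + T y) \<partial>lborel) \<partial>lborel)"
    by (intro nn_integral_cong nn_integral_cmult[symmetric]) auto
  also have "\<dots> = (\<integral>\<^sup>+x. (\<integral>\<^sup>+y. I (T y) * F (x + T y) \<partial>lborel) \<partial>lborel)"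
    by (rule lborel_pair.Fubini'[symmetric]) measurable
  also have "\<dots> = (\<integral>\<^sup>+x. (\<integral>\<^sup>+y. I (T (y + - S x)) * F (x + T (y + - S x)) \<partial>lborel) \<partial>lborel)"
    by (intro nn_integral_cong nn_integral_lborel_translate[symmetric]) measurable
  also have "\<dots> = (\<integral>\<^sup>+x. (\<integral>\<^sup>+y. I (T y - x) * F (T y) \<partial>lborel) \<partial>lborel)"
    by (simp add: linear_diff[OF T] TS)
  also have "\<dots> = (\<integral>\<^sup>+y. (\<integral>\<^sup>+x. I (T y - x) * F (T y) \<partial>lborel) \<partial>lborel)"
    by (rule lborel_pair.Fubini') measurable
  also have "\<dots> = (\<integral>\<^sup>+y. (\<integral>\<^sup>+x. I (T y - x) \<partial>lborel) * F (T y) \<partial>lborel)"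
    by (intro nn_integral_cong nn_integral_multc) measurable
  also have "\<dots> = (\<integral>\<^sup>+y. emeasure lborel (ball (0::'a) 1) * F (T y) \<partial>lborel)"
  proof (intro nn_integral_cong)
    fix y
    have "(\<integral>\<^sup>+x. I (T y - x) \<partial>lborel) = (\<integral>\<^sup>+x. indicator (ball (T y) 1) x \<partial>lborel)"
      by (intro nn_integral_cong) (auto simp: I_def indicator_def dist_norm norm_minus_commute)
    also have "\<dots> = emeasure lborel (ball (T y) 1)" by simp
    also have "\<dots> = emeasure lborel (ball (0::'a) 1)" by (simp add: emeasure_ball)
    finally show "(\<integral>\<^sup>+x. I (T y - x) \<partial>lborel) * F (T y) = emeasure lborel (ball (0::'a) 1) * F (T y)" by simp
  qed
  also have "\<dots> = emeasure lborel (ball (0::'a) 1) * (\<integral>\<^sup>+y. F (T y) \<partial>lborel)"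
    by (rule nn_integral_cmult) measurable
  finally show ?thesis .
qed

lemma emeasure_unit_ball_pos_finite:
  "0 < emeasure lborel (ball (0::'a::euclidean_space) 1)" "emeasure lborel (ball (0::'a::euclidean_space) 1) < \<infinity>"
  by (simp_all add: emeasure_ball unit_ball_vol_pos)

text \<open>
  The constant is the absolute real Jacobian determinant of \<open>T\<close>. It multiplies both sides of the
  energy comparison, so that its existence is enough.
\<close>
lemma nn_integral_lborel_linear:
  fixes T S :: "'a::euclidean_space \<Rightarrow> 'a"
  assumes T: "linear T" and S: "linear S" and TS: "\<And>x. T (S x) = x" and ST: "\<And>x. S (T x) = x"
  obtains c :: ennreal where "0 < c" "c < \<infinity>"
    "\<And>F a. F \<in> borel_measurable borel \<Longrightarrow>
       (\<integral>\<^sup>+x. F x \<partial>lborel) = c * (\<integral>\<^sup>+y. F (a + T y) \<partial>lborel)"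
proof -
  define V where "V = emeasure lborel (T -` ball 0 1)"
  define U where "U = emeasure lborel (ball (0::'a) 1)"
  have cT: "continuous_on UNIV T" and bS: "bounded_linear S"
    using T S by (auto intro: linear_continuous_on simp: linear_conv_bounded_linear)
  have TV: "T -` ball 0 1 = S ` ball 0 1"
    using TS ST by (auto intro!: image_eqI[where f=S])
  have "open (T -` ball 0 1)"
    using cT by (intro open_vimage) (auto simp: continuous_on_eq_continuous_at)
  moreover have "0 \<in> T -` ball 0 1" using linear_0[OF T] by simp
  ultimately obtain e where e: "e > 0" "ball 0 e \<subseteq> T -` ball 0 1"
    by (meson open_contains_ball)
  have opn: "T -` ball 0 1 \<in> sets borel" using \<open>open (T -` ball 0 1)\<close> by simp
  have "0 < emeasure lborel (ball (0::'a) e)"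
    using e by (simp add: emeasure_ball unit_ball_vol_pos ennreal_zero_less_mult_iff)
  also have "\<dots> \<le> V" unfolding V_def using e opn by (intro emeasure_mono) auto
  finally have V0: "0 < V" .
  have "bounded (T -` ball 0 1)" unfolding TV by (intro bounded_linear_image bS) auto
  then have V1: "V < \<infinity>" unfolding V_def using emeasure_bounded_finite by auto
  have U: "0 < U" "U < \<infinity>" unfolding U_def by (rule emeasure_unit_ball_pos_finite)+
  show ?thesis
  proof (rule that[of "U / V"])
    show "0 < U / V" using U V0 V1 by (simp add: ennreal_zero_less_divide)
    have "U / V \<noteq> top" using U V0 by (auto simp: ennreal_divide_eq_top_iff)
    then show "U / V < \<infinity>" by (simp add: less_top)
    fix F :: "'a \<Rightarrow> ennreal" and a assume [measurable]: "F \<in> borel_measurable borel"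
    have "(\<integral>\<^sup>+x. F x \<partial>lborel) * V = (\<integral>\<^sup>+x. F (x + a) \<partial>lborel) * V"
      by (simp add: nn_integral_lborel_translate)
    also have "\<dots> = U * (\<integral>\<^sup>+y. F (T y + a) \<partial>lborel)"
      unfolding U_def V_def
      by (rule nn_integral_lborel_linear_aux[OF T S TS]) measurable
    finally have "(\<integral>\<^sup>+x. F x \<partial>lborel) * V / V = U * (\<integral>\<^sup>+y. F (a + T y) \<partial>lborel) / V"
      by (simp add: add.commute)
    moreover have "(\<integral>\<^sup>+x. F x \<partial>lborel) * V / V = (\<integral>\<^sup>+x. F x \<partial>lborel)"
      using V0 V1 by (simp add: ennreal_mult_divide_eq)
    moreover have "U * (\<integral>\<^sup>+y. F (a + T y) \<partial>lborel) / V = U / V * (\<integral>\<^sup>+y. F (a + T y) \<partial>lborel)"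
      by (simp add: divide_ennreal_def mult_ac)
    ultimately show "(\<integral>\<^sup>+x. F x \<partial>lborel) = U / V * (\<integral>\<^sup>+y. F (a + T y) \<partial>lborel)" by simp
  qed
qed

lemma nn_integral_lborel_isometry:
  fixes T S :: "'a::euclidean_space \<Rightarrow> 'a"
  assumes T: "linear T" and S: "linear S" and TS: "\<And>x. T (S x) = x"
    and iso: "\<And>x. norm (T x) = norm x" and [measurable]: "F \<in> borel_measurable borel"
  shows "(\<integral>\<^sup>+y. F (T y) \<partial>lborel) = (\<integral>\<^sup>+x. F x \<partial>lborel)"
proof -
  have "T -` ball 0 1 = ball 0 1" by (auto simp: iso)
  with nn_integral_lborel_linear_aux[OF T S TS, of F] emeasure_unit_ball_pos_finite[where 'a='a]
  have "emeasure lborel (ball (0::'a) 1) * (\<integral>\<^sup>+x. F x \<partial>lborel)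
      = emeasure lborel (ball (0::'a) 1) * (\<integral>\<^sup>+y. F (T y) \<partial>lborel)"
    by (simp add: mult.commute)
  then show ?thesis using emeasure_unit_ball_pos_finite[where 'a='a]
    by (subst (asm) ennreal_mult_cancel_left) auto
qed

lemma linear_vector_scalar_mult: "linear (\<lambda>w::complex^'n. c *s w)"
  by (rule linearI) (auto simp: vec_eq_iff algebra_simps scaleR_conv_of_real)

lemma norm_vector_scalar_mult: "norm (c *s w) = cmod c * norm (w::complex^'n)"
  by (simp add: norm_vec_def norm_mult L2_set_right_distrib)

lemma continuous_on_vector_scalar_mult[continuous_intros]:
  "continuous_on A f \<Longrightarrow> continuous_on A g \<Longrightarrow> continuous_on A (\<lambda>x. f x *s (g x :: complex^'n))"
  unfolding vector_scalar_mult_def by (intro continuous_intros)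

lemma borel_measurable_vector_scalar_mult[measurable]:
  assumes [measurable]: "f \<in> borel_measurable M" "g \<in> borel_measurable M"
  shows "(\<lambda>x. f x *s (g x :: complex^'n)) \<in> borel_measurable M"
  by (rule borel_measurable_continuous_Pair[OF assms]) (intro continuous_intros)

text \<open>
  Multiplication by a unimodular scalar is an isometry, so an integral over \<open>\<complex>\<^sup>n\<close> can be computed by
  first averaging over the circles through each point.
\<close>
lemma nn_integral_circle_average:
  fixes F :: "complex ^ 'n \<Rightarrow> ennreal"
  assumes [measurable]: "F \<in> borel_measurable borel"
  shows "(\<integral>\<^sup>+w. (\<integral>\<^sup>+t\<in>{0..1}. F (cis (2 * pi * t) *s w) \<partial>lborel) \<partial>lborel) = (\<integral>\<^sup>+w. F w \<partial>lborel)"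
proof -
  have [measurable]: "(\<lambda>t. cis (2 * pi * t)) \<in> borel_measurable borel"
    by (intro borel_measurable_continuous_onI continuous_intros)
  have "(\<integral>\<^sup>+w. (\<integral>\<^sup>+t\<in>{0..1}. F (cis (2 * pi * t) *s w) \<partial>lborel) \<partial>lborel)
      = (\<integral>\<^sup>+t. (\<integral>\<^sup>+w. F (cis (2 * pi * t) *s w) * indicator {0..1} t \<partial>lborel) \<partial>lborel)"
    by (rule lborel_pair.Fubini') measurable
  also have "\<dots> = (\<integral>\<^sup>+t. (\<integral>\<^sup>+w. F w \<partial>lborel) * indicator {0..1::real} t \<partial>lborel)"
  proof (intro nn_integral_cong)
    fix t :: real
    have "(\<integral>\<^sup>+w. F (cis (2 * pi * t) *s w) * indicator {0..1} t \<partial>lborel)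
        = (\<integral>\<^sup>+w. F (cis (2 * pi * t) *s w) \<partial>lborel) * indicator {0..1} t"
      by (rule nn_integral_multc) measurable
    also have "(\<integral>\<^sup>+w. F (cis (2 * pi * t) *s w) \<partial>lborel) = (\<integral>\<^sup>+w. F w \<partial>lborel)"
      by (rule nn_integral_lborel_isometry[where S="\<lambda>w. cis (- (2 * pi * t)) *s w"])
         (auto simp: linear_vector_scalar_mult norm_vector_scalar_mult vector_smult_assoc cis_mult)
    finally show "(\<integral>\<^sup>+w. F (cis (2 * pi * t) *s w) * indicator {0..1} t \<partial>lborel)
      = (\<integral>\<^sup>+w. F w \<partial>lborel) * indicator {0..1::real} t" .
  qed
  also have "\<dots> = (\<integral>\<^sup>+w. F w \<partial>lborel)"
    by (subst nn_integral_cmult) auto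
  finally show ?thesis .
qed

section \<open>Mean values of holomorphic functions over circles\<close>

lemma circle_mean_value:
  assumes hol: "F holomorphic_on ball 0 R" and R: "R > 1"
  shows "((\<lambda>t. F (cis (2 * pi * t))) has_integral F 0) {0..1}"
proof -
  have "F holomorphic_on cball 0 1"
    using R by (intro holomorphic_on_subset[OF hol]) auto
  then have "((\<lambda>u. F u / (u - 0)) has_contour_integral (2 * of_real pi * \<i> * F 0)) (circlepath 0 1)"
    by (rule Cauchy_integral_circlepath_simple) simp
  then have "((\<lambda>t. F (cis (2 * pi * t)) / cis (2 * pi * t) * (2 * pi * \<i> * cis (2 * pi * t)))
      has_integral (2 * of_real pi * \<i> * F 0)) {0..1}"
    unfolding has_contour_integral vector_derivative_circlepath
    by (simp add: circlepath vector_derivative_circlepath01 cis_conv_exp mult_ac cong: has_integral_cong)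
  then have "((\<lambda>t. (2 * of_real pi * \<i>) * F (cis (2 * pi * t))) has_integral (2 * of_real pi * \<i> * F 0)) {0..1}"
    by (simp add: mult_ac)
  then have "((\<lambda>t. inverse (2 * of_real pi * \<i>) * ((2 * of_real pi * \<i>) * F (cis (2 * pi * t))))
     has_integral (inverse (2 * of_real pi * \<i>) * (2 * of_real pi * \<i> * F 0))) {0..1}"
    by (rule has_integral_mult_right)
  then show ?thesis by (simp add: field_simps)
qed

text \<open>
  Parseval for two terms: \<open>F - F 0\<close> has mean zero over the circle by Cauchy's formula, hence is
  orthogonal to the constant \<open>F 0\<close>. The identity serves as a lower bound for the division energy and
  as an upper bound for the energy of a function that is nearly constant.
\<close>
lemma circle_mean_square:
  assumes hol: "F holomorphic_on ball 0 R" and R: "R > 1"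
  shows "(\<integral>\<^sup>+t\<in>{0..1}. ennreal ((cmod (F (cis (2 * pi * t))))\<^sup>2) \<partial>lborel)
       = ennreal ((cmod (F 0))\<^sup>2) + (\<integral>\<^sup>+t\<in>{0..1}. ennreal ((cmod (F (cis (2 * pi * t)) - F 0))\<^sup>2) \<partial>lborel)"
proof -
  let ?f = "\<lambda>t. F (cis (2 * pi * t))"
  have cont: "continuous_on {0..1} ?f"
    using R by (intro continuous_intros continuous_on_compose2[OF holomorphic_on_imp_continuous_on[OF hol]]) auto
  have m: "(?f has_integral F 0) {0..1}" by (rule circle_mean_value[OF assms])
  have "((\<lambda>t. ?f t - F 0) has_integral (F 0 - F 0)) {0..1}"
    by (rule has_integral_diff[OF m]) (use has_integral_const_real[of "F 0" 0 1] in simp)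
  then have "((\<lambda>t. 2 * (F 0 \<bullet> (?f t - F 0))) has_integral 2 * (F 0 \<bullet> 0)) {0..1}"
    by (intro has_integral_mult_right has_integral_linear[OF _ bounded_linear_inner_right, unfolded o_def]) simp
  then have z: "((\<lambda>t. 2 * (F 0 \<bullet> (?f t - F 0))) has_integral 0) {0..1}" by simp
  define B where "B = integral {0..1} (\<lambda>t. (cmod (?f t - F 0))\<^sup>2)"
  have B: "((\<lambda>t. (cmod (?f t - F 0))\<^sup>2) has_integral B) {0..1}"
    unfolding B_def by (intro integrable_integral integrable_continuous_real continuous_intros cont)
  have B0: "B \<ge> 0" by (rule has_integral_nonneg[OF B]) simp
  have "((\<lambda>t. (cmod (F 0))\<^sup>2 + (2 * (F 0 \<bullet> (?f t - F 0)) + (cmod (?f t - F 0))\<^sup>2)) has_integral ((cmod (F 0))\<^sup>2 + (0 + B))) {0..1}"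
    by (intro has_integral_add z B) (use has_integral_const_real[of "(cmod (F 0))\<^sup>2" 0 1] in simp)
  moreover have "(cmod (F 0))\<^sup>2 + (2 * (F 0 \<bullet> (?f t - F 0)) + (cmod (?f t - F 0))\<^sup>2) = (cmod (?f t))\<^sup>2" for t
    by (simp add: power2_norm_eq_inner inner_diff inner_commute)
  ultimately have A: "((\<lambda>t. (cmod (?f t))\<^sup>2) has_integral ((cmod (F 0))\<^sup>2 + B)) {0..1}" by simp
  have nn: "(\<integral>\<^sup>+t\<in>{0..1}. ennreal (g t) \<partial>lborel) = ennreal I"
    if "continuous_on {0..1} g" "\<And>t. 0 \<le> g t" "(g has_integral I) {0..1}" for g :: "real \<Rightarrow> real" and I
    by (rule nn_integral_has_integral_lebesgue'[OF _ that(3)]) (use that in auto)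
  have "(\<integral>\<^sup>+t\<in>{0..1}. ennreal ((cmod (?f t))\<^sup>2) \<partial>lborel) = ennreal ((cmod (F 0))\<^sup>2 + B)"
    by (intro nn A continuous_intros cont) auto
  moreover have "(\<integral>\<^sup>+t\<in>{0..1}. ennreal ((cmod (?f t - F 0))\<^sup>2) \<partial>lborel) = ennreal B"
    by (intro nn B continuous_intros cont) auto
  ultimately show ?thesis using B0 by simp
qed

section \<open>Radial moments\<close>

lemma set_integrable_ball_continuous:
  fixes g :: "'a::euclidean_space \<Rightarrow> real"
  assumes "continuous_on UNIV g"
  shows "set_integrable lborel (ball a r) g"
proof -
  have "set_integrable lborel (cball a r) g"
    unfolding set_integrable_def
    by (rule borel_integrable_compact) (auto intro: continuous_on_subset[OF assms])
  then show ?thesis by (rule set_integrable_subset) auto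
qed

lemma lborel_integral_scale:
  fixes f :: "'a::euclidean_space \<Rightarrow> real"
  assumes c: "c > 0" and [measurable]: "f \<in> borel_measurable borel"
  shows "(LINT y|lborel. f y) = c ^ DIM('a) * (LINT x|lborel. f (c *\<^sub>R x))"
proof -
  have "(LINT y|lborel. f y) = (LINT y|density (distr lborel borel (\<lambda>x. 0 + c *\<^sub>R x)) (\<lambda>_. ennreal (\<bar>c\<bar> ^ DIM('a))). f y)"
    using lborel_affine[of c "0::'a"] c by simp
  also have "\<dots> = (LINT y|distr lborel borel (\<lambda>x. 0 + c *\<^sub>R x). c ^ DIM('a) *\<^sub>R f y)"
    using c by (subst integral_density) auto
  also have "\<dots> = (LINT x|lborel. c ^ DIM('a) *\<^sub>R f (c *\<^sub>R x))"
    by (subst integral_distr) auto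
  finally show ?thesis by simp
qed

text \<open>
  The graph of the convex function \<open>t \<mapsto> (1 + t x)\<^sup>-\<^sup>S\<close> lies above its tangent at \<open>t = 1\<close>.
\<close>
lemma inverse_power_tangent_le:
  fixes x t :: real
  assumes "x \<ge> 0" "t \<ge> 1"
  shows "1 / (1 + x) ^ S - real S * (t - 1) * (x / (1 + x) ^ Suc S) \<le> 1 / (1 + t * x) ^ S"
proof -
  define a where "a = 1 + x"
  define b where "b = 1 + t * x"
  have ab: "0 < a" "a \<le> b" using assms by (auto simp: a_def b_def mult_left_mono mult_le_cancel_right1)
  have "1 - real S * ((b - a) / a) \<le> 1 + real S * (a / b - 1)"
  proof -
    have "1 - a / b = (b - a) / b" using ab by (simp add: field_simps)
    also have "\<dots> \<le> (b - a) / a" using ab by (intro divide_left_mono) auto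
    finally have "real S * (1 - a / b) \<le> real S * ((b - a) / a)" by (intro mult_left_mono) auto
    then show ?thesis by (simp add: algebra_simps)
  qed
  also have "\<dots> \<le> (1 + (a / b - 1)) ^ S"
    using ab by (intro Bernoulli_inequality) auto
  finally have "(1 - real S * ((b - a) / a)) / a ^ S \<le> (a / b) ^ S / a ^ S"
    using ab by (intro divide_right_mono) auto
  also have "(a / b) ^ S / a ^ S = 1 / b ^ S" using ab by (simp add: power_divide)
  also have "(1 - real S * ((b - a) / a)) / a ^ S = 1 / a ^ S - real S * (t - 1) * (x / a ^ Suc S)"
  proof -
    have "b - a = (t - 1) * x" by (simp add: a_def b_def algebra_simps)
    then show ?thesis by (simp add: diff_divide_distrib)
  qed
  finally show ?thesis by (simp add: a_def b_def)
qed

text \<open>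
  The divergence theorem for the radial field \<open>x |x|\<^sup>2\<^sup>j / (1 + |x|\<^sup>2)\<^sup>S\<close> on a ball, the last term being
  the flux through the sphere. The proof compares dilations instead of differentiating under the
  integral: rescaling by \<open>c \<ge> 1\<close> turns the integral over the ball of radius \<open>c r\<close> into one with
  \<open>1 + c\<^sup>2 |x|\<^sup>2\<close> in the denominator, and the tangent bound makes this an inequality between functions of \<open>c\<close> that is an
  equality at \<open>c = 1\<close>. The claim compares the derivatives there.
\<close>
lemma moment_flux_inequality:
  fixes r :: real and S j :: nat
  assumes r: "r > 0"
  defines "X \<equiv> (LINT x:ball (0::'a::euclidean_space) r|lborel. norm x ^ (2 * j) / (1 + (norm x)\<^sup>2) ^ S)"
    and "Y \<equiv> (LINT x:ball (0::'a) r|lborel. norm x ^ (2 * Suc j) / (1 + (norm x)\<^sup>2) ^ Suc S)"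
  shows "(real DIM('a) + 2 * real j) * X
    \<le> 2 * real S * Y + real DIM('a) * (measure lborel (ball (0::'a) r) * r ^ (2 * j) / (1 + r\<^sup>2) ^ S)"
proof (rule ccontr)
  define E where "E = measure lborel (ball (0::'a) r) * r ^ (2 * j) / (1 + r\<^sup>2) ^ S"
  assume "\<not> ?thesis"
  then have neg: "real DIM('a) * E - ((real DIM('a) + 2 * real j) * X - 2 * real S * Y) < 0"
    by (simp add: E_def)
  let ?f = "\<lambda>x::'a. norm x ^ (2 * j) / (1 + (norm x)\<^sup>2) ^ S"
  let ?g = "\<lambda>x::'a. norm x ^ (2 * Suc j) / (1 + (norm x)\<^sup>2) ^ Suc S"
  have p1: "1 + c * (norm x)\<^sup>2 \<noteq> 0" if "c \<ge> 0" for x :: 'a and c :: real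
    using that by (metis add_nonneg_pos add.commute less_irrefl mult_nonneg_nonneg zero_le_power2 zero_less_one)
  have cf: "continuous_on A ?f" and cg: "continuous_on A ?g" for A
    using p1[of 1] by (auto intro!: continuous_intros)
  have si: "set_integrable lborel (ball 0 R) ?f" "set_integrable lborel (ball 0 R) ?g" for R
    using cf cg by (auto intro: set_integrable_ball_continuous)
  have key: "c ^ (DIM('a) + 2 * j) * (X - real S * (c\<^sup>2 - 1) * Y) \<le> X + (c ^ DIM('a) - 1) * c ^ (2 * j) * E"
    if c: "c \<ge> 1" for c :: real
  proof -
    let ?h = "\<lambda>x::'a. norm x ^ (2 * j) / (1 + c\<^sup>2 * (norm x)\<^sup>2) ^ S"
    have ch: "continuous_on A ?h" for A
      using p1[of "c\<^sup>2"] by (auto intro!: continuous_intros)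
    have sih: "set_integrable lborel (ball 0 R) ?h" for R
      using ch by (auto intro: set_integrable_ball_continuous)
    have sy: "set_integrable lborel (ball (0::'a) r) (\<lambda>x. real S * (c\<^sup>2 - 1) * ?g x)"
      by (intro set_integrable_mult_right si(2))
    have "X - real S * (c\<^sup>2 - 1) * Y = (LINT x:ball (0::'a) r|lborel. ?f x - real S * (c\<^sup>2 - 1) * ?g x)"
      unfolding X_def Y_def
      by (simp only: set_integral_diff(2)[OF si(1) sy] set_integral_mult_right)
    also have "\<dots> \<le> (LINT x:ball (0::'a) r|lborel. ?h x)"
    proof (rule set_integral_mono)
      show "set_integrable lborel (ball 0 r) (\<lambda>x::'a. ?f x - real S * (c\<^sup>2 - 1) * ?g x)"
        by (rule set_integral_diff(1)[OF si(1) sy])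
      fix x :: 'a
      have "c\<^sup>2 \<ge> 1" using c by simp
      then have "norm x ^ (2 * j) * (1 / (1 + (norm x)\<^sup>2) ^ S - real S * (c\<^sup>2 - 1) * ((norm x)\<^sup>2 / (1 + (norm x)\<^sup>2) ^ Suc S))
        \<le> norm x ^ (2 * j) * (1 / (1 + c\<^sup>2 * (norm x)\<^sup>2) ^ S)"
        by (intro mult_left_mono inverse_power_tangent_le) auto
      also have "norm x ^ (2 * j) * (1 / (1 + (norm x)\<^sup>2) ^ S - real S * (c\<^sup>2 - 1) * ((norm x)\<^sup>2 / (1 + (norm x)\<^sup>2) ^ Suc S))
         = ?f x - real S * (c\<^sup>2 - 1) * ?g x"
        by (simp add: algebra_simps power2_eq_square)
      finally show "?f x - real S * (c\<^sup>2 - 1) * ?g x \<le> ?h x" by simp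
    qed (rule sih)
    finally have 1: "X - real S * (c\<^sup>2 - 1) * Y \<le> (LINT x:ball (0::'a) r|lborel. ?h x)" .
    have bm: "(\<lambda>x. indicator (ball (0::'a) (c * r)) x *\<^sub>R ?f x) \<in> borel_measurable borel"
      by (intro borel_measurable_scaleR borel_measurable_indicator borel_measurable_continuous_onI cf) simp
    have "(LINT x:ball (0::'a) (c * r)|lborel. ?f x) = c ^ DIM('a) * (LINT x|lborel. indicator (ball 0 (c * r)) (c *\<^sub>R x) * ?f (c *\<^sub>R x))"
      unfolding set_lebesgue_integral_def using lborel_integral_scale[OF _ bm, of c] c by simp
    also have "(LINT x|lborel. indicator (ball 0 (c * r)) (c *\<^sub>R x) * ?f (c *\<^sub>R x)) = (LINT x|lborel. c ^ (2 * j) * (indicator (ball (0::'a) r) x * ?h x))"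
      using c by (intro Bochner_Integration.integral_cong) (auto simp: indicator_def power_mult_distrib)
    also have "\<dots> = c ^ (2 * j) * (LINT x:ball (0::'a) r|lborel. ?h x)"
      unfolding set_lebesgue_integral_def real_scaleR_def by (rule integral_mult_right_zero)
    finally have 2: "(LINT x:ball (0::'a) (c * r)|lborel. ?f x) = c ^ (DIM('a) + 2 * j) * (LINT x:ball (0::'a) r|lborel. ?h x)"
      by (simp add: power_add)
    \<comment> \<open>The shell between the two balls contributes the flux term.\<close>
    have sub: "ball (0::'a) r \<subseteq> ball 0 (c * r)"
      using c r by (intro subset_ball) (simp add: mult_le_cancel_right1)
    define Q where "Q = ball (0::'a) (c * r) - ball 0 r"
    have "(LINT x:ball (0::'a) (c * r)|lborel. ?f x) = (LINT x:ball (0::'a) r \<union> Q|lborel. ?f x)"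
      using sub by (simp add: Q_def Un_absorb1 Un_commute)
    also have "\<dots> = X + (LINT x:Q|lborel. ?f x)"
      unfolding X_def
      by (intro set_integral_Un si set_integrable_subset[OF si(1)[of "c * r"]]) (auto simp: Q_def)
    also have "(LINT x:Q|lborel. ?f x) \<le> (LINT x:Q|lborel. (c * r) ^ (2 * j) / (1 + r\<^sup>2) ^ S)"
    proof (rule set_integral_mono)
      show "set_integrable lborel Q ?f"
        by (rule set_integrable_subset[OF si(1)[of "c * r"]]) (auto simp: Q_def)
      show "set_integrable lborel Q (\<lambda>x. (c * r) ^ (2 * j) / (1 + r\<^sup>2) ^ S)"
        by (rule set_integrable_subset[OF set_integrable_ball_continuous[of _ 0 "c * r"]]) (auto simp: Q_def)
      fix x assume "x \<in> Q"
      then have "norm x \<le> c * r" "r \<le> norm x" by (auto simp: Q_def)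
      then show "?f x \<le> (c * r) ^ (2 * j) / (1 + r\<^sup>2) ^ S"
        using r by (intro frac_le power_mono add_left_mono add_pos_pos zero_less_power) auto
    qed
    also have "(LINT x:Q|lborel. (c * r) ^ (2 * j) / (1 + r\<^sup>2) ^ S) = measure lborel Q * ((c * r) ^ (2 * j) / (1 + r\<^sup>2) ^ S)"
      unfolding set_lebesgue_integral_def by (simp add: Q_def)
    also have "measure lborel Q = measure lborel (ball (0::'a) (c * r)) - measure lborel (ball (0::'a) r)"
      unfolding Q_def using sub emeasure_lborel_ball_finite[of "0::'a" "c * r"]
      by (intro measure_Diff) auto
    also have "\<dots> = (c ^ DIM('a) - 1) * measure lborel (ball (0::'a) r)"
      using c r by (simp add: content_ball power_mult_distrib algebra_simps)
    finally have 3: "(LINT x:ball (0::'a) (c * r)|lborel. ?f x) \<le> X + (c ^ DIM('a) - 1) * c ^ (2 * j) * E"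
      by (simp add: E_def power_mult_distrib mult_ac)
    have "c ^ (DIM('a) + 2 * j) * (X - real S * (c\<^sup>2 - 1) * Y) \<le> c ^ (DIM('a) + 2 * j) * (LINT x:ball (0::'a) r|lborel. ?h x)"
      using c by (intro mult_left_mono 1) auto
    with 2 3 show ?thesis by simp
  qed
  define \<Phi> where "\<Phi> c = X + (c ^ DIM('a) - 1) * c ^ (2 * j) * E - c ^ (DIM('a) + 2 * j) * (X - real S * (c\<^sup>2 - 1) * Y)" for c
  have "(\<Phi> has_real_derivative (real DIM('a) * E - ((real DIM('a) + 2 * real j) * X - 2 * real S * Y))) (at 1)"
    unfolding \<Phi>_def by (auto intro!: derivative_eq_intros simp: algebra_simps)
  from has_real_derivative_neg_dec_right[OF this neg]
  obtain d where "d > 0" "\<And>h. 0 < h \<Longrightarrow> h < d \<Longrightarrow> \<Phi> (1 + h) < \<Phi> 1" by auto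
  from this(2)[of "d / 2"] this(1) have "\<Phi> (1 + d / 2) < \<Phi> 1" by simp
  moreover have "\<Phi> 1 = 0" by (simp add: \<Phi>_def)
  moreover have "\<Phi> (1 + d / 2) \<ge> 0" using key[of "1 + d / 2"] \<open>d > 0\<close> by (simp add: \<Phi>_def)
  ultimately show False by simp
qed

lemma lborel_distr_isometry:
  fixes T S :: "'a::euclidean_space \<Rightarrow> 'a"
  assumes T: "linear T" and S: "linear S" and TS: "\<And>x. T (S x) = x"
    and iso: "\<And>x. norm (T x) = norm x"
  shows "distr lborel borel T = lborel"
proof (rule measure_eqI)
  have [measurable]: "T \<in> borel_measurable borel"
    using T by (intro borel_measurable_continuous_onI linear_continuous_on) (simp add: linear_conv_bounded_linear)
  fix A assume "A \<in> sets (distr lborel borel T)"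
  then have [measurable]: "A \<in> sets borel" by simp
  have "emeasure (distr lborel borel T) A = (\<integral>\<^sup>+x. indicator A x \<partial>distr lborel borel T)" by simp
  also have "\<dots> = (\<integral>\<^sup>+y. indicator A (T y) \<partial>lborel)" by (rule nn_integral_distr) auto
  also have "\<dots> = (\<integral>\<^sup>+y. indicator A y \<partial>lborel)" by (rule nn_integral_lborel_isometry[OF assms]) auto
  finally show "emeasure (distr lborel borel T) A = emeasure lborel A" by simp
qed simp

lemma norm_vec_complex_sq: "(norm (w::complex^'n))\<^sup>2 = (\<Sum>j\<in>UNIV. (cmod (w $ j))\<^sup>2)"
  by (simp add: norm_vec_def L2_set_def sum_nonneg)

lemma norm_coordinate_swap:
  "norm (\<chi> i. (w::complex^'n) $ Transposition.transpose k l i) = norm w"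
proof -
  have "bij_betw (Transposition.transpose k l) UNIV UNIV" by (rule bij_transpose)
  then have "(\<Sum>j\<in>UNIV. (cmod (w $ Transposition.transpose k l j))\<^sup>2) = (\<Sum>j\<in>UNIV. (cmod (w $ j))\<^sup>2)"
    by (rule sum.reindex_bij_betw)
  then have "(norm (\<chi> i. w $ Transposition.transpose k l i))\<^sup>2 = (norm w)\<^sup>2"
    by (simp add: norm_vec_complex_sq)
  then show ?thesis by simp
qed

lemma ball_integral_coordinate_swap:
  fixes G :: "real \<Rightarrow> real" and k l :: "'n::finite"
  assumes G: "continuous_on UNIV G"
  shows "(LINT w:ball (0::complex^'n) r|lborel. (cmod (w $ k))\<^sup>2 * G (norm w)) = (LINT w:ball (0::complex^'n) r|lborel. (cmod (w $ l))\<^sup>2 * G (norm w))"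
proof -
  define T :: "complex^'n \<Rightarrow> complex^'n" where "T w = (\<chi> i. w $ Transposition.transpose k l i)" for w
  have lin: "linear T" by (rule linearI) (auto simp: T_def vec_eq_iff)
  have TT: "T (T w) = w" for w by (simp add: T_def vec_eq_iff)
  have no: "norm (T w) = norm w" for w unfolding T_def by (rule norm_coordinate_swap)
  have [measurable]: "T \<in> borel_measurable borel"
    using lin by (intro borel_measurable_continuous_onI linear_continuous_on) (simp add: linear_conv_bounded_linear)
  have [measurable]: "G \<in> borel_measurable borel" using G by (rule borel_measurable_continuous_onI)
  have [measurable]: "(\<lambda>w::complex^'n. w $ i) \<in> borel_measurable borel" for i
    by (intro borel_measurable_continuous_onI continuous_intros)
  have [measurable]: "ball (0::complex^'n) r \<in> sets borel" by simp
  have "(LINT w:ball (0::complex^'n) r|lborel. (cmod (w $ k))\<^sup>2 * G (norm w))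
     = (LINT w|distr lborel borel T. indicator (ball 0 r) w *\<^sub>R ((cmod (w $ k))\<^sup>2 * G (norm w)))"
    unfolding set_lebesgue_integral_def by (simp add: lborel_distr_isometry[OF lin lin TT no])
  also have "\<dots> = (LINT w|lborel. indicator (ball 0 r) (T w) *\<^sub>R ((cmod (T w $ k))\<^sup>2 * G (norm (T w))))"
    by (rule integral_distr) measurable
  also have "\<dots> = (LINT w:ball (0::complex^'n) r|lborel. (cmod (w $ l))\<^sup>2 * G (norm w))"
    unfolding set_lebesgue_integral_def
    by (intro Bochner_Integration.integral_cong) (auto simp: no indicator_def, simp add: T_def)
  finally show ?thesis .
qed

text \<open>
  The coordinates contribute equally to \<open>|w|\<^sup>2\<close>, by symmetry under transpositions.
\<close>
lemma ball_integral_coordinate: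
  fixes G :: "real \<Rightarrow> real" and k :: "'n::finite"
  assumes G: "continuous_on UNIV G"
  shows "(LINT w:ball (0::complex^'n) r|lborel. (cmod (w $ k))\<^sup>2 * G (norm w))
     = (LINT w:ball (0::complex^'n) r|lborel. (norm w)\<^sup>2 * G (norm w)) / real CARD('n)"
proof -
  let ?I = "\<lambda>j. LINT w:ball (0::complex^'n) r|lborel. (cmod (w $ j))\<^sup>2 * G (norm w)"
  have "(LINT w:ball (0::complex^'n) r|lborel. (norm w)\<^sup>2 * G (norm w))
    = (LINT w:ball (0::complex^'n) r|lborel. (\<Sum>j\<in>UNIV. (cmod (w $ j))\<^sup>2 * G (norm w)))"
    by (simp add: norm_vec_complex_sq sum_distrib_right)
  also have "\<dots> = (\<Sum>j\<in>UNIV. ?I j)"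
    unfolding set_lebesgue_integral_def scaleR_sum_right
    by (intro Bochner_Integration.integral_sum
          set_integrable_ball_continuous[unfolded set_integrable_def] continuous_intros continuous_on_compose2[OF G]) auto
  also have "\<dots> = (\<Sum>j\<in>(UNIV::'n set). ?I k)"
    by (intro sum.cong refl ball_integral_coordinate_swap G)
  finally show ?thesis by simp
qed

text \<open>
  With the moments \<open>M\<^sub>j\<close> of weight \<open>(1 + |w|\<^sup>2)\<^sup>-\<^sup>s\<^sup>-\<^sup>1\<close>, \<open>s = n (1 + N)\<close>, the negation says
  \<open>N (M\<^sub>1 + \<beta> M\<^sub>2) \<le> M\<^sub>0 + (\<tau>/n + 4 \<eta>) M\<^sub>1 + C (1 + r\<^sup>2)\<^sup>-\<^sup>s\<close> with \<open>\<beta> = \<tau>/n - \<eta>\<close>. The flux inequality for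
  \<open>j = 0\<close> cancels \<open>M\<^sub>0\<close> against \<open>N M\<^sub>1\<close> and for \<open>j = 1\<close> replaces \<open>n N M\<^sub>2\<close> by \<open>(n + 1) M\<^sub>1\<close>. What
  remains is \<open>\<gamma> M\<^sub>1 \<le> K (1 + r\<^sup>2)\<^sup>-\<^sup>s\<close> with \<open>\<gamma> = \<tau>/n - (5 n + 1) \<eta> > 0\<close>, whereas the part of the
  ball of radius \<open>r/2\<close> alone makes \<open>M\<^sub>1\<close> at least a multiple of \<open>(1 + r\<^sup>2/4)\<^sup>-\<^sup>s\<^sup>-\<^sup>1\<close>.
\<close>
lemma radial_inequality_contradiction:
  fixes k :: "'n::finite" and r \<tau> \<eta> C :: real
  assumes r: "r > 0" and \<eta>: "\<eta> > 0" and \<tau>: "(5 * real CARD('n) + 1) * \<eta> < \<tau> / real CARD('n)" and C: "C \<ge> 0"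
  shows "\<exists>N\<ge>1::nat. 
     (LINT w:ball (0::complex^'n) r|lborel. (1 + \<tau> * (cmod (w $ k))\<^sup>2 + 4 * \<eta> * (norm w)\<^sup>2) / (1 + (norm w)\<^sup>2) ^ Suc (CARD('n) * (1 + N)))
       + C / (1 + r\<^sup>2) ^ (CARD('n) * (1 + N))
     < real N * (LINT w:ball (0::complex^'n) r|lborel. (norm w)\<^sup>2 * (1 + \<tau> * (cmod (w $ k))\<^sup>2 - \<eta> * (norm w)\<^sup>2) / (1 + (norm w)\<^sup>2) ^ Suc (CARD('n) * (1 + N)))"
proof (rule ccontr)
  assume neg: "\<not> ?thesis"
  define n where "n = real CARD('n)"
  define V where "V = measure lborel (ball (0::complex^'n) r)"
  define \<beta> where "\<beta> = \<tau> / n - \<eta>"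
  define \<gamma> where "\<gamma> = \<tau> / n - (5 * n + 1) * \<eta>"
  define K where "K = n * V * (1 + \<beta> * r\<^sup>2) + n * C"
  define Q where "Q = ball (0::complex^'n) (r/2) - ball 0 (r/4)"
  define m where "m = measure lborel Q * (r/4)\<^sup>2"
  have n1: "n \<ge> 1" by (simp add: n_def Suc_leI)
  have \<gamma>0: "\<gamma> > 0" using \<tau> by (simp add: \<gamma>_def n_def)
  have \<beta>0: "\<beta> > 0" using \<gamma>0 n1 \<eta> by (simp add: \<gamma>_def \<beta>_def algebra_simps) (smt (verit) mult_pos_pos)
  have "measure lborel Q = measure lborel (ball (0::complex^'n) (r/2)) - measure lborel (ball (0::complex^'n) (r/4))"
    unfolding Q_def using emeasure_lborel_ball_finite[of "0::complex^'n" "r / 2"] r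
    by (intro measure_Diff) auto
  also have "\<dots> > 0"
    using r by (auto simp: content_ball power_divide intro!: mult_strict_left_mono divide_strict_left_mono power_strict_mono unit_ball_vol_pos)
  finally have m0: "m > 0" using r by (simp add: m_def)
  have V0: "V \<ge> 0" by (simp add: V_def)
  have main: "\<gamma> * m / (1 + r\<^sup>2 / 4) ^ Suc (CARD('n) * (1 + N)) \<le> K / (1 + r\<^sup>2) ^ (CARD('n) * (1 + N))" if N: "N \<ge> 1" for N
  proof -
    define s where "s = CARD('n) * (1 + N)"
    define M where "M j = (LINT w:ball (0::complex^'n) r|lborel. norm w ^ (2 * j) / (1 + (norm w)\<^sup>2) ^ Suc s)" for j
    have p1: "1 + (norm x)\<^sup>2 \<noteq> 0" for x :: "complex^'n"
      by (metis add_nonneg_pos add.commute less_irrefl zero_le_power2 zero_less_one)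
    have si: "set_integrable lborel (ball 0 R) (\<lambda>w::complex^'n. norm w ^ j / (1 + (norm w)\<^sup>2) ^ Suc s)" for R j
      using p1 by (intro set_integrable_ball_continuous continuous_intros) (auto simp del: power_Suc)
    have X: "(LINT w:ball (0::complex^'n) r|lborel. norm w ^ (2 * j) / (1 + (norm w)\<^sup>2) ^ s) = M j + M (Suc j)" for j
    proof -
      have "norm w ^ (2 * j) / (1 + (norm w)\<^sup>2) ^ s
        = norm w ^ (2 * j) / (1 + (norm w)\<^sup>2) ^ Suc s + norm w ^ (2 * Suc j) / (1 + (norm w)\<^sup>2) ^ Suc s" for w :: "complex^'n"
      proof -
        have "norm w ^ (2 * j) / (1 + (norm w)\<^sup>2) ^ s = norm w ^ (2 * j) * (1 + (norm w)\<^sup>2) / (1 + (norm w)\<^sup>2) ^ Suc s"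
          using p1[of w] by simp
        then show ?thesis by (simp only: distrib_left add_divide_distrib) (simp add: power2_eq_square mult_ac)
      qed
      then show ?thesis
        unfolding M_def by (simp only: set_integral_add(2)[OF si si])
    qed
    have flux: "(n + j) * (M j + M (Suc j)) \<le> s * M (Suc j) + n * (V * r ^ (2 * j) / (1 + r\<^sup>2) ^ s)" for j :: nat
    proof -
      define E where "E = V * r ^ (2 * j) / (1 + r\<^sup>2) ^ s"
      have "(real DIM(complex^'n) + 2 * real j) * (M j + M (Suc j)) \<le> 2 * real s * M (Suc j) + real DIM(complex^'n) * E"
        using moment_flux_inequality[OF r, where 'a="complex^'n" and j=j and S=s]
        unfolding X M_def[symmetric] V_def[symmetric] E_def .
      then have "2 * ((n + j) * (M j + M (Suc j))) \<le> 2 * (s * M (Suc j) + n * E)"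
        by (simp add: n_def algebra_simps)
      then show ?thesis unfolding E_def by simp
    qed
    have sn: "real s = n * (1 + N)" by (simp add: s_def n_def distrib_left)
    have f0: "n * M 0 \<le> n * N * M 1 + n * (V / (1 + r\<^sup>2) ^ s)"
      using flux[of 0] by (simp add: sn algebra_simps)
    have M2: "M 2 \<ge> 0" unfolding M_def set_lebesgue_integral_def by (intro integral_nonneg_AE) auto
    have f1: "(n + 1) * M 1 \<le> n * N * M 2 + n * (V * r\<^sup>2 / (1 + r\<^sup>2) ^ s)"
      using flux[of 1] M2 by (simp add: sn algebra_simps numeral_2_eq_2)
    have kmom: "(LINT w:ball (0::complex^'n) r|lborel. (cmod (w $ k))\<^sup>2 * (norm w ^ (2 * j) / (1 + (norm w)\<^sup>2) ^ Suc s)) = M (Suc j) / n" for j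
    proof -
      have "continuous_on UNIV (\<lambda>x::real. x ^ (2 * j) / (1 + x\<^sup>2) ^ Suc s)"
      proof (intro continuous_intros ballI)
        fix x :: real have "0 < 1 + x\<^sup>2" by (simp add: add_pos_nonneg)
        then show "(1 + x\<^sup>2) ^ Suc s \<noteq> 0" by simp
      qed
      from ball_integral_coordinate[OF this, of r k] show ?thesis
        by (simp add: M_def n_def power2_eq_square mult_ac)
    qed
    have ksi: "set_integrable lborel (ball 0 R) (\<lambda>w::complex^'n. (cmod (w $ k))\<^sup>2 * (norm w ^ j / (1 + (norm w)\<^sup>2) ^ Suc s))" for R j
      using p1 by (intro set_integrable_ball_continuous continuous_intros) (auto simp del: power_Suc)
    have sk: "set_integrable lborel (ball 0 R) (\<lambda>w::complex^'n. c * ((cmod (w $ k))\<^sup>2 * (norm w ^ j / (1 + (norm w)\<^sup>2) ^ Suc s)))" for R c j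
      by (intro set_integrable_mult_right ksi)
    have sc: "set_integrable lborel (ball 0 R) (\<lambda>w::complex^'n. c * (norm w ^ j / (1 + (norm w)\<^sup>2) ^ Suc s))" for R c j
      by (intro set_integrable_mult_right si)
    have R: "(LINT w:ball (0::complex^'n) r|lborel. (1 + \<tau> * (cmod (w $ k))\<^sup>2 + 4 * \<eta> * (norm w)\<^sup>2) / (1 + (norm w)\<^sup>2) ^ Suc s)
       = M 0 + (\<tau> * (M 1 / n) + 4 * \<eta> * M 1)"
    proof -
      have "(LINT w:ball (0::complex^'n) r|lborel. (1 + \<tau> * (cmod (w $ k))\<^sup>2 + 4 * \<eta> * (norm w)\<^sup>2) / (1 + (norm w)\<^sup>2) ^ Suc s)
        = (LINT w:ball (0::complex^'n) r|lborel. norm w ^ (2 * 0) / (1 + (norm w)\<^sup>2) ^ Suc s +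
            (\<tau> * ((cmod (w $ k))\<^sup>2 * (norm w ^ (2 * 0) / (1 + (norm w)\<^sup>2) ^ Suc s)) + 4 * \<eta> * (norm w ^ (2 * 1) / (1 + (norm w)\<^sup>2) ^ Suc s)))"
        by (simp add: add_divide_distrib add.assoc del: power_Suc)
      also have "\<dots> = M 0 + (\<tau> * (M 1 / n) + 4 * \<eta> * M 1)"
        by (simp only: set_integral_add(2)[OF si set_integral_add(1)[OF sk sc]] set_integral_add(2)[OF sk sc]
            set_integral_mult_right kmom M_def) simp
      finally show ?thesis .
    qed
    have L: "(LINT w:ball (0::complex^'n) r|lborel. (norm w)\<^sup>2 * (1 + \<tau> * (cmod (w $ k))\<^sup>2 - \<eta> * (norm w)\<^sup>2) / (1 + (norm w)\<^sup>2) ^ Suc s)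
       = M 1 + (\<tau> * (M 2 / n) - \<eta> * M 2)"
    proof -
      have alg: "x\<^sup>2 * (1 + \<tau> * c - \<eta> * x\<^sup>2) / D = x ^ (2 * 1) / D + (\<tau> * (c * (x ^ (2 * 1) / D)) - \<eta> * (x ^ (2 * 2) / D))"
        for x c D :: real
        by (simp add: algebra_simps add_divide_distrib diff_divide_distrib power4_eq_xxxx power2_eq_square)
      have "(LINT w:ball (0::complex^'n) r|lborel. (norm w)\<^sup>2 * (1 + \<tau> * (cmod (w $ k))\<^sup>2 - \<eta> * (norm w)\<^sup>2) / (1 + (norm w)\<^sup>2) ^ Suc s)
        = (LINT w:ball (0::complex^'n) r|lborel. norm w ^ (2 * 1) / (1 + (norm w)\<^sup>2) ^ Suc s +
            (\<tau> * ((cmod (w $ k))\<^sup>2 * (norm w ^ (2 * 1) / (1 + (norm w)\<^sup>2) ^ Suc s)) - \<eta> * (norm w ^ (2 * 2) / (1 + (norm w)\<^sup>2) ^ Suc s)))"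
        by (simp only: alg)
      also have "\<dots> = M 1 + (\<tau> * (M 2 / n) - \<eta> * M 2)"
        by (simp only: set_integral_add(2)[OF si set_integral_diff(1)[OF sk sc]] set_integral_diff(2)[OF sk sc]
            set_integral_mult_right kmom M_def) (simp add: numeral_2_eq_2)
      finally show ?thesis .
    qed
    have "N * (M 1 + (\<tau> * (M 2 / n) - \<eta> * M 2)) \<le> M 0 + (\<tau> * (M 1 / n) + 4 * \<eta> * M 1) + C / (1 + r\<^sup>2) ^ s"
    proof -
      have "\<not> M 0 + (\<tau> * (M 1 / n) + 4 * \<eta> * M 1) + C / (1 + r\<^sup>2) ^ s < N * (M 1 + (\<tau> * (M 2 / n) - \<eta> * M 2))"
        using neg N unfolding R[symmetric] L[symmetric] s_def by blast
      then show ?thesis by simp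
    qed
    then have "n * (N * (M 1 + \<beta> * M 2)) \<le> n * (M 0 + (\<tau> / n + 4 * \<eta>) * M 1 + C / (1 + r\<^sup>2) ^ s)"
      using n1 by (intro mult_left_mono) (auto simp: \<beta>_def algebra_simps)
    then have a: "n * N * M 1 + \<beta> * (n * N * M 2) \<le> n * M 0 + (\<tau> + 4 * n * \<eta>) * M 1 + n * (C / (1 + r\<^sup>2) ^ s)"
      using n1 by (simp add: algebra_simps)
    have b: "\<beta> * ((n + 1) * M 1) \<le> \<beta> * (n * N * M 2 + n * (V * r\<^sup>2 / (1 + r\<^sup>2) ^ s))"
      using f1 \<beta>0 by (intro mult_left_mono) auto
    have "\<beta> * ((n + 1) * M 1) \<le> \<beta> * (n * (V * r\<^sup>2 / (1 + r\<^sup>2) ^ s)) + n * (V / (1 + r\<^sup>2) ^ s) + (\<tau> + 4 * n * \<eta>) * M 1 + n * (C / (1 + r\<^sup>2) ^ s)"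
      using a b f0 unfolding distrib_left by linarith
    also have "\<dots> = K / (1 + r\<^sup>2) ^ s + (\<tau> + 4 * n * \<eta>) * M 1"
      by (simp add: K_def add_divide_distrib algebra_simps)
    finally have "(\<beta> * (n + 1) - (\<tau> + 4 * n * \<eta>)) * M 1 \<le> K / (1 + r\<^sup>2) ^ s"
      by (simp add: algebra_simps)
    also have "\<beta> * (n + 1) - (\<tau> + 4 * n * \<eta>) = \<gamma>"
      using n1 by (simp add: \<beta>_def \<gamma>_def field_simps)
    finally have c: "\<gamma> * M 1 \<le> K / (1 + r\<^sup>2) ^ s" .
    have "m / (1 + r\<^sup>2 / 4) ^ Suc s = (LINT w:Q|lborel. (r/4)\<^sup>2 / (1 + r\<^sup>2 / 4) ^ Suc s)"
      unfolding set_lebesgue_integral_def by (simp add: Q_def m_def del: power_Suc)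
    also have "\<dots> \<le> (LINT w:Q|lborel. (norm w)\<^sup>2 / (1 + (norm w)\<^sup>2) ^ Suc s)"
    proof (rule set_integral_mono)
      show "set_integrable lborel Q (\<lambda>w. (norm w)\<^sup>2 / (1 + (norm w)\<^sup>2) ^ Suc s)"
        by (rule set_integrable_subset[OF si(1)[of "r"]]) (use r in \<open>auto simp: Q_def\<close>)
      show "set_integrable lborel Q (\<lambda>w. (r/4)\<^sup>2 / (1 + r\<^sup>2 / 4) ^ Suc s)"
        by (rule set_integrable_subset[OF set_integrable_ball_continuous[of _ 0 "r"]]) (use r in \<open>auto simp: Q_def\<close>)
      fix w assume "w \<in> Q"
      then have "norm w \<le> r/2" "r/4 \<le> norm w" by (auto simp: Q_def)
      moreover from this(1) have "(norm w)\<^sup>2 \<le> (r/2)\<^sup>2" by (intro power_mono) auto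
      ultimately show "(r/4)\<^sup>2 / (1 + r\<^sup>2 / 4) ^ Suc s \<le> (norm w)\<^sup>2 / (1 + (norm w)\<^sup>2) ^ Suc s"
        using r by (intro frac_le power_mono add_left_mono zero_less_power) (auto simp: power_divide intro: add_pos_nonneg)
    qed
    also have "\<dots> \<le> M 1"
    proof -
      have "set_integrable lborel Q (\<lambda>w. norm w ^ 2 / (1 + (norm w)\<^sup>2) ^ Suc s)"
        by (rule set_integrable_subset[OF si(1)[of "r"]]) (use r in \<open>auto simp: Q_def\<close>)
      moreover note si[of r 2]
      ultimately have "(LINT w:Q|lborel. (norm w)\<^sup>2 / (1 + (norm w)\<^sup>2) ^ Suc s) \<le> (LINT w:ball (0::complex^'n) r|lborel. (norm w)\<^sup>2 / (1 + (norm w)\<^sup>2) ^ Suc s)"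
        unfolding set_lebesgue_integral_def set_integrable_def using r
        by (intro integral_mono) (auto simp: Q_def indicator_def simp del: power_Suc intro!: divide_nonneg_pos zero_less_power add_pos_nonneg)
      then show ?thesis by (simp add: M_def del: power_Suc)
    qed
    finally have "\<gamma> * (m / (1 + r\<^sup>2 / 4) ^ Suc s) \<le> \<gamma> * M 1"
      using \<gamma>0 by (intro mult_left_mono) auto
    with c show ?thesis unfolding s_def[symmetric] by simp
  qed
  define \<rho> where "\<rho> = (1 + r\<^sup>2) / (1 + r\<^sup>2 / 4)"
  have den: "1 + r\<^sup>2 / 4 > 0" "1 + r\<^sup>2 > 0" by (auto intro: add_pos_nonneg)
  have \<rho>: "\<rho> > 1" unfolding \<rho>_def using den r by simp
  obtain N where N: "K * (1 + r\<^sup>2 / 4) / (\<gamma> * m) < \<rho> ^ N" using real_arch_pow[OF \<rho>] by blast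
  let ?s = "CARD('n) * (1 + Suc N)"
  have "\<gamma> * m / (1 + r\<^sup>2 / 4) ^ Suc ?s \<le> K / (1 + r\<^sup>2) ^ ?s" by (rule main) simp
  moreover have "Q / P \<le> K * a / x" if "x / (a * P) \<le> K / Q" "0 < x" "0 < a" "0 < P" "0 < Q" for x a P Q :: real
    using that by (simp add: field_simps)
  ultimately have "\<rho> ^ ?s \<le> K * (1 + r\<^sup>2 / 4) / (\<gamma> * m)"
    unfolding \<rho>_def power_divide power_Suc using den \<gamma>0 m0 by simp
  moreover have "\<rho> ^ N \<le> \<rho> ^ ?s" using \<rho> by (intro power_increasing) (auto simp: trans_le_add2 intro: order_trans[of _ "1 * N"])
  ultimately show False using N by simp
qed

section \<open>Holomorphic functions of several variables\<close>

lemma has_derivative_complex_line: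
  "((\<lambda>\<zeta>. a + \<zeta> *s (w::complex^'n)) has_derivative (\<lambda>h. h *s w)) (at \<zeta>0)"
proof -
  have "linear (\<lambda>h. h *s w)"
    by (rule linearI) (auto simp: vec_eq_iff algebra_simps)
  then have "((\<lambda>h. h *s w) has_derivative (\<lambda>h. h *s w)) (at \<zeta>0)"
    by (simp add: bounded_linear_imp_has_derivative linear_conv_bounded_linear)
  then show ?thesis by (auto intro!: derivative_eq_intros)
qed

lemma holomorphic_fun_on_line:
  fixes f :: "complex^'n \<Rightarrow> complex"
  assumes f: "f holomorphic_fun_on D" and S: "\<And>\<zeta>. \<zeta> \<in> S \<Longrightarrow> a + \<zeta> *s w \<in> D"
  shows "(\<lambda>\<zeta>. f (a + \<zeta> *s w)) holomorphic_on S"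
  unfolding holomorphic_on_def
proof
  fix \<zeta> assume "\<zeta> \<in> S"
  then obtain L where L: "(f has_derivative L) (at (a + \<zeta> *s w))" "\<And>c v. L (c *s v) = c * L v"
    using f S unfolding holomorphic_fun_on_def by blast
  have "((\<lambda>\<zeta>. f (a + \<zeta> *s w)) has_derivative (\<lambda>h. L (h *s w))) (at \<zeta>)"
    using has_derivative_compose[OF has_derivative_complex_line L(1)] .
  then have "((\<lambda>\<zeta>. f (a + \<zeta> *s w)) has_field_derivative L w) (at \<zeta>)"
  proof -
    assume "((\<lambda>\<zeta>. f (a + \<zeta> *s w)) has_derivative (\<lambda>h. L (h *s w))) (at \<zeta>)"
    moreover have "(\<lambda>h. L (h *s w)) = (*) (L w)" by (auto simp: L(2))
    ultimately show ?thesis unfolding has_field_derivative_def by simp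
  qed
  then show "(\<lambda>\<zeta>. f (a + \<zeta> *s w)) field_differentiable at \<zeta> within S"
    using field_differentiable_def field_differentiable_at_within by blast
qed

lemma holomorphic_fun_on_imp_continuous_on:
  "f holomorphic_fun_on D \<Longrightarrow> continuous_on D f"
  unfolding holomorphic_fun_on_def
  by (meson continuous_at_imp_continuous_on has_derivative_continuous)

text \<open>
  The interior of the zero set is closed in \<open>D\<close>: if a ball meets it in a point \<open>b\<close>, then one-variable
  analytic continuation along the complex lines through \<open>b\<close> shows that \<open>f\<close> vanishes on the whole ball.
\<close>
lemma holomorphic_fun_identity:
  fixes f :: "complex^'n \<Rightarrow> complex"
  assumes D: "open D" "connected D" and f: "f holomorphic_fun_on D"
    and U: "open U" "U \<noteq> {}" "U \<subseteq> D" "\<And>z. z \<in> U \<Longrightarrow> f z = 0" and z: "z \<in> D"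
  shows "f z = 0"
proof -
  define E where "E = interior {z\<in>D. f z = 0}"
  have E: "open E" "E \<subseteq> D" "\<And>z. z \<in> E \<Longrightarrow> f z = 0"
    unfolding E_def using interior_subset[of "{z\<in>D. f z = 0}"] by auto
  have UE: "U \<subseteq> E" unfolding E_def using U by (intro interior_maximal) auto
  have "open (D - E)"
  proof (subst open_contains_ball, intro ballI)
    fix y assume y: "y \<in> D - E"
    then obtain e where e: "e > 0" "ball y e \<subseteq> D" using D(1) open_contains_ball by (metis DiffD1)
    \<comment> \<open>A ball around a point outside \<open>E\<close> cannot meet \<open>E\<close>, or else \<open>f\<close> vanishes on all of it.\<close>
    have "ball y e \<inter> E = {}"
    proof (rule ccontr)
      assume "ball y e \<inter> E \<noteq> {}"
      then obtain b where b: "b \<in> ball y e" "b \<in> E" by blast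
      have "f x = 0" if x: "x \<in> ball y e" for x
      proof -
        define S where "S = (\<lambda>\<zeta>. b + \<zeta> *s (x - b)) -` ball y e"
        define V where "V = (\<lambda>\<zeta>. b + \<zeta> *s (x - b)) -` (ball y e \<inter> E)"
        have ct: "continuous (at \<zeta>) (\<lambda>\<zeta>. b + \<zeta> *s (x - b))" for \<zeta>
          by (rule has_derivative_continuous[OF has_derivative_complex_line])
        have "open S" unfolding S_def by (rule continuous_open_vimage[OF open_ball ct])
        have "open V" unfolding V_def by (rule continuous_open_vimage[OF open_Int[OF open_ball E(1)] ct])
        have "convex S"
        proof (rule convexI)
          fix \<zeta> \<xi> and u v :: real assume *: "\<zeta> \<in> S" "\<xi> \<in> S" "0 \<le> u" "0 \<le> v" "u + v = 1"
          have "u *\<^sub>R (b + \<zeta> *s (x - b)) + v *\<^sub>R (b + \<xi> *s (x - b)) \<in> ball y e"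
            using * by (intro convexD[OF convex_ball]) (auto simp: S_def)
          also have "u *\<^sub>R (b + \<zeta> *s (x - b)) + v *\<^sub>R (b + \<xi> *s (x - b)) = (u + v) *\<^sub>R b + (u *\<^sub>R \<zeta> + v *\<^sub>R \<xi>) *s (x - b)"
            by (auto simp: vec_eq_iff algebra_simps)
          finally show "u *\<^sub>R \<zeta> + v *\<^sub>R \<xi> \<in> S" using * by (simp add: S_def)
        qed
        have 0: "0 \<in> V" "0 \<in> S" "1 \<in> S" using b x by (auto simp: V_def S_def)
        have "(\<lambda>\<zeta>. f (b + \<zeta> *s (x - b))) 1 = 0"
        proof (rule analytic_continuation[of "\<lambda>\<zeta>. f (b + \<zeta> *s (x - b))" S V 0])
          show "(\<lambda>\<zeta>. f (b + \<zeta> *s (x - b))) holomorphic_on S"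
            using e by (intro holomorphic_fun_on_line[OF f]) (auto simp: S_def)
          show "0 islimpt V" using 0 \<open>open V\<close> by (intro interior_limit_point) (simp add: interior_open)
        qed (use 0 \<open>open S\<close> \<open>convex S\<close> E in \<open>auto simp: V_def S_def convex_connected\<close>)
        then show ?thesis by simp
      qed
      then have "ball y e \<subseteq> E" unfolding E_def using e by (intro interior_maximal) auto
      moreover have "y \<in> ball y e" using e by simp
      ultimately show False using y by blast
    qed
    with e show "\<exists>e>0. ball y e \<subseteq> D - E" by blast
  qed
  then have "E \<inter> D = {} \<or> (D - E) \<inter> D = {}"
    using E by (intro connectedD[OF D(2)]) auto
  with UE U E z show ?thesis by blast
qed

section \<open>From the Levi form to plurisubharmonicity\<close>

lemma scaleR_vector_scalar_mult: "r *\<^sub>R (c *s w) = (of_real r * c) *s (w::complex^'n)"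
  by (simp add: vec_eq_iff scaleR_conv_of_real[where 'a=complex] mult.assoc)

text \<open>
  Let \<open>M r\<close> be the integral of \<open>\<phi>\<close> over the circle of radius \<open>r\<close> and \<open>N = M'\<close>. Integrating the angular
  second derivative over the full circle gives zero, and this expresses \<open>N r\<close> through the second
  derivative of \<open>\<phi>\<close> in the tangential direction. Hence \<open>(r N)'\<close> is \<open>r\<close> times the integral of the
  Laplacian, \<open>r N\<close> increases from \<open>0\<close>, and \<open>M\<close> increases.
\<close>
lemma circle_mean_le_of_laplacian_nonneg:
  fixes \<phi> :: "complex^'n \<Rightarrow> real" and u' :: "complex^'n \<Rightarrow> (complex^'n) \<Rightarrow>\<^sub>L real"
    and u'' :: "complex^'n \<Rightarrow> (complex^'n) \<Rightarrow>\<^sub>L ((complex^'n) \<Rightarrow>\<^sub>L real)"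
  assumes d1: "\<And>x. x \<in> D \<Longrightarrow> (\<phi> has_derivative blinfun_apply (u' x)) (at x)"
    and d2: "\<And>x. x \<in> D \<Longrightarrow> (u' has_derivative blinfun_apply (u'' x)) (at x)"
    and c2: "continuous_on D u''"
    and levi: "\<And>x c. x \<in> D \<Longrightarrow> u'' x (c *s w) (c *s w) + u'' x ((\<i> * c) *s w) ((\<i> * c) *s w) \<ge> 0"
    and disc: "\<And>c. cmod c \<le> 1 \<Longrightarrow> a + c *s w \<in> D"
  shows "2 * pi * \<phi> a \<le> integral {0..2*pi} (\<lambda>\<theta>. \<phi> (a + cis \<theta> *s w))"
proof -
  have c0: "continuous_on D \<phi>" using d1 by (meson continuous_at_imp_continuous_on has_derivative_continuous)
  have c1: "continuous_on D u'" using d2 by (meson continuous_at_imp_continuous_on has_derivative_continuous)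
  define p where "p r \<theta> = a + (of_real r * cis \<theta>) *s w" for r \<theta>
  define c where "c \<theta> = cis \<theta> *s w" for \<theta>
  define ic where "ic \<theta> = (\<i> * cis \<theta>) *s w" for \<theta>
  have pD: "p r \<theta> \<in> D" if "r \<in> {0..1}" for r \<theta>
    unfolding p_def using that by (intro disc) (simp add: norm_mult)
  have cp: "continuous_on ({0..1} \<times> {0..2*pi}) (\<lambda>z. p (fst z) (snd z))"
    unfolding p_def by (intro continuous_intros)
  have cc: "continuous_on A c" "continuous_on A ic" for A
    unfolding c_def ic_def by (intro continuous_intros)+
  have cc2: "continuous_on A (\<lambda>z. c (snd z))" "continuous_on A (\<lambda>z. ic (snd z))" for A :: "(real \<times> real) set"
    by (intro continuous_on_compose2[OF cc(1)[of UNIV]] continuous_on_compose2[OF cc(2)[of UNIV]] continuous_intros; simp)+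
  have pr: "((\<lambda>r. p r \<theta>) has_vector_derivative c \<theta>) (at r within S)" for r \<theta> S
  proof -
    have *: "(\<lambda>r. p r \<theta>) = (\<lambda>r. a + r *\<^sub>R c \<theta>)"
      by (simp add: p_def c_def scaleR_vector_scalar_mult)
    show ?thesis unfolding * by (auto intro!: derivative_eq_intros)
  qed
  have lin: "bounded_linear (\<lambda>h. h *s w)"
    unfolding linear_conv_bounded_linear[symmetric]
    by (rule linearI) (auto simp: vec_eq_iff algebra_simps)
  have cisd: "(cis has_vector_derivative \<i> * cis \<theta>) (at \<theta> within S)" for \<theta> S
    by (auto simp: cis_conv_exp has_vector_derivative_def intro!: derivative_eq_intros simp: scaleR_conv_of_real mult_ac)
  have pt: "((\<lambda>\<theta>. p r \<theta>) has_vector_derivative r *\<^sub>R ic \<theta>) (at \<theta> within S)" for r \<theta> S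
  proof -
    have "((\<lambda>\<theta>. of_real r * cis \<theta>) has_vector_derivative of_real r * (\<i> * cis \<theta>)) (at \<theta> within S)"
      by (intro has_vector_derivative_mult_right cisd)
    from bounded_linear.has_vector_derivative[OF lin this]
    have "((\<lambda>\<theta>. a + (of_real r * cis \<theta>) *s w) has_vector_derivative 0 + (of_real r * (\<i> * cis \<theta>)) *s w) (at \<theta> within S)"
      by (intro has_vector_derivative_add has_vector_derivative_const)
    then show ?thesis by (simp add: p_def[abs_def] ic_def scaleR_vector_scalar_mult)
  qed
  have ict: "(ic has_vector_derivative - c \<theta>) (at \<theta> within S)" for \<theta> S
  proof -
    have "((\<lambda>\<theta>. \<i> * cis \<theta>) has_vector_derivative \<i> * (\<i> * cis \<theta>)) (at \<theta> within S)"
      by (intro has_vector_derivative_mult_right cisd)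
    from bounded_linear.has_vector_derivative[OF lin this]
    moreover have "(\<i> * (\<i> * cis \<theta>)) *s w = - c \<theta>"
      by (simp add: c_def vec_eq_iff flip: mult.assoc)
    ultimately show ?thesis by (simp add: ic_def[abs_def])
  qed
  let ?I = "{0..2*pi}"
  define M where "M r = integral ?I (\<lambda>\<theta>. \<phi> (p r \<theta>))" for r
  define N where "N r = integral ?I (\<lambda>\<theta>. u' (p r \<theta>) (c \<theta>))" for r
  define P where "P r = integral ?I (\<lambda>\<theta>. u'' (p r \<theta>) (c \<theta>) (c \<theta>))" for r
  have cs: "continuous_on ?I (\<lambda>\<theta>. p r \<theta>)" for r
    unfolding p_def by (intro continuous_intros)
  note blc = bounded_bilinear.continuous_on[OF bounded_bilinear_blinfun_apply]
  have C0: "continuous_on ?I (\<lambda>\<theta>. \<phi> (p r \<theta>))" if "r \<in> {0..1}" for r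
    by (intro continuous_on_compose2[OF c0] cs) (use pD that in auto)
  have C1: "continuous_on ?I (\<lambda>\<theta>. u' (p r \<theta>) (c \<theta>))" if "r \<in> {0..1}" for r
    by (intro blc continuous_on_compose2[OF c1] cs cc) (use pD that in auto)
  have C2: "continuous_on ?I (\<lambda>\<theta>. u'' (p r \<theta>) (c \<theta>) (c \<theta>))" "continuous_on ?I (\<lambda>\<theta>. u'' (p r \<theta>) (ic \<theta>) (ic \<theta>))" if "r \<in> {0..1}" for r
    by (intro blc continuous_on_compose2[OF c2] cs cc; use pD that in auto)+
  have dM: "(M has_real_derivative N r) (at r within {0..1})" if "r \<in> {0..1}" for r
    unfolding M_def N_def cbox_interval[symmetric]
  proof (rule leibniz_rule_field_derivative)
    fix r \<theta> :: real assume r: "r \<in> cbox 0 1"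
    have "((\<phi> \<circ> (\<lambda>r. p r \<theta>)) has_vector_derivative u' (p r \<theta>) (c \<theta>)) (at r within cbox 0 1)"
      by (rule vector_derivative_diff_chain_within[OF pr]) (use r pD in \<open>auto intro!: has_derivative_at_withinI d1\<close>)
    then show "((\<lambda>r. \<phi> (p r \<theta>)) has_real_derivative u' (p r \<theta>) (c \<theta>)) (at r within cbox 0 1)"
      by (simp add: has_real_derivative_iff_has_vector_derivative o_def)
  next
    fix r :: real assume "r \<in> cbox 0 1" then show "(\<lambda>\<theta>. \<phi> (p r \<theta>)) integrable_on cbox 0 (2*pi)"
      by (auto intro!: integrable_continuous_real C0)
  next
    show "continuous_on (cbox 0 1 \<times> cbox 0 (2*pi)) (\<lambda>(x, \<theta>). u' (p x \<theta>) (c \<theta>))"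
      unfolding split_beta box_real
      by (intro blc continuous_on_compose2[OF c1] cp cc2) (use pD in auto)
  qed (use that in auto)
  have dN: "(N has_real_derivative P r) (at r within {0..1})" if "r \<in> {0..1}" for r
    unfolding N_def P_def cbox_interval[symmetric]
  proof (rule leibniz_rule_field_derivative)
    fix r \<theta> :: real assume r: "r \<in> cbox 0 1"
    have "((u' \<circ> (\<lambda>r. p r \<theta>)) has_vector_derivative u'' (p r \<theta>) (c \<theta>)) (at r within cbox 0 1)"
      by (rule vector_derivative_diff_chain_within[OF pr]) (use r pD in \<open>auto intro!: has_derivative_at_withinI d2\<close>)
    from bounded_bilinear.has_vector_derivative[OF bounded_bilinear_blinfun_apply this has_vector_derivative_const[of "c \<theta>"]]
    show "((\<lambda>r. u' (p r \<theta>) (c \<theta>)) has_real_derivative u'' (p r \<theta>) (c \<theta>) (c \<theta>)) (at r within cbox 0 1)"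
      by (simp add: has_real_derivative_iff_has_vector_derivative o_def blinfun.zero_right)
  next
    fix r :: real assume "r \<in> cbox 0 1" then show "(\<lambda>\<theta>. u' (p r \<theta>) (c \<theta>)) integrable_on cbox 0 (2*pi)"
      by (auto intro!: integrable_continuous_real C1)
  next
    show "continuous_on (cbox 0 1 \<times> cbox 0 (2*pi)) (\<lambda>(x, \<theta>). u'' (p x \<theta>) (c \<theta>) (c \<theta>))"
      unfolding split_beta box_real
      by (intro blc continuous_on_compose2[OF c2] cp cc2) (use pD in auto)
  qed (use that in auto)
  \<comment> \<open>Integral of the second angular derivative over the full circle.\<close>
  have angular: "N r = r * integral ?I (\<lambda>\<theta>. u'' (p r \<theta>) (ic \<theta>) (ic \<theta>))" if r: "r \<in> {0..1}" for r
  proof -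
    have "((\<lambda>\<theta>. u' (p r \<theta>) (ic \<theta>)) has_vector_derivative u' (p r \<theta>) (- c \<theta>) + u'' (p r \<theta>) (r *\<^sub>R ic \<theta>) (ic \<theta>)) (at \<theta> within ?I)" for \<theta>
    proof -
      have "((u' \<circ> (\<lambda>\<theta>. p r \<theta>)) has_vector_derivative u'' (p r \<theta>) (r *\<^sub>R ic \<theta>)) (at \<theta> within ?I)"
        by (rule vector_derivative_diff_chain_within[OF pt]) (use r pD in \<open>auto intro!: has_derivative_at_withinI d2\<close>)
      from bounded_bilinear.has_vector_derivative[OF bounded_bilinear_blinfun_apply this ict] show ?thesis by (simp add: o_def)
    qed
    then have "((\<lambda>\<theta>. u' (p r \<theta>) (- c \<theta>) + u'' (p r \<theta>) (r *\<^sub>R ic \<theta>) (ic \<theta>)) has_integral u' (p r (2*pi)) (ic (2*pi)) - u' (p r 0) (ic 0)) ?I"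
      by (intro fundamental_theorem_of_calculus) auto
    then have "((\<lambda>\<theta>. r * u'' (p r \<theta>) (ic \<theta>) (ic \<theta>) - u' (p r \<theta>) (c \<theta>)) has_integral 0) ?I"
    proof -
      have "p r (2*pi) = p r 0" "ic (2*pi) = ic 0" by (simp_all add: p_def ic_def)
      moreover have "u' (p r \<theta>) (- c \<theta>) + u'' (p r \<theta>) (r *\<^sub>R ic \<theta>) (ic \<theta>)
          = r * u'' (p r \<theta>) (ic \<theta>) (ic \<theta>) - u' (p r \<theta>) (c \<theta>)" for \<theta>
        by (simp add: blinfun.minus_right blinfun.scaleR_right blinfun.scaleR_left)
      moreover assume "((\<lambda>\<theta>. u' (p r \<theta>) (- c \<theta>) + u'' (p r \<theta>) (r *\<^sub>R ic \<theta>) (ic \<theta>)) has_integral u' (p r (2*pi)) (ic (2*pi)) - u' (p r 0) (ic 0)) ?I"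
      ultimately show ?thesis by simp
    qed
    moreover have "((\<lambda>\<theta>. r * u'' (p r \<theta>) (ic \<theta>) (ic \<theta>) - u' (p r \<theta>) (c \<theta>)) has_integral (r * integral ?I (\<lambda>\<theta>. u'' (p r \<theta>) (ic \<theta>) (ic \<theta>)) - N r)) ?I"
      unfolding N_def
      by (intro has_integral_diff has_integral_mult_right integrable_integral integrable_continuous_real C1 C2 r)
    ultimately have "0 = r * integral ?I (\<lambda>\<theta>. u'' (p r \<theta>) (ic \<theta>) (ic \<theta>)) - N r"
      by (rule has_integral_unique)
    then show ?thesis by simp
  qed
  have incr: "N r \<ge> 0" if r: "0 < r" "r < 1" for r
  proof -
    have "0 * N 0 \<le> r * N r"
    proof (rule DERIV_nonneg_imp_increasing_open[of 0 r "\<lambda>r. r * N r"])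
      fix x assume x: "0 < x" "x < r"
      then have xi: "x \<in> {0..1}" using r by auto
      have "(N has_real_derivative P x) (at x within {0<..<1})"
        by (rule DERIV_subset[OF dN[OF xi]]) auto
      then have "(N has_real_derivative P x) (at x)" using x r by (simp add: at_within_open[of x "{0<..<1}"])
      then have "((\<lambda>r. r * N r) has_real_derivative N x + x * P x) (at x)"
        by (auto intro!: derivative_eq_intros)
      moreover have "N x + x * P x = x * (integral ?I (\<lambda>\<theta>. u'' (p x \<theta>) (ic \<theta>) (ic \<theta>)) + P x)"
        by (simp add: angular[OF xi] algebra_simps)
      moreover have "integral ?I (\<lambda>\<theta>. u'' (p x \<theta>) (ic \<theta>) (ic \<theta>)) + P x = integral ?I (\<lambda>\<theta>. u'' (p x \<theta>) (ic \<theta>) (ic \<theta>) + u'' (p x \<theta>) (c \<theta>) (c \<theta>))"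
        unfolding P_def
        by (intro Henstock_Kurzweil_Integration.integral_add[symmetric] integrable_continuous_real C2 xi)
      moreover have "\<dots> \<ge> 0"
        by (intro integral_nonneg integrable_add integrable_continuous_real C2 xi)
           (use levi[OF pD[OF xi]] in \<open>auto simp: c_def ic_def add.commute\<close>)
      ultimately show "\<exists>y. ((\<lambda>r. r * N r) has_real_derivative y) (at x) \<and> 0 \<le> y" using x by auto
    next
      have "continuous_on {0..1} N" using dN by (meson DERIV_continuous_on)
      then show "continuous_on {0..r} (\<lambda>r. r * N r)"
        using r by (intro continuous_intros) (auto elim!: continuous_on_subset)
    qed (use r in auto)
    with r show ?thesis by (simp add: zero_le_mult_iff)
  qed
  have "M 0 \<le> M 1"
  proof (rule DERIV_nonneg_imp_increasing_open[of 0 1 M])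
    fix x :: real assume x: "0 < x" "x < 1"
    have "(M has_real_derivative N x) (at x within {0<..<1})"
      by (rule DERIV_subset[OF dM]) (use x in auto)
    then have "(M has_real_derivative N x) (at x)" using x by (simp add: at_within_open[of x "{0<..<1}"])
    with incr x show "\<exists>y. (M has_real_derivative y) (at x) \<and> 0 \<le> y" by blast
  next
    show "continuous_on {0..1} M" using dM by (meson DERIV_continuous_on)
  qed simp
  moreover have "M 0 = 2 * pi * \<phi> a" by (simp add: M_def p_def)
  moreover have "M 1 = integral {0..2*pi} (\<lambda>\<theta>. \<phi> (a + cis \<theta> *s w))" by (simp add: M_def p_def)
  ultimately show ?thesis by simp
qed

lemma plurisubharmonic_on_if_levi_nonneg:
  fixes \<phi> :: "complex^'n \<Rightarrow> real" and u' :: "complex^'n \<Rightarrow> (complex^'n) \<Rightarrow>\<^sub>L real"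
    and u'' :: "complex^'n \<Rightarrow> (complex^'n) \<Rightarrow>\<^sub>L ((complex^'n) \<Rightarrow>\<^sub>L real)"
  assumes d1: "\<And>x. x \<in> D \<Longrightarrow> (\<phi> has_derivative blinfun_apply (u' x)) (at x)"
    and d2: "\<And>x. x \<in> D \<Longrightarrow> (u' has_derivative blinfun_apply (u'' x)) (at x)"
    and c2: "continuous_on D u''"
    and levi: "\<And>x w. x \<in> D \<Longrightarrow> u'' x w w + u'' x (\<i> *s w) (\<i> *s w) \<ge> 0"
  shows "\<phi> plurisubharmonic_on D"
  unfolding plurisubharmonic_on_def
proof (intro conjI ballI allI impI)
  have c0: "continuous_on D \<phi>" using d1 by (meson continuous_at_imp_continuous_on has_derivative_continuous)
  show "\<forall>\<^sub>F x in at z within D. \<phi> x < t" if "z \<in> D" "\<phi> z < t" for z t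
    using c0 that by (auto simp: continuous_on_def intro: order_tendstoD(2))
  fix a w assume disc: "\<forall>c. cmod c \<le> 1 \<longrightarrow> a + c *s w \<in> D"
  have cont: "continuous_on {0..2*pi} (\<lambda>\<theta>. \<phi> (a + cis \<theta> *s w))"
    by (intro continuous_on_compose2[OF c0] continuous_intros) (use disc in auto)
  show int: "set_integrable lborel {0..2 * pi} (\<lambda>\<theta>. \<phi> (a + cis \<theta> *s w))"
    by (rule borel_integrable_atLeastAtMost'[OF cont])
  have "2 * pi * \<phi> a \<le> integral {0..2*pi} (\<lambda>\<theta>. \<phi> (a + cis \<theta> *s w))"
  proof (rule circle_mean_le_of_laplacian_nonneg[OF d1 d2 c2])
    show "u'' x (c *s w) (c *s w) + u'' x ((\<i> * c) *s w) ((\<i> * c) *s w) \<ge> 0" if "x \<in> D" for x c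
      using levi[OF that, of "c *s w"] by (simp add: vector_smult_assoc)
  qed (use disc in auto)
  also have "\<dots> = (LINT \<theta>:{0..2 * pi}|lborel. \<phi> (a + cis \<theta> *s w))"
    using set_borel_integral_eq_integral(2)[OF int] by simp
  finally show "\<phi> a \<le> 1 / (2 * pi) * (LINT \<theta>:{0..2 * pi}|lborel. \<phi> (a + cis \<theta> *s w))"
    by (simp add: field_simps)
qed

section \<open>Energy of a division on complex lines\<close>

lemma circle_mean_square_sum_ge:
  fixes F :: "'i \<Rightarrow> complex \<Rightarrow> complex"
  assumes fin: "finite I" and hol: "\<And>i. i \<in> I \<Longrightarrow> F i holomorphic_on ball 0 R" and R: "R > 1"
  shows "ennreal (\<Sum>i\<in>I. (cmod (F i 0))\<^sup>2) \<le> (\<integral>\<^sup>+t\<in>{0..1}. ennreal (\<Sum>i\<in>I. (cmod (F i (cis (2 * pi * t))))\<^sup>2) \<partial>lborel)"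
proof -
  have cont: "continuous_on {0..1} (\<lambda>t. (cmod (F i (cis (2 * pi * t))))\<^sup>2)" if "i \<in> I" for i
    using R by (intro continuous_intros continuous_on_compose2[OF holomorphic_on_imp_continuous_on[OF hol[OF that]]]) auto
  have meas: "(\<lambda>t. ennreal ((cmod (F i (cis (2 * pi * t))))\<^sup>2) * indicator {0..1} t) \<in> borel_measurable lborel" if "i \<in> I" for i
  proof -
    have "(\<lambda>t. ennreal (indicator {0..1} t *\<^sub>R (cmod (F i (cis (2 * pi * t))))\<^sup>2)) \<in> borel_measurable lborel"
      using borel_measurable_continuous_on_indicator[OF _ cont[OF that]] by simp
    moreover have "ennreal ((cmod (F i (cis (2 * pi * t))))\<^sup>2) * indicator {0..1} t
        = ennreal (indicator {0..1} t *\<^sub>R (cmod (F i (cis (2 * pi * t))))\<^sup>2)" for t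
      by (auto simp: indicator_def)
    ultimately show ?thesis by simp
  qed
  have "ennreal (\<Sum>i\<in>I. (cmod (F i 0))\<^sup>2) = (\<Sum>i\<in>I. ennreal ((cmod (F i 0))\<^sup>2))"
    by (simp add: sum_ennreal)
  also have "\<dots> \<le> (\<Sum>i\<in>I. \<integral>\<^sup>+t\<in>{0..1}. ennreal ((cmod (F i (cis (2 * pi * t))))\<^sup>2) \<partial>lborel)"
    by (intro sum_mono) (subst circle_mean_square[OF hol R], auto)
  also have "\<dots> = (\<integral>\<^sup>+t. (\<Sum>i\<in>I. ennreal ((cmod (F i (cis (2 * pi * t))))\<^sup>2) * indicator {0..1} t) \<partial>lborel)"
    by (rule nn_integral_sum[symmetric]) (rule meas)
  also have "\<dots> = (\<integral>\<^sup>+t\<in>{0..1}. ennreal (\<Sum>i\<in>I. (cmod (F i (cis (2 * pi * t))))\<^sup>2) \<partial>lborel)"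
    by (simp add: sum_distrib_right[symmetric] sum_ennreal)
  finally show ?thesis .
qed

text \<open>
  Among all solutions of \<open>h\<^sub>0 + \<Sum>\<^sub>j w\<^sub>j h\<^sub>j = k\<close> the shortest is \<open>k (1, cnj w) / \<nu>\<close>, and the rest of
  a solution is orthogonal to it.
\<close>
lemma pointwise_minimal_division:
  fixes h0 k :: complex and h w :: "'n::finite \<Rightarrow> complex"
  assumes k: "h0 + (\<Sum>j\<in>UNIV. w j * h j) = k" and \<nu>: "\<nu> = 1 + (\<Sum>j\<in>UNIV. (cmod (w j))\<^sup>2)"
  shows "(cmod (h0 - k / of_real \<nu>))\<^sup>2 + (\<Sum>j\<in>UNIV. (cmod (h j - k * cnj (w j) / of_real \<nu>))\<^sup>2)
    = (cmod h0)\<^sup>2 + (\<Sum>j\<in>UNIV. (cmod (h j))\<^sup>2) - (cmod k)\<^sup>2 / \<nu>"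
proof -
  have \<nu>0: "\<nu> > 0" unfolding \<nu> by (intro add_pos_nonneg sum_nonneg) auto
  have d: "(cmod (x - y))\<^sup>2 = (cmod x)\<^sup>2 - 2 * Re (x * cnj y) + (cmod y)\<^sup>2" for x y
    by (simp add: cmod_power2) (simp add: power2_eq_square algebra_simps)
  have "(cmod (h0 - k / of_real \<nu>))\<^sup>2 = (cmod h0)\<^sup>2 - 2 * Re (h0 * cnj k) / \<nu> + (cmod k)\<^sup>2 / \<nu>\<^sup>2"
    using \<nu>0 by (simp add: d norm_divide power_divide)
  moreover have "(\<Sum>j\<in>UNIV. (cmod (h j - k * cnj (w j) / of_real \<nu>))\<^sup>2)
     = (\<Sum>j\<in>UNIV. (cmod (h j))\<^sup>2) - (\<Sum>j\<in>UNIV. 2 * Re (w j * h j * cnj k) / \<nu>) + (\<Sum>j\<in>UNIV. (cmod k)\<^sup>2 * (cmod (w j))\<^sup>2 / \<nu>\<^sup>2)"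
    unfolding sum_subtractf[symmetric] sum.distrib[symmetric] using \<nu>0
    by (intro sum.cong refl) (simp add: d norm_divide norm_mult power_divide power_mult_distrib mult_ac)
  moreover have "(\<Sum>j\<in>UNIV. (cmod k)\<^sup>2 * (cmod (w j))\<^sup>2 / \<nu>\<^sup>2) = (cmod k)\<^sup>2 * (\<nu> - 1) / \<nu>\<^sup>2"
    by (simp add: \<nu> sum_distrib_left sum_divide_distrib)
  moreover have "2 * Re (h0 * cnj k) / \<nu> + (\<Sum>j\<in>UNIV. 2 * Re (w j * h j * cnj k) / \<nu>) = 2 * (cmod k)\<^sup>2 / \<nu>"
  proof -
    have "2 * Re (h0 * cnj k) / \<nu> + (\<Sum>j\<in>UNIV. 2 * Re (w j * h j * cnj k) / \<nu>) = 2 * Re ((h0 + (\<Sum>j\<in>UNIV. w j * h j)) * cnj k) / \<nu>"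
      by (simp only: distrib_right sum_distrib_right plus_complex.sel Re_sum add_divide_distrib distrib_left sum_distrib_left sum_divide_distrib)
    also have "\<dots> = 2 * (cmod k)\<^sup>2 / \<nu>" by (simp only: k complex_norm_square[symmetric] Re_complex_of_real)
    finally show ?thesis .
  qed
  moreover have "(cmod k)\<^sup>2 / \<nu>\<^sup>2 + (cmod k)\<^sup>2 * (\<nu> - 1) / \<nu>\<^sup>2 = (cmod k)\<^sup>2 / \<nu>"
    using \<nu>0 by (simp add: field_simps power2_eq_square)
  ultimately show ?thesis by linarith
qed

lemma circle_in_ball_radius:
  fixes w :: "complex^'n"
  assumes "norm w < r"
  obtains R where "R > 1" "\<And>\<zeta>. \<zeta> \<in> ball 0 R \<Longrightarrow> \<zeta> *s w \<in> ball 0 r"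
proof (cases "w = 0")
  case True
  with assms show ?thesis by (intro that[of 2]) auto
next
  case False
  with assms show ?thesis
    by (intro that[of "r / norm w"]) (auto simp: norm_vector_scalar_mult field_simps)
qed

text \<open>
  Fix \<open>w\<close> and put \<open>\<nu> = 1 + |w|\<^sup>2\<close>. On the circle \<open>\<zeta> w\<close> with \<open>|\<zeta>| = 1\<close> the vector
  \<open>(H\<^sub>0(\<zeta> w), \<zeta> H\<^sub>j(\<zeta> w))\<close> has the same length as \<open>(H\<^sub>0(\<zeta> w), H\<^sub>j(\<zeta> w))\<close>, but divides \<open>K(\<zeta> w)\<close> by the
  constant vector \<open>(1, w)\<close>. Subtracting the minimal solution \<open>K(\<zeta> w) (1, cnj w) / \<nu>\<close> therefore
  leaves a vector that is holomorphic in \<open>\<zeta>\<close>. Its value at \<open>\<zeta> = 0\<close> is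
  \<open>K(0) (|w|\<^sup>2, - cnj w) / \<nu>\<close>, of square length \<open>|K(0)|\<^sup>2 |w|\<^sup>2 / \<nu>\<close>.
\<close>
lemma division_energy_lower_bound:
  fixes H0 K :: "complex^'n \<Rightarrow> complex" and H :: "'n \<Rightarrow> complex^'n \<Rightarrow> complex" and b :: "complex^'n \<Rightarrow> real"
  assumes cH0: "continuous_on (ball 0 r) H0" and cH: "\<And>j. continuous_on (ball 0 r) (H j)" and cK: "continuous_on (ball 0 r) K"
    and hH0: "\<And>w. (\<lambda>\<zeta>. H0 (\<zeta> *s w)) holomorphic_on {\<zeta>. \<zeta> *s w \<in> ball 0 r}"
    and hH: "\<And>w j. (\<lambda>\<zeta>. H j (\<zeta> *s w)) holomorphic_on {\<zeta>. \<zeta> *s w \<in> ball 0 r}"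
    and hK: "\<And>w. (\<lambda>\<zeta>. K (\<zeta> *s w)) holomorphic_on {\<zeta>. \<zeta> *s w \<in> ball 0 r}"
    and div: "\<And>w. w \<in> ball 0 r \<Longrightarrow> H0 w + (\<Sum>j\<in>UNIV. w $ j * H j w) = K w"
    and cb: "continuous_on (ball 0 r) b" and b0: "\<And>w. w \<in> ball 0 r \<Longrightarrow> b w \<ge> 0"
    and inv: "\<And>w t. b (cis t *s w) = b w"
  shows "(\<integral>\<^sup>+w\<in>ball 0 r. ennreal ((cmod (K 0))\<^sup>2 * ((norm w)\<^sup>2 / (1 + (norm w)\<^sup>2)) * b w) \<partial>lborel)
    \<le> (\<integral>\<^sup>+w\<in>ball 0 r. ennreal (((cmod (H0 w))\<^sup>2 + (\<Sum>j\<in>UNIV. (cmod (H j w))\<^sup>2) - (cmod (K w))\<^sup>2 / (1 + (norm w)\<^sup>2)) * b w) \<partial>lborel)"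
proof -
  define U where "U w = (cmod (H0 w))\<^sup>2 + (\<Sum>j\<in>UNIV. (cmod (H j w))\<^sup>2) - (cmod (K w))\<^sup>2 / (1 + (norm w)\<^sup>2)" for w
  define \<Phi> where "\<Phi> w = ennreal (U w * b w) * indicator (ball 0 r) w" for w
  have p1: "1 + (norm x)\<^sup>2 \<noteq> 0" for x :: "complex^'n"
    by (metis add_nonneg_pos add.commute less_irrefl zero_le_power2 zero_less_one)
  have "continuous_on (ball 0 r) (\<lambda>w. U w * b w)"
    unfolding U_def by (intro continuous_intros cH0 cH cK cb) (use p1 in auto)
  then have "(\<lambda>w. ennreal (indicator (ball 0 r) w *\<^sub>R (U w * b w))) \<in> borel_measurable borel"
    using borel_measurable_continuous_on_indicator[of "ball 0 r" "\<lambda>w. U w * b w"] by simp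
  also have "(\<lambda>w. ennreal (indicator (ball 0 r) w *\<^sub>R (U w * b w))) = \<Phi>"
    by (auto simp: \<Phi>_def indicator_def fun_eq_iff)
  finally have m: "\<Phi> \<in> borel_measurable borel" .
  have "(\<integral>\<^sup>+w\<in>ball 0 r. ennreal ((cmod (K 0))\<^sup>2 * ((norm w)\<^sup>2 / (1 + (norm w)\<^sup>2)) * b w) \<partial>lborel)
      \<le> (\<integral>\<^sup>+w. (\<integral>\<^sup>+t\<in>{0..1}. \<Phi> (cis (2 * pi * t) *s w) \<partial>lborel) \<partial>lborel)"
  proof (rule nn_integral_mono)
    fix w :: "complex^'n"
    show "ennreal ((cmod (K 0))\<^sup>2 * ((norm w)\<^sup>2 / (1 + (norm w)\<^sup>2)) * b w) * indicator (ball 0 r) w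
       \<le> (\<integral>\<^sup>+t\<in>{0..1}. \<Phi> (cis (2 * pi * t) *s w) \<partial>lborel)"
    proof (cases "w \<in> ball 0 r")
      case w: True
      then have wr: "norm w < r" by simp
      obtain R where R: "R > 1" "\<And>\<zeta>. \<zeta> \<in> ball 0 R \<Longrightarrow> \<zeta> *s w \<in> ball 0 r"
        using circle_in_ball_radius[OF wr] by blast
      define \<nu> where "\<nu> = 1 + (norm w)\<^sup>2"
      have \<nu>: "\<nu> = 1 + (\<Sum>j\<in>UNIV. (cmod (w $ j))\<^sup>2)" by (simp add: \<nu>_def norm_vec_complex_sq)
      have \<nu>0: "\<nu> > 0" unfolding \<nu>_def by (simp add: add_pos_nonneg)
      define F where "F i \<zeta> = (case i of None \<Rightarrow> H0 (\<zeta> *s w) - K (\<zeta> *s w) / of_real \<nu>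
          | Some j \<Rightarrow> \<zeta> * H j (\<zeta> *s w) - K (\<zeta> *s w) * cnj (w $ j) / of_real \<nu>)" for i \<zeta>
      have sub: "ball 0 R \<subseteq> {\<zeta>. \<zeta> *s w \<in> ball 0 r}" using R(2) by blast
      have Fh: "F i holomorphic_on ball 0 R" for i
        unfolding F_def using \<nu>0
        by (cases i) (auto intro!: holomorphic_intros holomorphic_on_subset[OF hH0 sub] holomorphic_on_subset[OF hH sub] holomorphic_on_subset[OF hK sub])
      have sumo: "(\<Sum>i\<in>UNIV. G i) = G None + (\<Sum>j\<in>UNIV. G (Some j))" for G :: "'n option \<Rightarrow> real"
        unfolding UNIV_option_conv by (subst sum.insert) (auto simp: sum.reindex)
      have U: "U (cis t *s w) = (\<Sum>i\<in>UNIV. (cmod (F i (cis t)))\<^sup>2)" for t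
      proof -
        have cw: "cis t *s w \<in> ball 0 r" using wr by (simp add: norm_vector_scalar_mult)
        have "H0 (cis t *s w) + (\<Sum>j\<in>UNIV. w $ j * (cis t * H j (cis t *s w))) = K (cis t *s w)"
          using div[OF cw] by (simp add: mult_ac)
        from pointwise_minimal_division[OF this \<nu>]
        show ?thesis unfolding sumo F_def option.case
          by (simp add: U_def \<nu>_def norm_mult norm_vector_scalar_mult)
      qed
      have "(\<Sum>i\<in>UNIV. (cmod (F i 0))\<^sup>2) = (cmod (K 0))\<^sup>2 * ((norm w)\<^sup>2 / (1 + (norm w)\<^sup>2))"
      proof -
        have z: "H0 0 = K 0" using div[of 0] wr by (simp add: norm_ge_zero le_less_trans[OF norm_ge_zero])
        have "(cmod (F None 0))\<^sup>2 = (cmod (K 0))\<^sup>2 * ((\<nu> - 1)\<^sup>2 / \<nu>\<^sup>2)"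
        proof -
          have "F None 0 = K 0 * of_real ((\<nu> - 1) / \<nu>)" using \<nu>0 by (simp add: F_def z field_simps)
          then show ?thesis by (simp only: norm_mult norm_of_real power_mult_distrib power2_abs power_divide)
        qed
        moreover have "(\<Sum>j\<in>UNIV. (cmod (F (Some j) 0))\<^sup>2) = (cmod (K 0))\<^sup>2 * ((\<nu> - 1) / \<nu>\<^sup>2)"
        proof -
          have "(\<Sum>j\<in>UNIV. (cmod (F (Some j) 0))\<^sup>2) = (\<Sum>j\<in>UNIV. (cmod (K 0))\<^sup>2 / \<nu>\<^sup>2 * (cmod (w $ j))\<^sup>2)"
            using \<nu>0 by (simp add: F_def norm_mult norm_divide power_mult_distrib power_divide)
          also have "\<dots> = (cmod (K 0))\<^sup>2 / \<nu>\<^sup>2 * (\<nu> - 1)"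
            by (simp only: sum_distrib_left[symmetric]) (simp add: \<nu>)
          finally show ?thesis by simp
        qed
        moreover have "(\<nu> - 1)\<^sup>2 / \<nu>\<^sup>2 + (\<nu> - 1) / \<nu>\<^sup>2 = (\<nu> - 1) / \<nu>"
          using \<nu>0 by (simp add: field_simps power2_eq_square)
        ultimately have "(\<Sum>i\<in>UNIV. (cmod (F i 0))\<^sup>2) = (cmod (K 0))\<^sup>2 * ((\<nu> - 1) / \<nu>)"
          unfolding sumo by (simp only: distrib_left[symmetric])
        then show ?thesis by (simp add: \<nu>_def)
      qed
      then have "ennreal ((cmod (K 0))\<^sup>2 * ((norm w)\<^sup>2 / (1 + (norm w)\<^sup>2)) * b w)
        = ennreal (b w) * ennreal (\<Sum>i\<in>UNIV. (cmod (F i 0))\<^sup>2)"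
        using b0[OF w] by (subst ennreal_mult[symmetric]) (auto simp: sum_nonneg mult.commute)
      also have "\<dots> \<le> ennreal (b w) * (\<integral>\<^sup>+t\<in>{0..1}. ennreal (\<Sum>i\<in>UNIV. (cmod (F i (cis (2 * pi * t))))\<^sup>2) \<partial>lborel)"
        by (rule mult_left_mono[OF circle_mean_square_sum_ge[OF finite Fh R(1)]]) auto
      also have "\<dots> = (\<integral>\<^sup>+t. ennreal (b w) * (ennreal (\<Sum>i\<in>UNIV. (cmod (F i (cis (2 * pi * t))))\<^sup>2) * indicator {0..1} t) \<partial>lborel)"
      proof (rule nn_integral_cmult[symmetric])
        have "continuous_on {0..1} (\<lambda>t. \<Sum>i\<in>UNIV. (cmod (F i (cis (2 * pi * t))))\<^sup>2)"
          using R by (intro continuous_intros continuous_on_compose2[OF holomorphic_on_imp_continuous_on[OF Fh]]) auto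
        then have "(\<lambda>t. ennreal (indicator {0..1} t *\<^sub>R (\<Sum>i\<in>UNIV. (cmod (F i (cis (2 * pi * t))))\<^sup>2))) \<in> borel_measurable lborel"
          using borel_measurable_continuous_on_indicator[of "{0..1}" "\<lambda>t. \<Sum>i\<in>UNIV. (cmod (F i (cis (2 * pi * t))))\<^sup>2"] by simp
        also have "(\<lambda>t. ennreal (indicator {0..1} t *\<^sub>R (\<Sum>i\<in>UNIV. (cmod (F i (cis (2 * pi * t))))\<^sup>2)))
          = (\<lambda>t. ennreal (\<Sum>i\<in>UNIV. (cmod (F i (cis (2 * pi * t))))\<^sup>2) * indicator {0..1} t)"
          by (auto simp: indicator_def fun_eq_iff)
        finally show "(\<lambda>t. ennreal (\<Sum>i\<in>UNIV. (cmod (F i (cis (2 * pi * t))))\<^sup>2) * indicator {0..1} t) \<in> borel_measurable lborel" .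
      qed
      also have "\<dots> = (\<integral>\<^sup>+t\<in>{0..1}. \<Phi> (cis (2 * pi * t) *s w) \<partial>lborel)"
        using b0[OF w] wr
        by (intro nn_integral_cong) (auto simp: \<Phi>_def U inv norm_vector_scalar_mult ennreal_mult sum_nonneg mult_ac)
      finally show ?thesis using w by simp
    qed simp
  qed
  also have "\<dots> = (\<integral>\<^sup>+w. \<Phi> w \<partial>lborel)" by (rule nn_integral_circle_average[OF m])
  finally show ?thesis unfolding \<Phi>_def U_def .
qed

text \<open>
  For functions that are holomorphic on complex lines the linear term of \<open>|K|\<^sup>2\<close> around \<open>K 0\<close> has mean
  zero over circles, so closeness to first order already controls the energy to second order.
\<close>
lemma energy_upper_bound:
  fixes K :: "complex^'n \<Rightarrow> complex" and b :: "complex^'n \<Rightarrow> real"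
  assumes cK: "continuous_on (ball 0 r) K"
    and hK: "\<And>w. (\<lambda>\<zeta>. K (\<zeta> *s w)) holomorphic_on {\<zeta>. \<zeta> *s w \<in> ball 0 r}"
    and near: "\<And>w. w \<in> ball 0 r \<Longrightarrow> (cmod (K w - K 0))\<^sup>2 \<le> \<eta> * (cmod (K 0))\<^sup>2 * (norm w)\<^sup>2" and \<eta>: "\<eta> \<ge> 0"
    and cb: "continuous_on (ball 0 r) b" and b0: "\<And>w. w \<in> ball 0 r \<Longrightarrow> b w \<ge> 0"
    and inv: "\<And>w t. b (cis t *s w) = b w"
  shows "(\<integral>\<^sup>+w\<in>ball 0 r. ennreal ((cmod (K w))\<^sup>2 * b w) \<partial>lborel)
    \<le> (\<integral>\<^sup>+w\<in>ball 0 r. ennreal ((cmod (K 0))\<^sup>2 * (1 + \<eta> * (norm w)\<^sup>2) * b w) \<partial>lborel)"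
proof -
  define \<Phi> where "\<Phi> w = ennreal ((cmod (K w))\<^sup>2 * b w) * indicator (ball 0 r) w" for w
  have "continuous_on (ball 0 r) (\<lambda>w. (cmod (K w))\<^sup>2 * b w)"
    by (intro continuous_intros cK cb)
  then have "(\<lambda>w. ennreal (indicator (ball 0 r) w *\<^sub>R ((cmod (K w))\<^sup>2 * b w))) \<in> borel_measurable borel"
    using borel_measurable_continuous_on_indicator[of "ball 0 r" "\<lambda>w. (cmod (K w))\<^sup>2 * b w"] by simp
  also have "(\<lambda>w. ennreal (indicator (ball 0 r) w *\<^sub>R ((cmod (K w))\<^sup>2 * b w))) = \<Phi>"
    by (auto simp: \<Phi>_def indicator_def fun_eq_iff)
  finally have m: "\<Phi> \<in> borel_measurable borel" .
  have "(\<integral>\<^sup>+w. \<Phi> w \<partial>lborel) = (\<integral>\<^sup>+w. (\<integral>\<^sup>+t\<in>{0..1}. \<Phi> (cis (2 * pi * t) *s w) \<partial>lborel) \<partial>lborel)"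
    by (rule nn_integral_circle_average[OF m, symmetric])
  also have "\<dots> \<le> (\<integral>\<^sup>+w\<in>ball 0 r. ennreal ((cmod (K 0))\<^sup>2 * (1 + \<eta> * (norm w)\<^sup>2) * b w) \<partial>lborel)"
  proof (rule nn_integral_mono)
    fix w :: "complex^'n"
    show "(\<integral>\<^sup>+t\<in>{0..1}. \<Phi> (cis (2 * pi * t) *s w) \<partial>lborel)
       \<le> ennreal ((cmod (K 0))\<^sup>2 * (1 + \<eta> * (norm w)\<^sup>2) * b w) * indicator (ball 0 r) w"
    proof (cases "w \<in> ball 0 r")
      case w: True
      then have wr: "norm w < r" by simp
      obtain R where R: "R > 1" "\<And>\<zeta>. \<zeta> \<in> ball 0 R \<Longrightarrow> \<zeta> *s w \<in> ball 0 r"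
        using circle_in_ball_radius[OF wr] by blast
      define F where "F \<zeta> = K (\<zeta> *s w)" for \<zeta>
      have sub: "ball 0 R \<subseteq> {\<zeta>. \<zeta> *s w \<in> ball 0 r}" using R(2) by blast
      have Fh: "F holomorphic_on ball 0 R"
        unfolding F_def by (rule holomorphic_on_subset[OF hK sub])
      have "(\<integral>\<^sup>+t\<in>{0..1}. ennreal ((cmod (F (cis (2 * pi * t)) - F 0))\<^sup>2) \<partial>lborel)
          \<le> (\<integral>\<^sup>+t\<in>{0..1::real}. ennreal (\<eta> * (cmod (K 0))\<^sup>2 * (norm w)\<^sup>2) \<partial>lborel)"
      proof (intro nn_integral_mono mult_right_mono ennreal_leI)
        fix t :: real
        show "(cmod (F (cis (2 * pi * t)) - F 0))\<^sup>2 \<le> \<eta> * (cmod (K 0))\<^sup>2 * (norm w)\<^sup>2"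
          using near[of "cis (2 * pi * t) *s w"] wr by (simp add: F_def norm_vector_scalar_mult)
      qed auto
      also have "\<dots> = ennreal (\<eta> * (cmod (K 0))\<^sup>2 * (norm w)\<^sup>2)"
        by (subst nn_integral_cmult_indicator) auto
      finally have "(\<integral>\<^sup>+t\<in>{0..1}. ennreal ((cmod (F (cis (2 * pi * t))))\<^sup>2) \<partial>lborel)
         \<le> ennreal ((cmod (F 0))\<^sup>2) + ennreal (\<eta> * (cmod (K 0))\<^sup>2 * (norm w)\<^sup>2)"
        unfolding circle_mean_square[OF Fh R(1)] by (rule add_left_mono)
      also have "\<dots> = ennreal ((cmod (K 0))\<^sup>2 * (1 + \<eta> * (norm w)\<^sup>2))"
        using \<eta> by (subst ennreal_plus[symmetric]) (auto simp: F_def algebra_simps)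
      finally have le: "(\<integral>\<^sup>+t\<in>{0..1}. ennreal ((cmod (F (cis (2 * pi * t))))\<^sup>2) \<partial>lborel) \<le> ennreal ((cmod (K 0))\<^sup>2 * (1 + \<eta> * (norm w)\<^sup>2))" .
      have "(\<integral>\<^sup>+t\<in>{0..1}. \<Phi> (cis (2 * pi * t) *s w) \<partial>lborel)
        = (\<integral>\<^sup>+t. ennreal (b w) * (ennreal ((cmod (F (cis (2 * pi * t))))\<^sup>2) * indicator {0..1} t) \<partial>lborel)"
        using b0[OF w] wr
        by (intro nn_integral_cong) (auto simp: \<Phi>_def F_def inv norm_vector_scalar_mult ennreal_mult mult_ac)
      also have "\<dots> = ennreal (b w) * (\<integral>\<^sup>+t\<in>{0..1}. ennreal ((cmod (F (cis (2 * pi * t))))\<^sup>2) \<partial>lborel)"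
      proof (rule nn_integral_cmult)
        have "continuous_on {0..1} (\<lambda>t. (cmod (F (cis (2 * pi * t))))\<^sup>2)"
          using R by (intro continuous_intros continuous_on_compose2[OF holomorphic_on_imp_continuous_on[OF Fh]]) auto
        then have "(\<lambda>t. ennreal (indicator {0..1} t *\<^sub>R (cmod (F (cis (2 * pi * t))))\<^sup>2)) \<in> borel_measurable lborel"
          using borel_measurable_continuous_on_indicator[of "{0..1}" "\<lambda>t. (cmod (F (cis (2 * pi * t))))\<^sup>2"] by simp
        also have "(\<lambda>t. ennreal (indicator {0..1} t *\<^sub>R (cmod (F (cis (2 * pi * t))))\<^sup>2))
          = (\<lambda>t. ennreal ((cmod (F (cis (2 * pi * t))))\<^sup>2) * indicator {0..1} t)"
          by (auto simp: indicator_def fun_eq_iff)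
        finally show "(\<lambda>t. ennreal ((cmod (F (cis (2 * pi * t))))\<^sup>2) * indicator {0..1} t) \<in> borel_measurable lborel" .
      qed
      also have "\<dots> \<le> ennreal (b w) * ennreal ((cmod (K 0))\<^sup>2 * (1 + \<eta> * (norm w)\<^sup>2))"
        by (intro mult_left_mono le) auto
      also have "\<dots> = ennreal ((cmod (K 0))\<^sup>2 * (1 + \<eta> * (norm w)\<^sup>2) * b w)"
        using b0[OF w] \<eta> by (subst ennreal_mult[symmetric]) (auto simp: mult_ac)
      finally show ?thesis using w by simp
    next
      case False
      then show ?thesis by (simp add: \<Phi>_def norm_vector_scalar_mult)
    qed
  qed
  finally show ?thesis unfolding \<Phi>_def .
qed

lemma nn_integral_ball_continuous:
  fixes g :: "'a::euclidean_space \<Rightarrow> real"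
  assumes g: "continuous_on UNIV g" and g0: "\<And>w. w \<in> ball a r \<Longrightarrow> 0 \<le> g w"
  shows "(\<integral>\<^sup>+w\<in>ball a r. ennreal (g w) \<partial>lborel) = ennreal (LINT w:ball a r|lborel. g w)"
proof -
  have "(\<integral>\<^sup>+w\<in>ball a r. ennreal (g w) \<partial>lborel) = (\<integral>\<^sup>+w. ennreal (indicator (ball a r) w *\<^sub>R g w) \<partial>lborel)"
    by (intro nn_integral_cong) (auto simp: indicator_def)
  also have "\<dots> = ennreal (LINT w:ball a r|lborel. g w)"
    unfolding set_lebesgue_integral_def
    by (intro nn_integral_eq_integral set_integrable_ball_continuous[OF g, unfolded set_integrable_def] AE_I2)
       (auto simp: indicator_def g0)
  finally show ?thesis .
qed

text \<open>
  The two sides of the comparison for a weight \<open>e\<close> that is only pinched between circle invariant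
  quadratic expressions. The restriction on \<open>r\<close> makes the lower expression nonnegative and
  allows the product with \<open>1 + \<eta> |w|\<^sup>2\<close> to be absorbed by passing from \<open>2 \<eta>\<close> to \<open>4 \<eta>\<close>.
\<close>
lemma local_energy_inequalities:
  fixes H0 K :: "complex^'n \<Rightarrow> complex" and H :: "'n \<Rightarrow> complex^'n \<Rightarrow> complex" and e :: "complex^'n \<Rightarrow> real"
    and k :: 'n
  assumes cH0: "continuous_on (ball 0 r) H0" and cH: "\<And>j. continuous_on (ball 0 r) (H j)" and cK: "continuous_on (ball 0 r) K"
    and hH0: "\<And>w. (\<lambda>\<zeta>. H0 (\<zeta> *s w)) holomorphic_on {\<zeta>. \<zeta> *s w \<in> ball 0 r}"
    and hH: "\<And>w j. (\<lambda>\<zeta>. H j (\<zeta> *s w)) holomorphic_on {\<zeta>. \<zeta> *s w \<in> ball 0 r}"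
    and hK: "\<And>w. (\<lambda>\<zeta>. K (\<zeta> *s w)) holomorphic_on {\<zeta>. \<zeta> *s w \<in> ball 0 r}"
    and div: "\<And>w. w \<in> ball 0 r \<Longrightarrow> H0 w + (\<Sum>j\<in>UNIV. w $ j * H j w) = K w"
    and near: "\<And>w. w \<in> ball 0 r \<Longrightarrow> (cmod (K w - K 0))\<^sup>2 \<le> \<eta> * (cmod (K 0))\<^sup>2 * (norm w)\<^sup>2"
    and \<eta>: "\<eta> > 0" and \<tau>: "\<tau> > 0" and r: "r\<^sup>2 * (\<tau> + 2 * \<eta>) \<le> 1"
    and e0: "\<And>w. w \<in> ball 0 r \<Longrightarrow> 1 + \<tau> * (cmod (w $ k))\<^sup>2 - \<eta> * (norm w)\<^sup>2 \<le> e w"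
    and e1: "\<And>w. w \<in> ball 0 r \<Longrightarrow> e w \<le> 1 + \<tau> * (cmod (w $ k))\<^sup>2 + 2 * \<eta> * (norm w)\<^sup>2"
  shows "ennreal ((cmod (K 0))\<^sup>2 * (LINT w:ball 0 r|lborel. (norm w)\<^sup>2 * (1 + \<tau> * (cmod (w $ k))\<^sup>2 - \<eta> * (norm w)\<^sup>2) / (1 + (norm w)\<^sup>2) ^ Suc s))
      \<le> (\<integral>\<^sup>+w\<in>ball 0 r. ennreal (((cmod (H0 w))\<^sup>2 + (\<Sum>j\<in>UNIV. (cmod (H j w))\<^sup>2) - (cmod (K w))\<^sup>2 / (1 + (norm w)\<^sup>2)) * e w / (1 + (norm w)\<^sup>2) ^ s) \<partial>lborel)" (is ?lower)
    and "(\<integral>\<^sup>+w\<in>ball 0 r. ennreal ((cmod (K w))\<^sup>2 * e w / (1 + (norm w)\<^sup>2) ^ Suc s) \<partial>lborel)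
      \<le> ennreal ((cmod (K 0))\<^sup>2 * (LINT w:ball 0 r|lborel. (1 + \<tau> * (cmod (w $ k))\<^sup>2 + 4 * \<eta> * (norm w)\<^sup>2) / (1 + (norm w)\<^sup>2) ^ Suc s))" (is ?upper)
proof -
  have p0: "0 < 1 + (norm x)\<^sup>2" for x :: "complex^'n" by (simp add: add_pos_nonneg)
  then have p1: "1 + (norm x)\<^sup>2 \<noteq> 0" for x :: "complex^'n" by (metis less_irrefl)
  have wk: "(cmod (w $ k))\<^sup>2 \<le> (norm w)\<^sup>2" for w :: "complex^'n"
    by (intro power_mono Finite_Cartesian_Product.norm_nth_le) auto
  have w2: "(norm w)\<^sup>2 \<le> r\<^sup>2" if "w \<in> ball 0 r" for w :: "complex^'n"
    using that by (intro power_mono) auto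
  have small: "(norm w)\<^sup>2 * (\<tau> + 2 * \<eta>) \<le> 1" if "w \<in> ball 0 r" for w :: "complex^'n"
  proof -
    have "(norm w)\<^sup>2 * (\<tau> + 2 * \<eta>) \<le> r\<^sup>2 * (\<tau> + 2 * \<eta>)"
      using \<eta> \<tau> by (intro mult_right_mono w2 that) auto
    with r show ?thesis by linarith
  qed
  define b0 where "b0 w = 1 + \<tau> * (cmod (w $ k))\<^sup>2 - \<eta> * (norm w)\<^sup>2" for w :: "complex^'n"
  define b1 where "b1 w = 1 + \<tau> * (cmod (w $ k))\<^sup>2 + 2 * \<eta> * (norm w)\<^sup>2" for w :: "complex^'n"
  have b00: "b0 w \<ge> 0" if "w \<in> ball 0 r" for w
  proof -
    have "\<eta> * (norm w)\<^sup>2 \<le> (norm w)\<^sup>2 * (\<tau> + 2 * \<eta>)"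
      using \<eta> \<tau> mult_right_mono[of \<eta> "\<tau> + 2 * \<eta>" "(norm w)\<^sup>2"] by (simp add: mult.commute)
    with small[OF that] have "\<eta> * (norm w)\<^sup>2 \<le> 1" by linarith
    moreover have "0 \<le> \<tau> * (cmod (w $ k))\<^sup>2" using \<tau> by simp
    ultimately show ?thesis unfolding b0_def by linarith
  qed
  have b10: "b1 w \<ge> 0" for w unfolding b1_def using \<eta> \<tau> by (intro add_nonneg_nonneg mult_nonneg_nonneg) auto
  have cb0: "continuous_on A b0" and cb1: "continuous_on A b1" for A
    unfolding b0_def b1_def by (intro continuous_intros)+
  have inv: "b0 (cis t *s w) = b0 w" "b1 (cis t *s w) = b1 w" for t w
    by (simp_all add: b0_def b1_def norm_mult norm_vector_scalar_mult)
  show ?lower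
  proof -
    have "ennreal ((cmod (K 0))\<^sup>2 * (LINT w:ball 0 r|lborel. (norm w)\<^sup>2 * (1 + \<tau> * (cmod (w $ k))\<^sup>2 - \<eta> * (norm w)\<^sup>2) / (1 + (norm w)\<^sup>2) ^ Suc s))
       = ennreal (LINT w:ball 0 r|lborel. (cmod (K 0))\<^sup>2 * ((norm w)\<^sup>2 * b0 w / (1 + (norm w)\<^sup>2) ^ Suc s))"
      unfolding b0_def set_integral_mult_right ..
    also have "\<dots> = (\<integral>\<^sup>+w\<in>ball 0 r. ennreal ((cmod (K 0))\<^sup>2 * ((norm w)\<^sup>2 * b0 w / (1 + (norm w)\<^sup>2) ^ Suc s)) \<partial>lborel)"
      using p1 p0 by (intro nn_integral_ball_continuous[symmetric] continuous_intros cb0 ballI mult_nonneg_nonneg divide_nonneg_nonneg b00) (auto simp: less_imp_le)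
    also have "\<dots> = (\<integral>\<^sup>+w\<in>ball 0 r. ennreal ((cmod (K 0))\<^sup>2 * ((norm w)\<^sup>2 / (1 + (norm w)\<^sup>2)) * (b0 w / (1 + (norm w)\<^sup>2) ^ s)) \<partial>lborel)"
      by (simp add: mult_ac)
    also have "\<dots> \<le> (\<integral>\<^sup>+w\<in>ball 0 r. ennreal (((cmod (H0 w))\<^sup>2 + (\<Sum>j\<in>UNIV. (cmod (H j w))\<^sup>2) - (cmod (K w))\<^sup>2 / (1 + (norm w)\<^sup>2)) * (b0 w / (1 + (norm w)\<^sup>2) ^ s)) \<partial>lborel)"
      using p1 p0
      by (intro division_energy_lower_bound cH0 cH cK hH0 hH hK div continuous_intros cb0 divide_nonneg_nonneg b00)
         (auto simp: less_imp_le inv norm_vector_scalar_mult)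
    also have "\<dots> \<le> (\<integral>\<^sup>+w\<in>ball 0 r. ennreal (((cmod (H0 w))\<^sup>2 + (\<Sum>j\<in>UNIV. (cmod (H j w))\<^sup>2) - (cmod (K w))\<^sup>2 / (1 + (norm w)\<^sup>2)) * e w / (1 + (norm w)\<^sup>2) ^ s) \<partial>lborel)"
    proof (intro nn_integral_mono)
      fix w :: "complex^'n"
      have "((cmod (H0 w))\<^sup>2 + (\<Sum>j\<in>UNIV. (cmod (H j w))\<^sup>2) - (cmod (K w))\<^sup>2 / (1 + (norm w)\<^sup>2)) * (b0 w / (1 + (norm w)\<^sup>2) ^ s)
         \<le> ((cmod (H0 w))\<^sup>2 + (\<Sum>j\<in>UNIV. (cmod (H j w))\<^sup>2) - (cmod (K w))\<^sup>2 / (1 + (norm w)\<^sup>2)) * (e w / (1 + (norm w)\<^sup>2) ^ s)" if w: "w \<in> ball 0 r"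
      proof (intro mult_left_mono divide_right_mono)
        show "b0 w \<le> e w" unfolding b0_def by (rule e0[OF w])
        show "0 \<le> (cmod (H0 w))\<^sup>2 + (\<Sum>j\<in>UNIV. (cmod (H j w))\<^sup>2) - (cmod (K w))\<^sup>2 / (1 + (norm w)\<^sup>2)"
          unfolding norm_vec_complex_sq[of w]
          by (subst pointwise_minimal_division[OF div[OF w] refl, symmetric]) (intro add_nonneg_nonneg sum_nonneg, auto)
      qed (use p0[of w] in simp)
      then show "ennreal (((cmod (H0 w))\<^sup>2 + (\<Sum>j\<in>UNIV. (cmod (H j w))\<^sup>2) - (cmod (K w))\<^sup>2 / (1 + (norm w)\<^sup>2)) * (b0 w / (1 + (norm w)\<^sup>2) ^ s)) * indicator (ball 0 r) w
        \<le> ennreal (((cmod (H0 w))\<^sup>2 + (\<Sum>j\<in>UNIV. (cmod (H j w))\<^sup>2) - (cmod (K w))\<^sup>2 / (1 + (norm w)\<^sup>2)) * e w / (1 + (norm w)\<^sup>2) ^ s) * indicator (ball 0 r) w"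
        by (auto simp: indicator_def intro!: ennreal_leI)
    qed
    finally show ?thesis .
  qed
  show ?upper
  proof -
    have "(\<integral>\<^sup>+w\<in>ball 0 r. ennreal ((cmod (K w))\<^sup>2 * e w / (1 + (norm w)\<^sup>2) ^ Suc s) \<partial>lborel)
       \<le> (\<integral>\<^sup>+w\<in>ball 0 r. ennreal ((cmod (K w))\<^sup>2 * (b1 w / (1 + (norm w)\<^sup>2) ^ Suc s)) \<partial>lborel)"
    proof (intro nn_integral_mono)
      fix w :: "complex^'n"
      have "(cmod (K w))\<^sup>2 * (e w / (1 + (norm w)\<^sup>2) ^ Suc s) \<le> (cmod (K w))\<^sup>2 * (b1 w / (1 + (norm w)\<^sup>2) ^ Suc s)" if w: "w \<in> ball 0 r"
        using e1[OF w] p0[of w] by (intro mult_left_mono divide_right_mono) (auto simp: b1_def)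
      then show "ennreal ((cmod (K w))\<^sup>2 * e w / (1 + (norm w)\<^sup>2) ^ Suc s) * indicator (ball 0 r) w \<le> ennreal ((cmod (K w))\<^sup>2 * (b1 w / (1 + (norm w)\<^sup>2) ^ Suc s)) * indicator (ball 0 r) w"
        by (auto simp: indicator_def intro!: ennreal_leI)
    qed
    also have "\<dots> \<le> (\<integral>\<^sup>+w\<in>ball 0 r. ennreal ((cmod (K 0))\<^sup>2 * (1 + \<eta> * (norm w)\<^sup>2) * (b1 w / (1 + (norm w)\<^sup>2) ^ Suc s)) \<partial>lborel)"
      using p1 p0 \<eta>
      by (intro energy_upper_bound cK hK near continuous_intros cb1 divide_nonneg_nonneg b10)
         (auto simp: less_imp_le inv norm_vector_scalar_mult simp del: power_Suc)
    also have "\<dots> \<le> (\<integral>\<^sup>+w\<in>ball 0 r. ennreal ((cmod (K 0))\<^sup>2 * ((1 + \<tau> * (cmod (w $ k))\<^sup>2 + 4 * \<eta> * (norm w)\<^sup>2) / (1 + (norm w)\<^sup>2) ^ Suc s)) \<partial>lborel)"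
    proof (intro nn_integral_mono)
      fix w :: "complex^'n"
      have "(cmod (K 0))\<^sup>2 * (((1 + \<eta> * (norm w)\<^sup>2) * b1 w) / (1 + (norm w)\<^sup>2) ^ Suc s) \<le> (cmod (K 0))\<^sup>2 * ((1 + \<tau> * (cmod (w $ k))\<^sup>2 + 4 * \<eta> * (norm w)\<^sup>2) / (1 + (norm w)\<^sup>2) ^ Suc s)" if w: "w \<in> ball 0 r"
      proof (intro mult_left_mono divide_right_mono)
        have "\<tau> * (cmod (w $ k))\<^sup>2 + 2 * \<eta> * (norm w)\<^sup>2 \<le> (norm w)\<^sup>2 * (\<tau> + 2 * \<eta>)"
          using mult_left_mono[OF wk[of w], of \<tau>] \<tau> by (simp add: algebra_simps)
        with small[OF w] have "\<tau> * (cmod (w $ k))\<^sup>2 + 2 * \<eta> * (norm w)\<^sup>2 \<le> 1" by linarith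
        then have "\<eta> * (norm w)\<^sup>2 * (\<tau> * (cmod (w $ k))\<^sup>2 + 2 * \<eta> * (norm w)\<^sup>2) \<le> \<eta> * (norm w)\<^sup>2 * 1"
          using \<eta> by (intro mult_left_mono) auto
        moreover have "(1 + \<eta> * (norm w)\<^sup>2) * b1 w = b1 w + \<eta> * (norm w)\<^sup>2 + \<eta> * (norm w)\<^sup>2 * (\<tau> * (cmod (w $ k))\<^sup>2 + 2 * \<eta> * (norm w)\<^sup>2)"
          by (simp add: b1_def algebra_simps)
        ultimately show "(1 + \<eta> * (norm w)\<^sup>2) * b1 w \<le> 1 + \<tau> * (cmod (w $ k))\<^sup>2 + 4 * \<eta> * (norm w)\<^sup>2"
          by (simp add: b1_def)
      qed (use p0[of w] in auto)
      then show "ennreal ((cmod (K 0))\<^sup>2 * (1 + \<eta> * (norm w)\<^sup>2) * (b1 w / (1 + (norm w)\<^sup>2) ^ Suc s)) * indicator (ball 0 r) w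
         \<le> ennreal ((cmod (K 0))\<^sup>2 * ((1 + \<tau> * (cmod (w $ k))\<^sup>2 + 4 * \<eta> * (norm w)\<^sup>2) / (1 + (norm w)\<^sup>2) ^ Suc s)) * indicator (ball 0 r) w"
        by (auto simp: indicator_def mult.assoc simp del: power_Suc intro!: ennreal_leI)
    qed
    also have "\<dots> = ennreal (LINT w:ball 0 r|lborel. (cmod (K 0))\<^sup>2 * ((1 + \<tau> * (cmod (w $ k))\<^sup>2 + 4 * \<eta> * (norm w)\<^sup>2) / (1 + (norm w)\<^sup>2) ^ Suc s))"
      using p1 p0 \<eta> \<tau> by (intro nn_integral_ball_continuous continuous_intros ballI mult_nonneg_nonneg divide_nonneg_nonneg add_nonneg_nonneg) (auto simp: less_imp_le simp del: power_Suc)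
    also have "\<dots> = ennreal ((cmod (K 0))\<^sup>2 * (LINT w:ball 0 r|lborel. (1 + \<tau> * (cmod (w $ k))\<^sup>2 + 4 * \<eta> * (norm w)\<^sup>2) / (1 + (norm w)\<^sup>2) ^ Suc s))"
      unfolding set_integral_mult_right ..
    finally show ?thesis .
  qed
qed

section \<open>Skoda division for a concentrated tuple\<close>

lemma holomorphic_fun_on_mult:
  assumes "f holomorphic_fun_on D" "g holomorphic_fun_on D"
  shows "(\<lambda>z. f z * g z) holomorphic_fun_on D"
  unfolding holomorphic_fun_on_def
proof
  fix z assume "z \<in> D"
  with assms obtain L M where L: "(f has_derivative L) (at z)" "\<And>c v. L (c *s v) = c * L v"
    and M: "(g has_derivative M) (at z)" "\<And>c v. M (c *s v) = c * M v"
    unfolding holomorphic_fun_on_def by metis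
  have "((\<lambda>z. f z * g z) has_derivative (\<lambda>v. f z * M v + L v * g z)) (at z)"
    by (rule has_derivative_mult[OF L(1) M(1)])
  then show "\<exists>L. ((\<lambda>z. f z * g z) has_derivative L) (at z) \<and> (\<forall>c v. L (c *s v) = c * L v)"
    by (intro exI conjI) (auto simp: L M algebra_simps)
qed

lemma holomorphic_fun_on_exp:
  assumes "f holomorphic_fun_on D"
  shows "(\<lambda>z. exp (f z)) holomorphic_fun_on D"
  unfolding holomorphic_fun_on_def
proof
  fix z assume "z \<in> D"
  with assms obtain L where L: "(f has_derivative L) (at z)" "\<And>c v. L (c *s v) = c * L v"
    unfolding holomorphic_fun_on_def by metis
  have "((\<lambda>z. exp (f z)) has_derivative (\<lambda>v. exp (f z) * L v)) (at z)"
    using has_derivative_compose[OF L(1), of exp "\<lambda>h. exp (f z) * h"] DERIV_exp[of "f z"]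
    unfolding has_field_derivative_def by auto
  then show "\<exists>L. ((\<lambda>z. exp (f z)) has_derivative L) (at z) \<and> (\<forall>c v. L (c *s v) = c * L v)"
    by (intro exI conjI) (auto simp: L algebra_simps)
qed

lemma holomorphic_fun_on_const: "(\<lambda>z. c) holomorphic_fun_on D"
  unfolding holomorphic_fun_on_def by (auto intro!: exI[of _ "\<lambda>_. 0"])

lemma holomorphic_fun_on_affine:
  assumes "linear L" "\<And>c v. L (c *s v) = c * L v"
  shows "(\<lambda>z. L (z - a)) holomorphic_fun_on D"
  unfolding holomorphic_fun_on_def
proof
  fix z
  have "bounded_linear L" using assms(1) by (simp add: linear_conv_bounded_linear)
  moreover have "((\<lambda>z. z - a) has_derivative (\<lambda>h. h)) (at z)"
    by (auto intro!: derivative_eq_intros)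
  ultimately have "((\<lambda>z. L (z - a)) has_derivative L) (at z)"
    by (rule bounded_linear.has_derivative)
  then show "\<exists>L'. ((\<lambda>z. L (z - a)) has_derivative L') (at z) \<and> (\<forall>c v. L' (c *s v) = c * L' v)"
    using assms(2) by blast
qed

text \<open>
  This energy bounds all contributions from outside a neighbourhood of the centre, uniformly in \<open>N\<close>.
\<close>
lemma twisted_energy_finite:
  fixes D :: "(complex^'n) set"
  assumes fA: "f \<in> weighted_bergman D \<phi>" and bd: "\<And>z. z \<in> D \<Longrightarrow> - B \<le> Re (\<Lambda> z)"
    and D: "open D" and \<phi>: "continuous_on D \<phi>"
  shows "(\<integral>\<^sup>+z\<in>D. ennreal ((cmod (f z))\<^sup>2 * exp (- \<phi> z - 2 * Re (\<Lambda> z))) \<partial>lborel) < \<infinity>"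
proof -
  have leb: "(\<integral>\<^sup>+z\<in>D. G z \<partial>lebesgue) = (\<integral>\<^sup>+z\<in>D. G z \<partial>lborel)" for G :: "complex^'n \<Rightarrow> ennreal"
    by (rule nn_integral_completion)
  have "(\<integral>\<^sup>+z\<in>D. ennreal ((cmod (f z))\<^sup>2 * exp (- \<phi> z - 2 * Re (\<Lambda> z))) \<partial>lborel)
      \<le> (\<integral>\<^sup>+z\<in>D. ennreal (exp (2 * B)) * ennreal ((cmod (f z))\<^sup>2 * exp (- \<phi> z)) \<partial>lborel)"
  proof (intro nn_integral_mono)
    fix z
    have "(cmod (f z))\<^sup>2 * exp (- \<phi> z - 2 * Re (\<Lambda> z)) \<le> exp (2 * B) * ((cmod (f z))\<^sup>2 * exp (- \<phi> z))" if "z \<in> D"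
    proof -
      have "(cmod (f z))\<^sup>2 * exp (- \<phi> z - 2 * Re (\<Lambda> z)) \<le> (cmod (f z))\<^sup>2 * exp (2 * B + - \<phi> z)"
        using bd[OF that] by (simp add: mult_left_mono)
      also have "\<dots> = exp (2 * B) * ((cmod (f z))\<^sup>2 * exp (- \<phi> z))"
        by (subst exp_add) (simp add: mult_ac)
      finally show ?thesis .
    qed
    then show "ennreal ((cmod (f z))\<^sup>2 * exp (- \<phi> z - 2 * Re (\<Lambda> z))) * indicator D z
      \<le> ennreal (exp (2 * B)) * ennreal ((cmod (f z))\<^sup>2 * exp (- \<phi> z)) * indicator D z"
      by (auto simp: indicator_def ennreal_mult[symmetric] intro!: ennreal_leI)
  qed
  also have "\<dots> = ennreal (exp (2 * B)) * (\<integral>\<^sup>+z\<in>D. ennreal ((cmod (f z))\<^sup>2 * exp (- \<phi> z)) \<partial>lborel)"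
  proof -
    have "f holomorphic_fun_on D" using fA by (simp add: weighted_bergman_def)
    then have "continuous_on D (\<lambda>z. (cmod (f z))\<^sup>2 * exp (- \<phi> z))"
      by (intro continuous_intros \<phi> holomorphic_fun_on_imp_continuous_on)
    then have "(\<lambda>z. indicator D z *\<^sub>R ((cmod (f z))\<^sup>2 * exp (- \<phi> z))) \<in> borel_measurable borel"
      using D by (intro borel_measurable_continuous_on_indicator) auto
    then have m: "(\<lambda>z. ennreal (indicator D z *\<^sub>R ((cmod (f z))\<^sup>2 * exp (- \<phi> z)))) \<in> borel_measurable lborel"
      by simp
    have e: "ennreal ((cmod (f z))\<^sup>2 * exp (- \<phi> z)) * indicator D z = ennreal (indicator D z *\<^sub>R ((cmod (f z))\<^sup>2 * exp (- \<phi> z)))" for z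
      by (auto simp: indicator_def)
    show ?thesis unfolding mult.assoc e by (rule nn_integral_cmult[OF m])
  qed
  also have "\<dots> < \<infinity>"
    using fA unfolding weighted_bergman_def leb by (auto simp: ennreal_mult_less_top)
  finally show ?thesis .
qed

text \<open>
  Skoda divisibility for the tuple \<open>e\<^sup>A (1, q\<^sub>1, \<dots>, q\<^sub>n)\<close> with \<open>A = \<Lambda> / (s + 1)\<close> and \<open>\<epsilon> = N\<close>. Since
  \<open>|g|\<^sup>2 = exp (2 Re A) (1 + |q|\<^sup>2)\<close>, the energy of \<open>f\<close> carries the power \<open>s + 1\<close> of \<open>|g|\<^sup>-\<^sup>2\<close>, hence
  the factor \<open>exp (- 2 Re \<Lambda>)\<close>. On the side of \<open>h\<close> the missing power of \<open>e\<^sup>A\<close> is moved into \<open>h\<close>, which then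
  divides \<open>f\<close> by \<open>(1, q)\<close>. The twist \<open>\<Lambda>\<close> is thus the same for all \<open>N\<close>.
\<close>
lemma skoda_division_with_twist:
  fixes D :: "(complex^'n) set" and q :: "complex^'n \<Rightarrow> complex^'n" and N :: nat
  assumes sk: "skoda_divisible D \<phi> f" and fA: "f \<in> weighted_bergman D \<phi>"
    and q: "\<And>j. (\<lambda>z. q z $ j) holomorphic_fun_on D"
    and \<Lambda>: "\<Lambda> holomorphic_fun_on D" and bd: "\<And>z. z \<in> D \<Longrightarrow> - B \<le> Re (\<Lambda> z)"
    and N: "N \<ge> 1" and D: "open D" and \<phi>: "continuous_on D \<phi>"
  defines "s \<equiv> CARD('n) * (1 + N)"
  obtains h0 h where
    "(\<integral>\<^sup>+z\<in>D. ennreal ((cmod (f z))\<^sup>2 * exp (- \<phi> z - 2 * Re (\<Lambda> z)) / (1 + (norm (q z))\<^sup>2) ^ Suc s) \<partial>lborel) < \<infinity>"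
    "h0 holomorphic_fun_on D" "\<And>j. h j holomorphic_fun_on D"
    "\<And>z. z \<in> D \<Longrightarrow> h0 z + (\<Sum>j\<in>UNIV. q z $ j * h j z) = f z"
    "(\<integral>\<^sup>+z\<in>D. ennreal (((cmod (h0 z))\<^sup>2 + (\<Sum>j\<in>UNIV. (cmod (h j z))\<^sup>2)) * exp (- \<phi> z - 2 * Re (\<Lambda> z)) / (1 + (norm (q z))\<^sup>2) ^ s) \<partial>lborel)
       \<le> ennreal (1 + 1 / real N) * (\<integral>\<^sup>+z\<in>D. ennreal ((cmod (f z))\<^sup>2 * exp (- \<phi> z - 2 * Re (\<Lambda> z)) / (1 + (norm (q z))\<^sup>2) ^ Suc s) \<partial>lborel)"
proof -
  obtain \<sigma> :: "'n \<Rightarrow> nat" where \<sigma>: "bij_betw \<sigma> UNIV {..<CARD('n)}"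
    using ex_bij_betw_finite_nat[of "UNIV::'n set"] by (auto simp: atLeast0LessThan)
  define idx where "idx = inv_into UNIV \<sigma>"
  have idx: "idx (\<sigma> j) = j" for j
    using \<sigma> unfolding idx_def by (simp add: bij_betw_def)
  have sum\<sigma>: "(\<Sum>j<Suc CARD('n). F j) = F 0 + (\<Sum>i\<in>UNIV. F (Suc (\<sigma> i)))" for F :: "nat \<Rightarrow> 'z::comm_monoid_add"
    using sum.reindex_bij_betw[OF \<sigma>, of "\<lambda>j. F (Suc j)"] by (simp add: sum.lessThan_Suc_shift del: sum.lessThan_Suc)
  \<comment> \<open>The energy of \<open>f\<close> carries the power \<open>s + 1\<close> of \<open>|g|\<^sup>-\<^sup>2\<close>: \<open>s\<close> from the Skoda weight and \<open>1\<close> from \<open>|f|\<^sup>2 / |g|\<^sup>2\<close>.\<close>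
  define A where "A z = \<Lambda> z * (1 / of_nat (Suc s))" for z
  have A: "A holomorphic_fun_on D"
    unfolding A_def by (intro holomorphic_fun_on_mult \<Lambda> holomorphic_fun_on_const)
  have eA: "(\<lambda>z. exp (A z)) holomorphic_fun_on D" by (rule holomorphic_fun_on_exp[OF A])
  have sA: "Re (\<Lambda> z) = real (Suc s) * Re (A z)" for z unfolding A_def by (simp del: of_nat_Suc)
  \<comment> \<open>Entry \<open>0\<close> is \<open>e\<^sup>A\<close>, so the tuple has no common zero.\<close>
  define g where "g j z = exp (A z) * (case j of 0 \<Rightarrow> 1 | Suc i \<Rightarrow> q z $ idx i)" for j z
  have gh: "g j holomorphic_fun_on D" for j
    unfolding g_def by (cases j) (auto intro!: holomorphic_fun_on_mult eA holomorphic_fun_on_const q)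
  define Q where "Q z = 1 + (norm (q z))\<^sup>2" for z
  have Q1: "Q z \<ge> 1" for z by (simp add: Q_def)
  have Q0: "Q z > 0" for z using Q1[of z] by linarith
  have gn: "tuple_normsq (Suc CARD('n)) g z = exp (2 * Re (A z)) * Q z" for z
    by (simp add: tuple_normsq_def sum\<sigma> g_def idx Q_def norm_vec_complex_sq norm_mult power_mult_distrib
        sum_distrib_left distrib_left exp_double del: sum.lessThan_Suc)
  have min: "min CARD('n) (Suc CARD('n) - 1) = CARD('n)" by simp
  have wt: "exp (- \<phi> z - skoda_weight (Suc CARD('n)) g (real N) z) = exp (- \<phi> z - 2 * Re (\<Lambda> z)) * exp (2 * Re (A z)) / Q z ^ s" for z
  proof -
    have "skoda_weight (Suc CARD('n)) g (real N) z = real s * (2 * Re (A z) + ln (Q z))"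
      unfolding skoda_weight_def gn min using Q0[of z] by (simp add: s_def ln_mult distrib_left)
    also have "\<dots> = 2 * Re (\<Lambda> z) - 2 * Re (A z) + real s * ln (Q z)"
      by (simp add: sA algebra_simps)
    finally have "- \<phi> z - skoda_weight (Suc CARD('n)) g (real N) z = (- \<phi> z - 2 * Re (\<Lambda> z)) + 2 * Re (A z) - real s * ln (Q z)" by simp
    also have "exp \<dots> = exp (- \<phi> z - 2 * Re (\<Lambda> z)) * exp (2 * Re (A z)) / exp (real s * ln (Q z))"
      by (simp only: exp_diff exp_add)
    also have "exp (real s * ln (Q z)) = Q z ^ s" using Q0[of z] by (simp add: exp_of_nat_mult)
    finally show ?thesis .
  qed
  have leb: "(\<integral>\<^sup>+z\<in>D. G z \<partial>lebesgue) = (\<integral>\<^sup>+z\<in>D. G z \<partial>lborel)" for G :: "complex^'n \<Rightarrow> ennreal"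
    by (rule nn_integral_completion)
  let ?J = "\<integral>\<^sup>+z\<in>D. ennreal ((cmod (f z))\<^sup>2 * exp (- \<phi> z - 2 * Re (\<Lambda> z)) / Q z ^ Suc s) \<partial>lborel"
  have J: "skoda_J D \<phi> (Suc CARD('n)) g (real N) f = ?J"
  proof -
    have "F / (E * y) * (X * E / P) = F * X / (y * P)" if "E \<noteq> 0" for F E X y P :: real
      using that by simp
    then show ?thesis unfolding skoda_J_def wt gn leb power_Suc by (simp only: exp_not_eq_zero not_False_eq_True)
  qed
  have fin: "?J < \<infinity>"
  proof -
    have "?J \<le> (\<integral>\<^sup>+z\<in>D. ennreal ((cmod (f z))\<^sup>2 * exp (- \<phi> z - 2 * Re (\<Lambda> z))) \<partial>lborel)"
    proof (intro nn_integral_mono mult_right_mono ennreal_leI)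
      fix z
      have "(cmod (f z))\<^sup>2 * exp (- \<phi> z - 2 * Re (\<Lambda> z)) / Q z ^ Suc s \<le> (cmod (f z))\<^sup>2 * exp (- \<phi> z - 2 * Re (\<Lambda> z)) / 1"
        using one_le_power[OF Q1, of z "Suc s"] by (intro divide_left_mono) auto
      then show "(cmod (f z))\<^sup>2 * exp (- \<phi> z - 2 * Re (\<Lambda> z)) / Q z ^ Suc s \<le> (cmod (f z))\<^sup>2 * exp (- \<phi> z - 2 * Re (\<Lambda> z))"
        by simp
    qed auto
    also have "\<dots> < \<infinity>" by (rule twisted_energy_finite[OF fA bd D \<phi>])
    finally show ?thesis .
  qed
  have "\<exists>j<Suc CARD('n). g j z \<noteq> 0" for z by (rule exI[of _ 0]) (simp add: g_def)
  then have pre: "Suc CARD('n) \<ge> 1 \<and> (\<forall>j<Suc CARD('n). g j holomorphic_fun_on D) \<and> (\<forall>z\<in>D. \<exists>j<Suc CARD('n). g j z \<noteq> 0) \<and>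
      real N > 0 \<and> skoda_J D \<phi> (Suc CARD('n)) g (real N) f < \<infinity>"
    using gh N fin unfolding J by auto
  obtain k where k:
    "\<forall>j<Suc CARD('n). k j holomorphic_fun_on D"
    "\<forall>z\<in>D. (\<Sum>j<Suc CARD('n). g j z * k j z) = f z"
    "(\<integral>\<^sup>+z\<in>D. ennreal (tuple_normsq (Suc CARD('n)) k z * exp (- \<phi> z - skoda_weight (Suc CARD('n)) g (real N) z)) \<partial>lebesgue)
      \<le> ennreal (1 + 1 / real N) * skoda_J D \<phi> (Suc CARD('n)) g (real N) f"
    using sk[unfolded skoda_divisible_def, THEN conjunct2, THEN conjunct2, THEN spec[where x="Suc CARD('n)"],
        THEN spec[where x=g], THEN spec[where x="real N"], THEN mp, OF pre]
    by (elim exE conjE)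
  have \<sigma>l: "Suc (\<sigma> j) < Suc CARD('n)" for j using \<sigma> by (auto simp: bij_betw_def)
  show ?thesis
  proof (rule that[OF fin[unfolded Q_def], of "\<lambda>z. exp (A z) * k 0 z" "\<lambda>j z. exp (A z) * k (Suc (\<sigma> j)) z"])
    show "(\<lambda>z. exp (A z) * k 0 z) holomorphic_fun_on D" by (intro holomorphic_fun_on_mult eA k(1)[rule_format]) simp
    show "(\<lambda>z. exp (A z) * k (Suc (\<sigma> j)) z) holomorphic_fun_on D" for j by (intro holomorphic_fun_on_mult eA k(1)[rule_format] \<sigma>l)
    show "exp (A z) * k 0 z + (\<Sum>j\<in>UNIV. q z $ j * (exp (A z) * k (Suc (\<sigma> j)) z)) = f z" if "z \<in> D" for z
      using k(2)[rule_format, OF that] by (simp add: sum\<sigma> g_def idx mult_ac del: sum.lessThan_Suc)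
    have eq: "((cmod (exp (A z) * k 0 z))\<^sup>2 + (\<Sum>j\<in>UNIV. (cmod (exp (A z) * k (Suc (\<sigma> j)) z))\<^sup>2)) = exp (2 * Re (A z)) * tuple_normsq (Suc CARD('n)) k z" for z
      by (simp add: tuple_normsq_def sum\<sigma> norm_mult power_mult_distrib
        sum_distrib_left distrib_left exp_double del: sum.lessThan_Suc)
    have "F * T * X / P = T * (X * F / P)" for F T X P :: real by simp
    then have "(\<integral>\<^sup>+z\<in>D. ennreal (((cmod (exp (A z) * k 0 z))\<^sup>2 + (\<Sum>j\<in>UNIV. (cmod (exp (A z) * k (Suc (\<sigma> j)) z))\<^sup>2)) * exp (- \<phi> z - 2 * Re (\<Lambda> z)) / (1 + (norm (q z))\<^sup>2) ^ s) \<partial>lborel)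
      = (\<integral>\<^sup>+z\<in>D. ennreal (tuple_normsq (Suc CARD('n)) k z * exp (- \<phi> z - skoda_weight (Suc CARD('n)) g (real N) z)) \<partial>lebesgue)"
      unfolding leb wt Q_def eq by (simp only:)
    also have "\<dots> \<le> ennreal (1 + 1 / real N) * ?J" using k(3) unfolding J .
    finally show "(\<integral>\<^sup>+z\<in>D. ennreal (((cmod (exp (A z) * k 0 z))\<^sup>2 + (\<Sum>j\<in>UNIV. (cmod (exp (A z) * k (Suc (\<sigma> j)) z))\<^sup>2)) * exp (- \<phi> z - 2 * Re (\<Lambda> z)) / (1 + (norm (q z))\<^sup>2) ^ s) \<partial>lborel)
       \<le> ennreal (1 + 1 / real N) * (\<integral>\<^sup>+z\<in>D. ennreal ((cmod (f z))\<^sup>2 * exp (- \<phi> z - 2 * Re (\<Lambda> z)) / (1 + (norm (q z))\<^sup>2) ^ Suc s) \<partial>lborel)"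
      unfolding Q_def .
  qed
qed

text \<open>
  The Skoda estimate after removing the pointwise minimal energy, restricted on the left to a ball
  in the coordinates \<open>w = V (z - a)\<close>. Outside the ball the energy density of \<open>f\<close> is at most its
  \<open>N\<close>-independent part times \<open>(1 + r\<^sup>2)\<^sup>-\<^sup>s\<close>, which gives the error term; \<open>C\<close> is the total energy
  divided by the Jacobian of \<open>T\<close>.
\<close>
lemma skoda_energy_comparison:
  fixes D :: "(complex^'n) set" and T V :: "complex^'n \<Rightarrow> complex^'n"
  assumes sk: "skoda_divisible D \<phi> f" and fA: "f \<in> weighted_bergman D \<phi>"
    and D: "open D" and \<phi>: "continuous_on D \<phi>"
    and T: "linear T" and V: "linear V" and TV: "\<And>z. T (V z) = z" and VT: "\<And>w. V (T w) = w"
    and Vc: "\<And>c z. V (c *s z) = c *s V z"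
    and \<Lambda>: "\<Lambda> holomorphic_fun_on D" and bd: "\<And>z. z \<in> D \<Longrightarrow> - B \<le> Re (\<Lambda> z)"
    and r: "r > 0" and rD: "\<And>w. norm w < r \<Longrightarrow> a + T w \<in> D"
  obtains C :: real where "C \<ge> 0"
    "\<And>N::nat. N \<ge> 1 \<Longrightarrow> \<exists>h0 h. h0 holomorphic_fun_on D \<and> (\<forall>j. h j holomorphic_fun_on D) \<and>
       (\<forall>w\<in>ball 0 r. h0 (a + T w) + (\<Sum>j\<in>UNIV. w $ j * h j (a + T w)) = f (a + T w)) \<and>
       (\<integral>\<^sup>+w\<in>ball 0 r. ennreal (((cmod (h0 (a + T w)))\<^sup>2 + (\<Sum>j\<in>UNIV. (cmod (h j (a + T w)))\<^sup>2) - (cmod (f (a + T w)))\<^sup>2 / (1 + (norm w)\<^sup>2))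
             * exp (- \<phi> (a + T w) - 2 * Re (\<Lambda> (a + T w))) / (1 + (norm w)\<^sup>2) ^ (CARD('n) * (1 + N))) \<partial>lborel)
       \<le> ennreal (1 / real N) * ((\<integral>\<^sup>+w\<in>ball 0 r. ennreal ((cmod (f (a + T w)))\<^sup>2 * exp (- \<phi> (a + T w) - 2 * Re (\<Lambda> (a + T w))) / (1 + (norm w)\<^sup>2) ^ Suc (CARD('n) * (1 + N))) \<partial>lborel)
           + ennreal (C / (1 + r\<^sup>2) ^ (CARD('n) * (1 + N))))"
proof -
  obtain c where c: "0 < c" "c < \<infinity>" "\<And>F a. F \<in> borel_measurable borel \<Longrightarrow>
       (\<integral>\<^sup>+x. F x \<partial>lborel) = c * (\<integral>\<^sup>+y. F (a + T y) \<partial>lborel)"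
    using nn_integral_lborel_linear[OF T V TV VT] by metis
  define W where "W z = exp (- \<phi> z - 2 * Re (\<Lambda> z))" for z
  have W0: "W z > 0" for z by (simp add: W_def)
  have cW: "continuous_on D W" unfolding W_def
    by (intro continuous_intros \<phi> holomorphic_fun_on_imp_continuous_on[OF \<Lambda>])
  have fh: "f holomorphic_fun_on D" using fA by (simp add: weighted_bergman_def)
  define q where "q z = V (z - a)" for z
  have qh: "(\<lambda>z. q z $ j) holomorphic_fun_on D" for j
  proof -
    have "linear (\<lambda>v. V v $ j)"
      using V by (intro linearI) (simp_all add: linear_add linear_scale)
    from holomorphic_fun_on_affine[OF this, of a D] show ?thesis by (simp add: q_def Vc)
  qed
  have qT: "q (a + T w) = w" for w by (simp add: q_def VT)
  have cq: "continuous_on A q" for A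
  proof -
    have "continuous_on UNIV V" using V by (intro linear_continuous_on) (simp add: linear_conv_bounded_linear)
    then show ?thesis unfolding q_def by (rule continuous_on_compose2) (auto intro!: continuous_intros)
  qed
  define Q where "Q z = 1 + (norm (q z))\<^sup>2" for z
  have Q0: "Q z > 0" for z by (simp add: Q_def add_pos_nonneg)
  have cQ: "continuous_on A Q" for A unfolding Q_def by (intro continuous_intros cq)
  define E where "E = (\<integral>\<^sup>+z\<in>D. ennreal ((cmod (f z))\<^sup>2 * W z) \<partial>lborel)"
  have Efin: "E < \<infinity>" unfolding E_def W_def by (rule twisted_energy_finite[OF fA bd D \<phi>])
  define C where "C = enn2real (E / c)"
  have EC: "E = c * ennreal C"
  proof -
    have "E / c \<noteq> top" using Efin c by (auto simp: ennreal_divide_eq_top_iff)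
    then have "ennreal C = E / c" by (simp add: C_def less_top)
    then show ?thesis using c by (simp add: ennreal_times_divide mult_divide_eq_ennreal mult.commute)
  qed
  have bm: "(\<lambda>z. ennreal (g z) * indicator D z) \<in> borel_measurable borel" if "continuous_on D g" for g :: "complex^'n \<Rightarrow> real"
  proof -
    have "(\<lambda>z. indicator D z *\<^sub>R g z) \<in> borel_measurable borel"
      using D that by (intro borel_measurable_continuous_on_indicator) auto
    then have "(\<lambda>z. ennreal (indicator D z *\<^sub>R g z)) \<in> borel_measurable borel" by simp
    also have "(\<lambda>z. ennreal (indicator D z *\<^sub>R g z)) = (\<lambda>z. ennreal (g z) * indicator D z)"
      by (auto simp: indicator_def fun_eq_iff)
    finally show ?thesis .
  qed
  define Bq where "Bq = {z. norm (q z) < r}"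
  have "open Bq" unfolding Bq_def using cq by (intro open_Collect_less continuous_intros)
  then have [measurable]: "Bq \<in> sets borel" by simp
  have pull: "(\<integral>\<^sup>+z. ennreal (g z) * indicator D z * indicator Bq z \<partial>lborel) = c * (\<integral>\<^sup>+w\<in>ball 0 r. ennreal (g (a + T w)) \<partial>lborel)"
    if "continuous_on D g" for g
  proof -
    have "(\<integral>\<^sup>+z. ennreal (g z) * indicator D z * indicator Bq z \<partial>lborel)
       = c * (\<integral>\<^sup>+w. ennreal (g (a + T w)) * indicator D (a + T w) * indicator Bq (a + T w) \<partial>lborel)"
      by (rule c(3)) (intro borel_measurable_times_ennreal bm that borel_measurable_indicator, measurable)
    also have "(\<integral>\<^sup>+w. ennreal (g (a + T w)) * indicator D (a + T w) * indicator Bq (a + T w) \<partial>lborel) = (\<integral>\<^sup>+w\<in>ball 0 r. ennreal (g (a + T w)) \<partial>lborel)"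
      by (intro nn_integral_cong) (auto simp: indicator_def Bq_def qT rD)
    finally show ?thesis .
  qed
  show ?thesis
  proof (rule that[of C])
    show "C \<ge> 0" by (simp add: C_def)
    fix N :: nat assume N: "N \<ge> 1"
    define s where "s = CARD('n) * (1 + N)"
    obtain h0 h where fin: "(\<integral>\<^sup>+z\<in>D. ennreal ((cmod (f z))\<^sup>2 * W z / Q z ^ Suc s) \<partial>lborel) < \<infinity>"
      and h0: "h0 holomorphic_fun_on D" and h: "\<And>j. h j holomorphic_fun_on D"
      and div: "\<And>z. z \<in> D \<Longrightarrow> h0 z + (\<Sum>j\<in>UNIV. q z $ j * h j z) = f z"
      and est: "(\<integral>\<^sup>+z\<in>D. ennreal (((cmod (h0 z))\<^sup>2 + (\<Sum>j\<in>UNIV. (cmod (h j z))\<^sup>2)) * W z / Q z ^ s) \<partial>lborel)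
         \<le> ennreal (1 + 1 / real N) * (\<integral>\<^sup>+z\<in>D. ennreal ((cmod (f z))\<^sup>2 * W z / Q z ^ Suc s) \<partial>lborel)"
      by (rule skoda_division_with_twist[OF sk fA qh \<Lambda> bd N D \<phi>, folded W_def Q_def s_def]) (assumption | rule that)+
    define X where "X z = ((cmod (h0 z))\<^sup>2 + (\<Sum>j\<in>UNIV. (cmod (h j z))\<^sup>2) - (cmod (f z))\<^sup>2 / Q z) * W z / Q z ^ s" for z
    define Y where "Y z = (cmod (f z))\<^sup>2 * W z / Q z ^ Suc s" for z
    have cX: "continuous_on D X" and cY: "continuous_on D Y"
      unfolding X_def Y_def using Q0
      by (intro continuous_intros cW cQ holomorphic_fun_on_imp_continuous_on h0 h fh; metis less_irrefl power_not_zero)+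
    have X0: "X z \<ge> 0" if "z \<in> D" for z
    proof -
      have "0 \<le> (cmod (h0 z))\<^sup>2 + (\<Sum>j\<in>UNIV. (cmod (h j z))\<^sup>2) - (cmod (f z))\<^sup>2 / Q z"
        unfolding Q_def norm_vec_complex_sq[of "q z"]
        by (subst pointwise_minimal_division[OF div[OF that] refl, symmetric]) (intro add_nonneg_nonneg sum_nonneg, auto)
      then show ?thesis unfolding X_def using W0[of z] Q0[of z] by (intro divide_nonneg_nonneg mult_nonneg_nonneg) auto
    qed
    have Y0: "Y z \<ge> 0" for z unfolding Y_def using W0[of z] Q0[of z] by (intro divide_nonneg_nonneg mult_nonneg_nonneg) auto
    have XY: "((cmod (h0 z))\<^sup>2 + (\<Sum>j\<in>UNIV. (cmod (h j z))\<^sup>2)) * W z / Q z ^ s = X z + Y z" for z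
    proof -
      have "A * w / P = (A - F / y) * w / P + F * w / (y * P)" if "y > 0" "P > 0" for A w P F y :: real
        using that by (simp add: field_simps)
      then show ?thesis unfolding X_def Y_def power_Suc using Q0[of z] by simp
    qed
    define IX where "IX = (\<integral>\<^sup>+z\<in>D. ennreal (X z) \<partial>lborel)"
    define IY where "IY = (\<integral>\<^sup>+z\<in>D. ennreal (Y z) \<partial>lborel)"
    have "IX + IY = (\<integral>\<^sup>+z. ennreal (X z) * indicator D z + ennreal (Y z) * indicator D z \<partial>lborel)"
      unfolding IX_def IY_def using bm[OF cX] bm[OF cY] by (intro nn_integral_add[symmetric]) simp_all
    also have "\<dots> = (\<integral>\<^sup>+z\<in>D. ennreal (X z + Y z) \<partial>lborel)"
      using X0 Y0 by (intro nn_integral_cong) (auto simp: indicator_def)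
    also have "\<dots> \<le> ennreal (1 + 1 / real N) * IY"
      using est unfolding XY IY_def Y_def .
    also have "\<dots> = IY + ennreal (1 / real N) * IY"
      by (simp add: ennreal_plus distrib_right)
    finally have "IY + IX \<le> IY + ennreal (1 / real N) * IY" by (simp add: add.commute)
    moreover have "IY \<noteq> top" using fin unfolding IY_def Y_def by simp
    ultimately have main: "IX \<le> ennreal (1 / real N) * IY"
      by (simp add: ennreal_add_left_cancel_le)
    have "c * (\<integral>\<^sup>+w\<in>ball 0 r. ennreal (X (a + T w)) \<partial>lborel) \<le> IX"
      unfolding pull[OF cX, symmetric] IX_def by (intro nn_integral_mono) (auto simp: indicator_def)
    moreover have "IY \<le> c * ((\<integral>\<^sup>+w\<in>ball 0 r. ennreal (Y (a + T w)) \<partial>lborel) + ennreal (C / (1 + r\<^sup>2) ^ s))"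
    proof -
      have rr: "1 + r\<^sup>2 \<ge> 1" "1 + r\<^sup>2 > 0" by (auto simp: add_pos_nonneg)
      have "IY \<le> (\<integral>\<^sup>+z. ennreal (Y z) * indicator D z * indicator Bq z + ennreal (1 / (1 + r\<^sup>2) ^ s) * (ennreal ((cmod (f z))\<^sup>2 * W z) * indicator D z) \<partial>lborel)"
        unfolding IY_def
      proof (intro nn_integral_mono)
        fix z
        have "Y z \<le> 1 / (1 + r\<^sup>2) ^ s * ((cmod (f z))\<^sup>2 * W z)" if "z \<notin> Bq"
        proof -
          have "r\<^sup>2 \<le> (norm (q z))\<^sup>2" using that r by (intro power_mono) (auto simp: Bq_def)
          then have "(1 + r\<^sup>2) ^ s \<le> Q z ^ s" using rr by (intro power_mono) (auto simp: Q_def)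
          also have "\<dots> \<le> Q z ^ Suc s" by (intro power_increasing) (auto simp: Q_def)
          finally have "(1 + r\<^sup>2) ^ s \<le> Q z ^ Suc s" .
          then have "(cmod (f z))\<^sup>2 * W z / Q z ^ Suc s \<le> (cmod (f z))\<^sup>2 * W z / (1 + r\<^sup>2) ^ s"
            using rr W0[of z] by (intro divide_left_mono mult_pos_pos mult_nonneg_nonneg zero_less_power Q0) auto
          then show ?thesis by (simp add: Y_def del: power_Suc)
        qed
        then show "ennreal (Y z) * indicator D z \<le> ennreal (Y z) * indicator D z * indicator Bq z + ennreal (1 / (1 + r\<^sup>2) ^ s) * (ennreal ((cmod (f z))\<^sup>2 * W z) * indicator D z)"
          using rr W0[of z] by (auto simp: indicator_def ennreal_mult[symmetric] less_imp_le intro!: ennreal_leI)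
      qed
      also have "\<dots> = (\<integral>\<^sup>+z. ennreal (Y z) * indicator D z * indicator Bq z \<partial>lborel) + ennreal (1 / (1 + r\<^sup>2) ^ s) * E"
      proof -
        have m1: "(\<lambda>z. ennreal ((cmod (f z))\<^sup>2 * W z) * indicator D z) \<in> borel_measurable lborel"
        proof -
          have "continuous_on D (\<lambda>z. (cmod (f z))\<^sup>2 * W z)"
            by (intro continuous_intros cW holomorphic_fun_on_imp_continuous_on fh)
          from bm[OF this] show ?thesis by simp
        qed
        have m2: "(\<lambda>z. ennreal (Y z) * indicator D z * indicator Bq z) \<in> borel_measurable lborel"
          using bm[OF cY] by (auto intro!: borel_measurable_times_ennreal)
        show ?thesis unfolding E_def nn_integral_cmult[OF m1, symmetric]
          using m1 m2 by (intro nn_integral_add) auto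
      qed
      also have "ennreal (1 / (1 + r\<^sup>2) ^ s) * E = c * ennreal (C / (1 + r\<^sup>2) ^ s)"
      proof -
        have "ennreal (C / (1 + r\<^sup>2) ^ s) = ennreal (1 / (1 + r\<^sup>2) ^ s) * ennreal C"
          using rr by (subst ennreal_mult[symmetric]) (auto simp: C_def)
        then show ?thesis unfolding EC by (simp add: mult_ac)
      qed
      finally show ?thesis unfolding pull[OF cY] by (simp add: distrib_left)
    qed
    ultimately have "c * (\<integral>\<^sup>+w\<in>ball 0 r. ennreal (X (a + T w)) \<partial>lborel)
       \<le> ennreal (1 / real N) * (c * ((\<integral>\<^sup>+w\<in>ball 0 r. ennreal (Y (a + T w)) \<partial>lborel) + ennreal (C / (1 + r\<^sup>2) ^ s)))"
      using main mult_left_mono[of IY _ "ennreal (1 / real N)"] by (meson order_trans zero_le)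
    also have "\<dots> = c * (ennreal (1 / real N) * ((\<integral>\<^sup>+w\<in>ball 0 r. ennreal (Y (a + T w)) \<partial>lborel) + ennreal (C / (1 + r\<^sup>2) ^ s)))"
      by (simp only: mult.left_commute)
    finally have "(\<integral>\<^sup>+w\<in>ball 0 r. ennreal (X (a + T w)) \<partial>lborel)
       \<le> ennreal (1 / real N) * ((\<integral>\<^sup>+w\<in>ball 0 r. ennreal (Y (a + T w)) \<partial>lborel) + ennreal (C / (1 + r\<^sup>2) ^ s))"
      using c by (subst (asm) ennreal_mult_le_mult_iff) auto
    then show "\<exists>h0 h. h0 holomorphic_fun_on D \<and> (\<forall>j. h j holomorphic_fun_on D) \<and>
       (\<forall>w\<in>ball 0 r. h0 (a + T w) + (\<Sum>j\<in>UNIV. w $ j * h j (a + T w)) = f (a + T w)) \<and>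
       (\<integral>\<^sup>+w\<in>ball 0 r. ennreal (((cmod (h0 (a + T w)))\<^sup>2 + (\<Sum>j\<in>UNIV. (cmod (h j (a + T w)))\<^sup>2) - (cmod (f (a + T w)))\<^sup>2 / (1 + (norm w)\<^sup>2))
             * exp (- \<phi> (a + T w) - 2 * Re (\<Lambda> (a + T w))) / (1 + (norm w)\<^sup>2) ^ (CARD('n) * (1 + N))) \<partial>lborel)
       \<le> ennreal (1 / real N) * ((\<integral>\<^sup>+w\<in>ball 0 r. ennreal ((cmod (f (a + T w)))\<^sup>2 * exp (- \<phi> (a + T w) - 2 * Re (\<Lambda> (a + T w))) / (1 + (norm w)\<^sup>2) ^ Suc (CARD('n) * (1 + N))) \<partial>lborel)
           + ennreal (C / (1 + r\<^sup>2) ^ (CARD('n) * (1 + N))))"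
      unfolding s_def[symmetric]
    proof (intro exI[of _ h0] exI[of _ h] conjI allI ballI h0 h)
      show "h0 (a + T w) + (\<Sum>j\<in>UNIV. w $ j * h j (a + T w)) = f (a + T w)" if "w \<in> ball 0 r" for w
        using div[OF rD[of w]] that by (simp add: qT)
    qed (simp only: X_def Y_def Q_def W_def qT)
  qed
qed

section \<open>Second order normal form of the weight\<close>

text \<open>
  Along the segment from \<open>a\<close> to \<open>a + v\<close> the derivative of the remainder is \<open>u'(a + t v) - u'(a) - u''(t v)\<close> applied to \<open>v\<close>, which is small because \<open>u'\<close> is
  differentiable at \<open>a\<close>.
\<close>
lemma second_order_taylor:
  fixes \<phi> :: "'a::real_normed_vector \<Rightarrow> real" and u' :: "'a \<Rightarrow> 'a \<Rightarrow>\<^sub>L real"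
    and u'' :: "'a \<Rightarrow>\<^sub>L ('a \<Rightarrow>\<^sub>L real)"
  assumes D: "open D" "a \<in> D" and d1: "\<And>x. x \<in> D \<Longrightarrow> (\<phi> has_derivative blinfun_apply (u' x)) (at x)"
    and d2: "(u' has_derivative blinfun_apply u'') (at a)" and \<eta>: "\<eta> > 0"
  obtains \<rho> where "\<rho> > 0" "ball a \<rho> \<subseteq> D"
    "\<And>v. norm v < \<rho> \<Longrightarrow> \<bar>\<phi> (a + v) - \<phi> a - u' a v - u'' v v / 2\<bar> \<le> \<eta> * (norm v)\<^sup>2"
proof -
  obtain \<rho>1 where \<rho>1: "\<rho>1 > 0" "ball a \<rho>1 \<subseteq> D" using D open_contains_ball by blast
  obtain \<rho>2 where \<rho>2: "\<rho>2 > 0" "\<And>y. norm (y - a) < \<rho>2 \<Longrightarrow> norm (u' y - u' a - u'' (y - a)) \<le> \<eta> * norm (y - a)"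
    using d2 \<eta> unfolding has_derivative_at_alt by blast
  show ?thesis
  proof (rule that[of "min \<rho>1 \<rho>2"])
    fix v :: 'a assume v: "norm v < min \<rho>1 \<rho>2"
    define g where "g t = \<phi> (a + t *\<^sub>R v) - t * u' a v - t\<^sup>2 / 2 * u'' v v" for t
    define g' where "g' t = u' (a + t *\<^sub>R v) v - u' a v - t * u'' v v" for t
    have tv: "norm (t *\<^sub>R v) < min \<rho>1 \<rho>2" if "0 \<le> t" "t \<le> 1" for t
      using v mult_right_mono[of t 1 "norm v"] that by simp
    have der: "(g has_real_derivative g' t) (at t)" if t: "0 \<le> t" "t \<le> 1" for t
    proof -
      have "a + t *\<^sub>R v \<in> D" using tv[OF t] \<rho>1 by (auto simp: subset_iff dist_norm)
      moreover have "((\<lambda>t. a + t *\<^sub>R v) has_derivative (\<lambda>h. h *\<^sub>R v)) (at t)"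
        by (auto intro!: derivative_eq_intros)
      ultimately have "((\<lambda>t. \<phi> (a + t *\<^sub>R v)) has_derivative (\<lambda>h. u' (a + t *\<^sub>R v) (h *\<^sub>R v))) (at t)"
        using has_derivative_compose d1 by blast
      then have "((\<lambda>t. \<phi> (a + t *\<^sub>R v)) has_real_derivative u' (a + t *\<^sub>R v) v) (at t)"
        unfolding has_field_derivative_def by (simp add: blinfun.scaleR_right mult.commute[of _ "u' (a + t *\<^sub>R v) v"])
      then show ?thesis unfolding g_def g'_def
        by (auto intro!: derivative_eq_intros simp: power2_eq_square)
    qed
    obtain t where t: "0 < t" "t < 1" "g 1 - g 0 = (1 - 0) * g' t"
      using MVT2[of 0 1 g g'] der by auto
    have "norm (u' (a + t *\<^sub>R v) - u' a - u'' (t *\<^sub>R v)) \<le> \<eta> * norm (t *\<^sub>R v)"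
      using \<rho>2(2)[of "a + t *\<^sub>R v"] tv[of t] t by simp
    moreover have "g' t = (u' (a + t *\<^sub>R v) - u' a - u'' (t *\<^sub>R v)) v"
      by (simp add: g'_def blinfun.diff_left blinfun.scaleR_right blinfun.scaleR_left)
    ultimately have "\<bar>g' t\<bar> \<le> \<eta> * norm (t *\<^sub>R v) * norm v"
      using norm_blinfun[of "u' (a + t *\<^sub>R v) - u' a - u'' (t *\<^sub>R v)" v] mult_right_mono[of _ _ "norm v"] by fastforce
    also have "\<dots> \<le> \<eta> * (norm v)\<^sup>2"
      using t \<eta> mult_right_mono[of t 1 "norm v"] by (simp add: power2_eq_square mult_left_le_one_le)
    finally show "\<bar>\<phi> (a + v) - \<phi> a - u' a v - u'' v v / 2\<bar> \<le> \<eta> * (norm v)\<^sup>2"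
      using t(3) by (simp add: g_def)
  qed (use \<rho>1 \<rho>2 in auto)
qed

lemma abs_blinfun_bilinear_le:
  fixes S :: "'a::real_normed_vector \<Rightarrow>\<^sub>L ('a \<Rightarrow>\<^sub>L real)"
  shows "\<bar>S x y\<bar> \<le> norm S * norm x * norm y"
  using norm_blinfun[of "S x" y] norm_blinfun[of S x] mult_right_mono[of "norm (S x)" _ "norm y"] by fastforce

text \<open>
  Under the circle action \<open>v \<mapsto> e\<^sup>i\<^sup>\<theta> v\<close> the real quadratic form \<open>S v v / 2\<close> splits into an invariant
  part, the Levi form, and the real part of a complex homogeneous quadratic polynomial. If \<open>S\<close> is
  not symmetric, both parts are those of its symmetrization.
\<close>
definition levi_part :: "((complex^'n) \<Rightarrow>\<^sub>L ((complex^'n) \<Rightarrow>\<^sub>L real)) \<Rightarrow> complex^'n \<Rightarrow> real"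
  where "levi_part S v = (S v v + S (\<i> *s v) (\<i> *s v)) / 4"

definition holomorphic_part :: "((complex^'n) \<Rightarrow>\<^sub>L ((complex^'n) \<Rightarrow>\<^sub>L real)) \<Rightarrow> complex^'n \<Rightarrow> complex"
  where "holomorphic_part S v = Complex ((S v v - S (\<i> *s v) (\<i> *s v)) / 4) (- (S v (\<i> *s v) + S (\<i> *s v) v) / 4)"

lemma quadratic_split: "blinfun_apply (blinfun_apply S v) v / 2 = levi_part S v + Re (holomorphic_part S v)"
  by (simp add: levi_part_def holomorphic_part_def field_simps)

lemma vector_scalar_mult_cartesian: "\<zeta> *s v = Re \<zeta> *\<^sub>R v + Im \<zeta> *\<^sub>R (\<i> *s (v::complex^'n))"
  by (simp add: vec_eq_iff complex_eq_iff)

lemma i_vector_scalar_mult_cartesian: "(\<i> * \<zeta>) *s v = Re \<zeta> *\<^sub>R (\<i> *s v) - Im \<zeta> *\<^sub>R (v::complex^'n)"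
  by (simp add: vec_eq_iff complex_eq_iff)

lemma levi_part_scale: "levi_part S (\<zeta> *s v) = (cmod \<zeta>)\<^sup>2 * levi_part S v"
  unfolding levi_part_def vector_smult_assoc i_vector_scalar_mult_cartesian
  unfolding vector_scalar_mult_cartesian[of \<zeta>] cmod_power2
  by (simp add: blinfun.bilinear_simps power2_eq_square algebra_simps)

lemma holomorphic_part_scale: "holomorphic_part S (\<zeta> *s v) = \<zeta>\<^sup>2 * holomorphic_part S v"
  unfolding holomorphic_part_def vector_smult_assoc i_vector_scalar_mult_cartesian
  unfolding vector_scalar_mult_cartesian[of \<zeta>]
  by (simp add: complex_eq_iff blinfun.bilinear_simps power2_eq_square) (simp add: algebra_simps)

lemma continuous_holomorphic_part: "continuous_on A (holomorphic_part S)"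
proof -
  note blc = bounded_bilinear.continuous_on[OF bounded_bilinear_blinfun_apply]
  show ?thesis unfolding holomorphic_part_def[abs_def] Complex_eq
    by (intro continuous_intros blc) simp_all
qed

lemma levi_part_perturb:
  "\<bar>levi_part S (x + z) - levi_part S x\<bar> \<le> norm S * (2 * norm x * norm z + (norm z)\<^sup>2)"
proof -
  have b: "\<bar>S x y\<bar> \<le> norm S * norm x * norm y" for x y
    by (rule abs_blinfun_bilinear_le)
  have ni: "norm (\<i> *s v) = norm v" for v :: "complex^'n" by (simp add: norm_vector_scalar_mult)
  have "levi_part S (x + z) - levi_part S x
     = (S x z + S z x + S z z + S (\<i> *s x) (\<i> *s z) + S (\<i> *s z) (\<i> *s x) + S (\<i> *s z) (\<i> *s z)) / 4"
    by (simp add: levi_part_def vector_add_ldistrib blinfun.bilinear_simps algebra_simps)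
  moreover have "\<bar>\<dots>\<bar> \<le> (4 * (norm S * norm x * norm z) + 2 * (norm S * norm z * norm z)) / 4"
    using b[of x z] b[of z x] b[of z z] b[of "\<i> *s x" "\<i> *s z"] b[of "\<i> *s z" "\<i> *s x"] b[of "\<i> *s z" "\<i> *s z"]
    by (simp add: ni mult_ac)
  moreover have "norm S * norm x * norm z \<ge> 0" "norm S * norm z * norm z \<ge> 0" by simp_all
  ultimately show ?thesis by (simp add: power2_eq_square algebra_simps)
qed

text \<open>
  The coordinate \<open>w\<^sub>k\<close> runs along \<open>\<xi>\<close> and the others along the remaining standard basis vectors,
  shortened by \<open>\<delta>\<close>.
\<close>
lemma anisotropic_coordinates:
  fixes \<xi> :: "complex^'n"
  assumes k: "\<xi> $ k \<noteq> 0" and \<delta>: "\<delta> > (0::real)"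
  defines "T \<equiv> \<lambda>w. (w $ k) *s \<xi> + \<delta> *\<^sub>R (\<chi> j. if j = k then 0 else w $ j)"
    and "V \<equiv> \<lambda>z. (\<chi> j. if j = k then z $ k / \<xi> $ k else (z $ j - z $ k / \<xi> $ k * \<xi> $ j) / of_real \<delta>)"
  shows "linear T" "linear V" "T (V z) = z" "V (T w) = w" "T (c *s w) = c *s T w" "V (c *s w) = c *s V w"
    "norm (\<chi> j. if j = k then 0 else w $ j) \<le> norm w"
proof -
  show "linear T" unfolding T_def
    by (rule linearI) (auto simp: vec_eq_iff algebra_simps)
  show "linear V" unfolding V_def
    by (rule linearI) (auto simp: vec_eq_iff field_simps add_divide_distrib diff_divide_distrib scaleR_conv_of_real[where 'a=complex])
  show "T (V z) = z" using k \<delta> by (auto simp: T_def V_def vec_eq_iff scaleR_conv_of_real[where 'a=complex])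
  show "V (T w) = w" using k \<delta> by (auto simp: T_def V_def vec_eq_iff scaleR_conv_of_real[where 'a=complex])
  show "T (c *s w) = c *s T w" by (auto simp: T_def vec_eq_iff algebra_simps)
  show "V (c *s w) = c *s V w" by (auto simp: V_def vec_eq_iff algebra_simps)
  show "norm (\<chi> j. if j = k then 0 else w $ j) \<le> norm w"
    by (rule norm_le_componentwise_cart) auto
qed

text \<open>
  Of the Levi form only its value on \<open>\<xi>\<close> survives: in the coordinates with parameter \<open>\<delta>\<close> all other
  entries, mixed ones included, carry a factor \<open>\<delta>\<close>.
\<close>
lemma negative_levi_direction_normal_form:
  fixes \<phi> :: "complex^'n \<Rightarrow> real" and u' :: "complex^'n \<Rightarrow> (complex^'n) \<Rightarrow>\<^sub>L real"
    and S :: "(complex^'n) \<Rightarrow>\<^sub>L ((complex^'n) \<Rightarrow>\<^sub>L real)" and \<xi> :: "complex^'n"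
  assumes D: "open D" "a \<in> D" and d1: "\<And>x. x \<in> D \<Longrightarrow> (\<phi> has_derivative blinfun_apply (u' x)) (at x)"
    and d2: "(u' has_derivative blinfun_apply S) (at a)" and k: "\<xi> $ k \<noteq> 0" and \<eta>: "\<eta> > 0"
  obtains T V :: "complex^'n \<Rightarrow> complex^'n" and r where
    "linear T" "linear V" "\<And>z. T (V z) = z" "\<And>w. V (T w) = w" "\<And>c w. T (c *s w) = c *s T w" "\<And>c w. V (c *s w) = c *s V w"
    "r > 0" "\<And>w. norm w < r \<Longrightarrow> a + T w \<in> D"
    "\<And>w. norm w < r \<Longrightarrow> \<bar>\<phi> (a + T w) - \<phi> a - u' a (T w) - Re (holomorphic_part S (T w)) - levi_part S \<xi> * (cmod (w $ k))\<^sup>2\<bar> \<le> \<eta> * (norm w)\<^sup>2"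
proof -
  define \<delta> where "\<delta> = min 1 (\<eta> / (2 * (norm S + 1) * (2 * norm \<xi> + 1)))"
  have \<delta>0: "\<delta> > 0" "\<delta> \<le> 1" using \<eta> by (auto simp: \<delta>_def add_nonneg_pos intro!: divide_pos_pos mult_pos_pos)
  define T where "T w = (w $ k) *s \<xi> + \<delta> *\<^sub>R (\<chi> j. if j = k then 0 else w $ j)" for w
  define V where "V z = (\<chi> j. if j = k then z $ k / \<xi> $ k else (z $ j - z $ k / \<xi> $ k * \<xi> $ j) / of_real \<delta>)" for z
  note ac = anisotropic_coordinates[OF k \<delta>0(1), folded T_def V_def, folded T_def[abs_def] V_def[abs_def]]
  have wk: "cmod (w $ k) \<le> norm w" for w :: "complex^'n" by (rule Finite_Cartesian_Product.norm_nth_le)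
  have nT1: "norm ((w $ k) *s \<xi>) \<le> norm \<xi> * norm w" for w :: "complex^'n"
    using mult_right_mono[OF wk[of w], of "norm \<xi>"] by (simp add: norm_vector_scalar_mult mult.commute)
  have nT2: "norm (\<delta> *\<^sub>R (\<chi> j. if j = k then 0 else w $ j)) \<le> \<delta> * norm w" for w :: "complex^'n"
    using mult_left_mono[OF ac(7)[of w], of \<delta>] \<delta>0 by simp
  define M where "M = norm \<xi> + 1"
  have M0: "M > 0" by (simp add: M_def add_nonneg_pos)
  have nT: "norm (T w) \<le> M * norm w" for w
  proof -
    have "norm (T w) \<le> norm \<xi> * norm w + \<delta> * norm w"
      unfolding T_def using norm_triangle_mono[OF nT1 nT2] .
    also have "\<dots> \<le> M * norm w" using mult_right_mono[OF \<delta>0(2), of "norm w"] by (simp add: M_def algebra_simps)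
    finally show ?thesis .
  qed
  have lev: "\<bar>levi_part S (T w) - levi_part S \<xi> * (cmod (w $ k))\<^sup>2\<bar> \<le> \<eta> / 2 * (norm w)\<^sup>2" for w
  proof -
    let ?x = "(w $ k) *s \<xi>" and ?z = "\<delta> *\<^sub>R (\<chi> j. if j = k then 0 else w $ j)"
    have "\<bar>levi_part S (T w) - levi_part S ?x\<bar> \<le> norm S * (2 * norm ?x * norm ?z + (norm ?z)\<^sup>2)"
      unfolding T_def by (rule levi_part_perturb)
    also have "\<dots> \<le> norm S * (2 * (norm \<xi> * norm w) * (\<delta> * norm w) + (\<delta> * norm w)\<^sup>2)"
      using nT1[of w] nT2[of w] \<delta>0 by (intro mult_left_mono add_mono mult_mono power_mono) auto
    also have "\<dots> = norm S * \<delta> * (2 * norm \<xi> + \<delta>) * (norm w)\<^sup>2" by (simp add: algebra_simps power2_eq_square)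
    also have "\<dots> \<le> (norm S + 1) * \<delta> * (2 * norm \<xi> + 1) * (norm w)\<^sup>2"
      using \<delta>0 by (intro mult_right_mono mult_mono) auto
    also have "\<dots> \<le> \<eta> / 2 * (norm w)\<^sup>2"
    proof (rule mult_right_mono)
      have "\<delta> \<le> \<eta> / (2 * (norm S + 1) * (2 * norm \<xi> + 1))" by (simp add: \<delta>_def)
      moreover have "2 * (norm S + 1) * (2 * norm \<xi> + 1) > 0" by (intro mult_pos_pos) (auto intro: add_nonneg_pos)
      ultimately have "\<delta> * (2 * (norm S + 1) * (2 * norm \<xi> + 1)) \<le> \<eta>"
        by (subst (asm) pos_le_divide_eq) auto
      then show "(norm S + 1) * \<delta> * (2 * norm \<xi> + 1) \<le> \<eta> / 2" by (simp add: algebra_simps)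
    qed simp
    finally show ?thesis unfolding levi_part_scale by (simp add: mult.commute)
  qed
  have "\<eta> / (2 * M\<^sup>2) > 0" using \<eta> M0 by simp
  from second_order_taylor[OF D d1 d2 this] obtain \<rho> where \<rho>: "\<rho> > 0" "ball a \<rho> \<subseteq> D"
    "\<And>v. norm v < \<rho> \<Longrightarrow> \<bar>\<phi> (a + v) - \<phi> a - u' a v - S v v / 2\<bar> \<le> \<eta> / (2 * M\<^sup>2) * (norm v)\<^sup>2" by blast
  show ?thesis
  proof (rule that[OF ac(1,2,3,4,5,6)])
    show "\<rho> / M > 0" using \<rho> M0 by simp
    fix w :: "complex^'n" assume "norm w < \<rho> / M"
    then have "M * norm w < \<rho>" using M0 by (simp add: pos_less_divide_eq mult.commute)
    with nT[of w] have Tw: "norm (T w) < \<rho>" by linarith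
    then show "a + T w \<in> D" using \<rho>(2) by (auto simp: subset_iff dist_norm)
    have "(norm (T w))\<^sup>2 \<le> (M * norm w)\<^sup>2" by (intro power_mono nT) auto
    then have "\<eta> / (2 * M\<^sup>2) * (norm (T w))\<^sup>2 \<le> \<eta> / (2 * M\<^sup>2) * (M * norm w)\<^sup>2" using \<eta> by (intro mult_left_mono) auto
    also have "\<dots> = \<eta> / 2 * (norm w)\<^sup>2" using M0 by (simp add: power_mult_distrib)
    finally have tb: "\<eta> / (2 * M\<^sup>2) * (norm (T w))\<^sup>2 \<le> \<eta> / 2 * (norm w)\<^sup>2" .
    have "\<eta> * (norm w)\<^sup>2 = \<eta> / 2 * (norm w)\<^sup>2 + \<eta> / 2 * (norm w)\<^sup>2" by simp
    then show "\<bar>\<phi> (a + T w) - \<phi> a - u' a (T w) - Re (holomorphic_part S (T w)) - levi_part S \<xi> * (cmod (w $ k))\<^sup>2\<bar> \<le> \<eta> * (norm w)\<^sup>2"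
      using \<rho>(3)[OF Tw] lev[of w] tb unfolding quadratic_split by linarith
  qed
qed

section \<open>Nonnegativity of the Levi form\<close>

lemma has_derivative_zero_if_quadratic_bound:
  fixes g :: "'a::real_normed_vector \<Rightarrow> 'b::real_normed_vector"
  assumes "\<And>v. norm (g v) \<le> C * (norm v)\<^sup>2"
  shows "(g has_derivative (\<lambda>_. 0)) (at 0)"
  unfolding has_derivative_at_alt
proof (intro conjI allI impI)
  have g0: "g 0 = 0" using assms[of 0] by simp
  fix e :: real assume e: "e > 0"
  show "\<exists>d>0. \<forall>y. norm (y - 0) < d \<longrightarrow> norm (g y - g 0 - 0) \<le> e * norm (y - 0)"
  proof (intro exI[of _ "e / (\<bar>C\<bar> + 1)"] conjI allI impI)
    fix y :: 'a assume y: "norm (y - 0) < e / (\<bar>C\<bar> + 1)"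
    have "norm (g y) \<le> C * (norm y)\<^sup>2" by (rule assms)
    also have "\<dots> \<le> (\<bar>C\<bar> + 1) * (norm y)\<^sup>2" by (intro mult_right_mono) auto
    also have "\<dots> = ((\<bar>C\<bar> + 1) * norm y) * norm y" by (simp add: power2_eq_square)
    also have "\<dots> \<le> e * norm y"
      using y by (intro mult_right_mono) (auto simp: pos_less_divide_eq mult.commute less_imp_le)
    finally show "norm (g y - g 0 - 0) \<le> e * norm (y - 0)" by (simp add: g0)
  qed (use e in auto)
qed simp

lemma norm_holomorphic_part_le: "norm (holomorphic_part S v) \<le> norm S * (norm v)\<^sup>2"
proof -
  have b: "\<bar>S x y\<bar> \<le> norm S * norm x * norm y" for x y
    by (rule abs_blinfun_bilinear_le)
  have ni: "norm (\<i> *s v) = norm v" by (simp add: norm_vector_scalar_mult)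
  have "norm (holomorphic_part S v) \<le> \<bar>Re (holomorphic_part S v)\<bar> + \<bar>Im (holomorphic_part S v)\<bar>" by (rule cmod_le)
  also have "\<dots> \<le> norm S * norm v * norm v"
  proof -
    have "\<bar>(p - q) / 4\<bar> + \<bar>- (s + t) / 4\<bar> \<le> m"
      if "\<bar>p\<bar> \<le> m" "\<bar>q\<bar> \<le> m" "\<bar>s\<bar> \<le> m" "\<bar>t\<bar> \<le> m" for p q s t m :: real
    proof -
      have "\<bar>p - q\<bar> \<le> 2 * m" "\<bar>- (s + t)\<bar> \<le> 2 * m" using that by linarith+
      then show ?thesis by simp
    qed
    from this[OF b[of v v] b[of "\<i> *s v" "\<i> *s v", unfolded ni] b[of v "\<i> *s v", unfolded ni] b[of "\<i> *s v" v, unfolded ni]]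
    show ?thesis unfolding holomorphic_part_def complex.sel .
  qed
  finally show ?thesis by (simp add: power2_eq_square)
qed

text \<open>
  Below the bound is the tangent of \<open>exp\<close>, above it is \<open>exp y \<le> 1 + y + y\<^sup>2\<close> for \<open>0 \<le> y \<le> 1\<close>; the smallness
  conditions absorb \<open>y\<^sup>2\<close> into \<open>\<eta> n2\<close>.
\<close>
lemma exp_between_quadratic:
  fixes x y \<eta> \<tau> A n2 :: real
  assumes x: "\<bar>x - \<tau> * A\<bar> \<le> \<eta> * n2" and "\<eta> > 0" "\<tau> > 0" "0 \<le> A" "A \<le> n2"
    and small: "n2 * (\<tau> + 2 * \<eta>) \<le> 1" "n2 * (\<tau> + 2 * \<eta>)\<^sup>2 \<le> \<eta>"
  shows "1 + \<tau> * A - \<eta> * n2 \<le> exp x" "exp x \<le> 1 + \<tau> * A + 2 * \<eta> * n2"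
proof -
  have "1 + x \<le> exp x" by (rule exp_ge_add_one_self)
  with x show "1 + \<tau> * A - \<eta> * n2 \<le> exp x" by linarith
  define y where "y = \<tau> * A + \<eta> * n2"
  have n2: "n2 \<ge> 0" using assms by linarith
  have y0: "y \<ge> 0" using assms n2 by (simp add: y_def)
  have "y \<le> n2 * (\<tau> + 2 * \<eta>)"
  proof -
    have "\<tau> * A \<le> \<tau> * n2" "0 \<le> \<eta> * n2" using assms n2 by (auto intro: mult_left_mono)
    moreover have "n2 * (\<tau> + 2 * \<eta>) = \<tau> * n2 + 2 * (\<eta> * n2)" by (simp add: algebra_simps)
    ultimately show ?thesis unfolding y_def by linarith
  qed
  then have "y\<^sup>2 \<le> (n2 * (\<tau> + 2 * \<eta>))\<^sup>2" and y1: "y \<le> 1"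
    using y0 small by (auto intro: power_mono)
  then have "y\<^sup>2 \<le> n2 * (n2 * (\<tau> + 2 * \<eta>)\<^sup>2)" by (simp add: power2_eq_square algebra_simps)
  also have "\<dots> \<le> n2 * \<eta>" using small(2) n2 by (rule mult_left_mono)
  finally have y2: "y\<^sup>2 \<le> \<eta> * n2" by (simp add: mult.commute)
  have "exp x \<le> exp y" using x by (simp add: y_def abs_le_iff)
  also have "\<dots> \<le> 1 + y + y\<^sup>2" using y0 y1 by (rule exp_bound)
  also have "\<dots> \<le> 1 + \<tau> * A + 2 * \<eta> * n2" using y2 by (simp add: y_def)
  finally show "exp x \<le> 1 + \<tau> * A + 2 * \<eta> * n2" .
qed

text \<open>
  Let \<open>lam = f'(a) / f(a)\<close> and let \<open>ell\<close> be the complex linear form with \<open>2 Re ell = \<phi>'(a)\<close>. With the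
  twist \<open>\<Lambda> = lam - ell\<close> the weight is \<open>|\<kappa>|\<^sup>2 e\<close>, where \<open>\<kappa>\<close> is holomorphic and without zeros, \<open>e\<close> is
  pinched by the circle invariant normal form, and \<open>K = f \<kappa>\<close> is stationary at \<open>a\<close>. Multiplying the
  division \<open>h\<close> of \<open>f\<close> by \<open>\<kappa>\<close> gives a division of \<open>K\<close>, to which the circle estimates apply.
\<close>
lemma levi_part_nonneg_at_nonzero:
  fixes \<phi> :: "complex^'n \<Rightarrow> real" and u' :: "complex^'n \<Rightarrow> (complex^'n) \<Rightarrow>\<^sub>L real"
    and u'' :: "complex^'n \<Rightarrow> (complex^'n) \<Rightarrow>\<^sub>L ((complex^'n) \<Rightarrow>\<^sub>L real)"
  assumes D: "open D" "bounded D" and d1: "\<And>x. x \<in> D \<Longrightarrow> (\<phi> has_derivative blinfun_apply (u' x)) (at x)"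
    and d2: "\<And>x. x \<in> D \<Longrightarrow> (u' has_derivative blinfun_apply (u'' x)) (at x)"
    and sk: "skoda_divisible D \<phi> f" and fA: "f \<in> weighted_bergman D \<phi>"
    and a: "a \<in> D" and fa: "f a \<noteq> 0"
  shows "levi_part (u'' a) \<xi> \<ge> 0"
proof (rule ccontr)
  assume neg: "\<not> levi_part (u'' a) \<xi> \<ge> 0"
  define S where "S = u'' a"
  define \<tau> where "\<tau> = - levi_part S \<xi>"
  have \<tau>: "\<tau> > 0" using neg by (simp add: \<tau>_def S_def)
  have "\<xi> \<noteq> 0" using \<tau> by (auto simp: \<tau>_def levi_part_def)
  then obtain k where k: "\<xi> $ k \<noteq> 0" by (auto simp: vec_eq_iff)
  define n where "n = real CARD('n)"
  have n1: "n \<ge> 1" by (simp add: n_def Suc_leI)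
  \<comment> \<open>The factor \<open>12\<close> ensures \<open>(5 n + 1) \<eta> \<le> \<tau> / (2 n)\<close>.\<close>
  define \<eta> where "\<eta> = \<tau> / (12 * n\<^sup>2)"
  have \<eta>: "\<eta> > 0" using \<tau> n1 by (simp add: \<eta>_def)
  have \<tau>\<eta>: "(5 * n + 1) * \<eta> < \<tau> / n"
  proof -
    have "(5 * n + 1) * \<eta> \<le> (6 * n) * \<eta>" using n1 \<eta> by (intro mult_right_mono) auto
    also have "\<dots> = \<tau> / n / 2" using n1 by (simp add: \<eta>_def field_simps power2_eq_square)
    also have "\<dots> < \<tau> / n"
    proof -
      have "\<tau> / n > 0" using \<tau> n1 by simp
      moreover have "y / 2 < y" if "0 < y" for y :: real using that by simp
      ultimately show ?thesis by blast
    qed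
    finally show ?thesis .
  qed
  have c\<phi>: "continuous_on D \<phi>" using d1 by (meson continuous_at_imp_continuous_on has_derivative_continuous)
  have fh: "f holomorphic_fun_on D" using fA by (simp add: weighted_bergman_def)
  obtain T V r1 where T: "linear T" and V: "linear V" and TV: "\<And>z. T (V z) = z" and VT: "\<And>w. V (T w) = w"
    and Tc: "\<And>c w. T (c *s w) = c *s T w" and Vc: "\<And>c w. V (c *s w) = c *s V w"
    and r1: "r1 > 0" and r1D: "\<And>w. norm w < r1 \<Longrightarrow> a + T w \<in> D"
    and tay: "\<And>w. norm w < r1 \<Longrightarrow> \<bar>\<phi> (a + T w) - \<phi> a - u' a (T w) - Re (holomorphic_part S (T w)) - levi_part S \<xi> * (cmod (w $ k))\<^sup>2\<bar> \<le> \<eta> * (norm w)\<^sup>2"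
    by (rule negative_levi_direction_normal_form[OF D(1) a d1 d2[OF a, folded S_def] k \<eta>]) (assumption | rule that)+
  obtain L where L: "(f has_derivative L) (at a)" "\<And>c v. L (c *s v) = c * L v"
    using fh a unfolding holomorphic_fun_on_def by blast
  define lam where "lam v = L v / f a" for v
  \<comment> \<open>The complex linear form whose real part is half of the differential of \<open>\<phi>\<close> at \<open>a\<close>.\<close>
  define ell where "ell v = Complex (u' a v / 2) (- (u' a (\<i> *s v) / 2))" for v
  have linL: "linear L" using L(1) by (rule has_derivative_linear)
  have lin_lam: "linear lam" unfolding lam_def
    by (rule linearI) (simp_all add: linear_add[OF linL] linear_scale[OF linL] add_divide_distrib scaleR_conv_of_real[where 'a=complex])
  have lam_c: "lam (c *s v) = c * lam v" for c v by (simp add: lam_def L(2))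
  have lin_ell: "linear ell" unfolding ell_def
  proof (rule linearI)
    fix r :: real and v w :: "complex^'n"
    have "\<i> *s (r *\<^sub>R v) = r *\<^sub>R (\<i> *s v)" by (simp add: vec_eq_iff)
    then show "Complex (u' a (r *\<^sub>R v) / 2) (- (u' a (\<i> *s (r *\<^sub>R v)) / 2)) = r *\<^sub>R Complex (u' a v / 2) (- (u' a (\<i> *s v) / 2))"
      by (simp add: complex_eq_iff blinfun.scaleR_right)
    show "Complex (u' a (v + w) / 2) (- (u' a (\<i> *s (v + w)) / 2)) = Complex (u' a v / 2) (- (u' a (\<i> *s v) / 2)) + Complex (u' a w / 2) (- (u' a (\<i> *s w) / 2))"
      by (simp add: complex_eq_iff blinfun.add_right vector_add_ldistrib add_divide_distrib)
  qed
  have ell_c: "ell (c *s v) = c * ell v" for c v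
    unfolding ell_def vector_smult_assoc i_vector_scalar_mult_cartesian
    unfolding vector_scalar_mult_cartesian[of c]
    by (simp add: complex_eq_iff blinfun.bilinear_simps algebra_simps add_divide_distrib diff_divide_distrib)
  define \<Lambda>0 where "\<Lambda>0 v = lam v - ell v" for v
  have lin\<Lambda>: "linear \<Lambda>0" unfolding \<Lambda>0_def by (intro linear_compose_sub lin_lam lin_ell)
  have \<Lambda>c: "\<Lambda>0 (c *s v) = c * \<Lambda>0 v" for c v by (simp add: \<Lambda>0_def lam_c ell_c algebra_simps)
  define \<Lambda> where "\<Lambda> z = \<Lambda>0 (z - a)" for z
  have \<Lambda>h: "\<Lambda> holomorphic_fun_on D" unfolding \<Lambda>_def[abs_def] by (rule holomorphic_fun_on_affine[OF lin\<Lambda> \<Lambda>c])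
  obtain B where B: "\<And>z. z \<in> D \<Longrightarrow> - B \<le> Re (\<Lambda> z)"
  proof -
    have "bounded (\<Lambda>0 ` ((\<lambda>z. z - a) ` D))"
      by (rule bounded_linear_image[OF bounded_translation_minus[OF D(2)]])
         (use lin\<Lambda> in \<open>simp add: linear_conv_bounded_linear\<close>)
    then obtain B where "\<And>z. z \<in> D \<Longrightarrow> cmod (\<Lambda> z) \<le> B" unfolding bounded_iff \<Lambda>_def by auto
    then show ?thesis using abs_Re_le_cmod by (intro that[of B]) (smt (verit, ccfv_SIG))
  qed
  define \<kappa> where "\<kappa> w = exp (- lam (T w)) * (exp (- holomorphic_part S (T w) / 2) * exp (- of_real (\<phi> a) / 2))" for w
  define K where "K w = f (a + T w) * \<kappa> w" for w
  have T0: "T 0 = 0" by (rule linear_0[OF T])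
  have lam0: "lam 0 = 0" by (rule linear_0[OF lin_lam])
  have hp0: "holomorphic_part S 0 = 0" using holomorphic_part_scale[of S 0 0] by simp
  have K0: "K 0 \<noteq> 0" by (simp add: K_def \<kappa>_def T0 fa)
  have bT: "bounded_linear T" using T by (simp add: linear_conv_bounded_linear)
  have dT: "((\<lambda>w. T w) has_derivative T) (at w)" for w
    by (rule bounded_linear_imp_has_derivative[OF bT])
  \<comment> \<open>The factor \<open>exp (- lam)\<close> cancels the logarithmic derivative of \<open>f\<close>; the quadratic factor is flat at \<open>0\<close>.\<close>
  have dK: "(K has_derivative (\<lambda>_. 0)) (at 0)"
  proof -
    have dF: "((\<lambda>w. f (a + T w)) has_derivative (\<lambda>h. L (T h))) (at 0)"
    proof -
      have "((\<lambda>w. a + T w) has_derivative T) (at 0)" using dT by (auto intro!: derivative_eq_intros)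
      from has_derivative_compose[OF this] show ?thesis using L(1) by (simp add: T0)
    qed
    have dexp: "((\<lambda>w. exp (g w)) has_derivative (\<lambda>h. exp (g 0) * g' h)) (at 0)"
      if "(g has_derivative g') (at 0)" for g :: "complex^'n \<Rightarrow> complex" and g'
      using has_derivative_compose[OF that, of exp "\<lambda>h. exp (g 0) * h"] DERIV_exp[of "g 0"]
      unfolding has_field_derivative_def by auto
    have "bounded_linear lam" using lin_lam by (simp add: linear_conv_bounded_linear)
    then have "((\<lambda>w. - lam (T w)) has_derivative (\<lambda>h. - lam (T h))) (at 0)"
      by (intro has_derivative_minus bounded_linear_imp_has_derivative bounded_linear_compose[OF _ bT])
    from dexp[OF this] have d1': "((\<lambda>w. exp (- lam (T w))) has_derivative (\<lambda>h. - lam (T h))) (at 0)"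
      by (simp add: T0 lam0)
    have "(holomorphic_part S has_derivative (\<lambda>_. 0)) (at (T 0))"
      unfolding T0 by (rule has_derivative_zero_if_quadratic_bound[OF norm_holomorphic_part_le])
    from has_derivative_compose[OF dT this]
    have "((\<lambda>w. holomorphic_part S (T w)) has_derivative (\<lambda>_. 0)) (at 0)" .
    then have "((\<lambda>w. - holomorphic_part S (T w) / 2) has_derivative (\<lambda>_. 0)) (at 0)"
      by (auto intro!: derivative_eq_intros)
    from dexp[OF this] have d2': "((\<lambda>w. exp (- holomorphic_part S (T w) / 2)) has_derivative (\<lambda>_. 0)) (at 0)" by simp
    have "((\<lambda>w. exp (- holomorphic_part S (T w) / 2) * exp (- of_real (\<phi> a) / 2)) has_derivative (\<lambda>h. exp (- holomorphic_part S (T 0) / 2) * 0 + 0 * exp (- of_real (\<phi> a) / 2))) (at 0)"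
      by (rule has_derivative_mult[OF d2' has_derivative_const])
    from has_derivative_mult[OF dF has_derivative_mult[OF d1' this]]
    show ?thesis unfolding K_def[abs_def] \<kappa>_def
      by (rule has_derivative_eq_rhs) (auto simp: T0 linear_0[OF linL] hp0 lam_def fa fun_eq_iff)
  qed
  have "sqrt \<eta> * cmod (K 0) > 0" using \<eta> K0 by simp
  with dK obtain r2 where r2: "r2 > 0" "\<And>w. norm w < r2 \<Longrightarrow> cmod (K w - K 0) \<le> sqrt \<eta> * cmod (K 0) * norm w"
    unfolding has_derivative_at_alt by (metis diff_zero)
  \<comment> \<open>Squared radius for which both smallness conditions of the exponential bounds hold.\<close>
  define r3 where "r3 = min (1 / (\<tau> + 2 * \<eta>)) (\<eta> / (\<tau> + 2 * \<eta>)\<^sup>2)"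
  have te: "\<tau> + 2 * \<eta> > 0" using \<tau> \<eta> by simp
  have r3: "r3 > 0" using te \<eta> by (simp add: r3_def)
  define r where "r = min (min r1 r2) (sqrt r3)"
  have r: "r > 0" "r \<le> r1" "r \<le> r2" using r1 r2 r3 by (auto simp: r_def)
  have "r\<^sup>2 \<le> (sqrt r3)\<^sup>2" using r(1) by (intro power_mono) (auto simp: r_def)
  then have rr3: "r\<^sup>2 \<le> r3" using r3 by simp
  have small: "x * (\<tau> + 2 * \<eta>) \<le> 1" "x * (\<tau> + 2 * \<eta>)\<^sup>2 \<le> \<eta>" if "x \<le> r\<^sup>2" for x
  proof -
    have "x \<le> 1 / (\<tau> + 2 * \<eta>)" "x \<le> \<eta> / (\<tau> + 2 * \<eta>)\<^sup>2" using that rr3 by (auto simp: r3_def)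
    then show "x * (\<tau> + 2 * \<eta>) \<le> 1" "x * (\<tau> + 2 * \<eta>)\<^sup>2 \<le> \<eta>"
      using te by (auto simp: pos_le_divide_eq)
  qed
  have rD: "a + T w \<in> D" if "norm w < r" for w using r1D[of w] that r by simp
  define e where "e w = exp (- (\<phi> (a + T w) - \<phi> a - u' a (T w) - Re (holomorphic_part S (T w))))" for w
  have e01: "1 + \<tau> * (cmod (w $ k))\<^sup>2 - \<eta> * (norm w)\<^sup>2 \<le> e w"
    "e w \<le> 1 + \<tau> * (cmod (w $ k))\<^sup>2 + 2 * \<eta> * (norm w)\<^sup>2" if w: "w \<in> ball 0 r" for w
  proof -
    have wr: "norm w < r" using w by simp
    have "(norm w)\<^sup>2 \<le> r\<^sup>2" using wr by (intro power_mono) auto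
    note sm = small[OF this]
    have ab: "\<bar>- (\<phi> (a + T w) - \<phi> a - u' a (T w) - Re (holomorphic_part S (T w))) - \<tau> * (cmod (w $ k))\<^sup>2\<bar> \<le> \<eta> * (norm w)\<^sup>2"
      using tay[of w] wr r by (simp add: \<tau>_def abs_le_iff)
    have "(cmod (w $ k))\<^sup>2 \<le> (norm w)\<^sup>2" by (intro power_mono Finite_Cartesian_Product.norm_nth_le) auto
    from exp_between_quadratic[OF ab \<eta> \<tau> _ this sm]
    show "1 + \<tau> * (cmod (w $ k))\<^sup>2 - \<eta> * (norm w)\<^sup>2 \<le> e w"
      "e w \<le> 1 + \<tau> * (cmod (w $ k))\<^sup>2 + 2 * \<eta> * (norm w)\<^sup>2" unfolding e_def by auto
  qed
  \<comment> \<open>The linear and the holomorphic quadratic part of \<open>\<phi>\<close> at \<open>a\<close> are both absorbed by \<open>\<kappa>\<close>.\<close>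
  have weight: "exp (- \<phi> (a + T w) - 2 * Re (\<Lambda> (a + T w))) = (cmod (\<kappa> w))\<^sup>2 * e w" for w
  proof -
    have "2 * Re (ell (T w)) = u' a (T w)" by (simp add: ell_def)
    then have "- \<phi> (a + T w) - 2 * Re (\<Lambda> (a + T w)) = 2 * (- Re (lam (T w)) + (- Re (holomorphic_part S (T w)) / 2 + - \<phi> a / 2)) + - (\<phi> (a + T w) - \<phi> a - u' a (T w) - Re (holomorphic_part S (T w)))"
      by (simp add: \<Lambda>_def \<Lambda>0_def)
    moreover have "cmod (\<kappa> w) = exp (- Re (lam (T w)) + (- Re (holomorphic_part S (T w)) / 2 + - \<phi> a / 2))"
      unfolding \<kappa>_def norm_mult norm_exp_eq_Re exp_add by simp
    ultimately show ?thesis by (simp only: e_def exp_add[of "2 * _"] exp_double)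
  qed
  have cT: "continuous_on A T" for A by (rule linear_continuous_on[OF bT])
  have caT: "continuous_on A (\<lambda>w. a + T w)" for A by (intro continuous_intros cT)
  have clam: "continuous_on A lam" for A using lin_lam by (intro linear_continuous_on) (simp add: linear_conv_bounded_linear)
  have c\<kappa>: "continuous_on A \<kappa>" for A
    unfolding \<kappa>_def
    by (intro continuous_intros continuous_on_compose2[OF clam[of UNIV] cT] continuous_on_compose2[OF continuous_holomorphic_part[of UNIV] cT]) auto
  have cgT: "continuous_on (ball 0 r) (\<lambda>w. g (a + T w) * \<kappa> w)" if "g holomorphic_fun_on D" for g
    by (intro continuous_intros c\<kappa> continuous_on_compose2[OF holomorphic_fun_on_imp_continuous_on[OF that] caT]) (auto intro: rD)
  have hgT: "(\<lambda>\<zeta>. g (a + T (\<zeta> *s w)) * \<kappa> (\<zeta> *s w)) holomorphic_on {\<zeta>. \<zeta> *s w \<in> ball 0 r}" if "g holomorphic_fun_on D" for g w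
  proof -
    have "(\<lambda>\<zeta>. g (a + \<zeta> *s T w)) holomorphic_on {\<zeta>. \<zeta> *s w \<in> ball 0 r}"
      by (rule holomorphic_fun_on_line[OF that]) (use rD Tc in \<open>auto simp: Tc[symmetric] norm_vector_scalar_mult\<close>)
    then show ?thesis unfolding Tc \<kappa>_def lam_c holomorphic_part_scale by (intro holomorphic_intros) auto
  qed
  have near: "(cmod (K w - K 0))\<^sup>2 \<le> \<eta> * (cmod (K 0))\<^sup>2 * (norm w)\<^sup>2" if "w \<in> ball 0 r" for w
  proof -
    have "(cmod (K w - K 0))\<^sup>2 \<le> (sqrt \<eta> * cmod (K 0) * norm w)\<^sup>2"
      using r2(2)[of w] that r by (intro power_mono) auto
    then show ?thesis using \<eta> by (simp add: power_mult_distrib)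
  qed
  obtain C where C: "C \<ge> 0"
    and comp: "\<And>N::nat. N \<ge> 1 \<Longrightarrow> \<exists>h0 h. h0 holomorphic_fun_on D \<and> (\<forall>j. h j holomorphic_fun_on D) \<and>
       (\<forall>w\<in>ball 0 r. h0 (a + T w) + (\<Sum>j\<in>UNIV. w $ j * h j (a + T w)) = f (a + T w)) \<and>
       (\<integral>\<^sup>+w\<in>ball 0 r. ennreal (((cmod (h0 (a + T w)))\<^sup>2 + (\<Sum>j\<in>UNIV. (cmod (h j (a + T w)))\<^sup>2) - (cmod (f (a + T w)))\<^sup>2 / (1 + (norm w)\<^sup>2))
             * exp (- \<phi> (a + T w) - 2 * Re (\<Lambda> (a + T w))) / (1 + (norm w)\<^sup>2) ^ (CARD('n) * (1 + N))) \<partial>lborel)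
       \<le> ennreal (1 / real N) * ((\<integral>\<^sup>+w\<in>ball 0 r. ennreal ((cmod (f (a + T w)))\<^sup>2 * exp (- \<phi> (a + T w) - 2 * Re (\<Lambda> (a + T w))) / (1 + (norm w)\<^sup>2) ^ Suc (CARD('n) * (1 + N))) \<partial>lborel)
           + ennreal (C / (1 + r\<^sup>2) ^ (CARD('n) * (1 + N))))"
    by (rule skoda_energy_comparison[OF sk fA D(1) c\<phi> T V TV VT Vc \<Lambda>h B r(1) rD]) (assumption | rule that)+
  define kk where "kk = (cmod (K 0))\<^sup>2"
  have kk: "kk > 0" using K0 by (simp add: kk_def)
  obtain N :: nat where N: "N \<ge> 1" and contra:
    "(LINT w:ball (0::complex^'n) r|lborel. (1 + \<tau> * (cmod (w $ k))\<^sup>2 + 4 * \<eta> * (norm w)\<^sup>2) / (1 + (norm w)\<^sup>2) ^ Suc (CARD('n) * (1 + N)))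
       + C / kk / (1 + r\<^sup>2) ^ (CARD('n) * (1 + N))
     < real N * (LINT w:ball (0::complex^'n) r|lborel. (norm w)\<^sup>2 * (1 + \<tau> * (cmod (w $ k))\<^sup>2 - \<eta> * (norm w)\<^sup>2) / (1 + (norm w)\<^sup>2) ^ Suc (CARD('n) * (1 + N)))"
    using radial_inequality_contradiction[OF r(1) \<eta> \<tau>\<eta>[unfolded n_def], of "C / kk" k] C kk by auto
  define s where "s = CARD('n) * (1 + N)"
  define LL where "LL = (LINT w:ball (0::complex^'n) r|lborel. (norm w)\<^sup>2 * (1 + \<tau> * (cmod (w $ k))\<^sup>2 - \<eta> * (norm w)\<^sup>2) / (1 + (norm w)\<^sup>2) ^ Suc s)"
  define RR where "RR = (LINT w:ball (0::complex^'n) r|lborel. (1 + \<tau> * (cmod (w $ k))\<^sup>2 + 4 * \<eta> * (norm w)\<^sup>2) / (1 + (norm w)\<^sup>2) ^ Suc s)"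
  obtain h0 h where h0: "h0 holomorphic_fun_on D" and h: "\<forall>j. h j holomorphic_fun_on D"
    and div: "\<forall>w\<in>ball 0 r. h0 (a + T w) + (\<Sum>j\<in>UNIV. w $ j * h j (a + T w)) = f (a + T w)"
    and est: "(\<integral>\<^sup>+w\<in>ball 0 r. ennreal (((cmod (h0 (a + T w)))\<^sup>2 + (\<Sum>j\<in>UNIV. (cmod (h j (a + T w)))\<^sup>2) - (cmod (f (a + T w)))\<^sup>2 / (1 + (norm w)\<^sup>2))
             * ((cmod (\<kappa> w))\<^sup>2 * e w) / (1 + (norm w)\<^sup>2) ^ s) \<partial>lborel)
       \<le> ennreal (1 / real N) * ((\<integral>\<^sup>+w\<in>ball 0 r. ennreal ((cmod (f (a + T w)))\<^sup>2 * ((cmod (\<kappa> w))\<^sup>2 * e w) / (1 + (norm w)\<^sup>2) ^ Suc s) \<partial>lborel)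
           + ennreal (C / (1 + r\<^sup>2) ^ s))"
    using comp[OF N] unfolding weight s_def[symmetric] by (elim exE conjE)
  define H0 where "H0 w = h0 (a + T w) * \<kappa> w" for w
  define H where "H j w = h j (a + T w) * \<kappa> w" for j w
  have divK: "H0 w + (\<Sum>j\<in>UNIV. w $ j * H j w) = K w" if "w \<in> ball 0 r" for w
    using arg_cong[OF bspec[OF div that], of "\<lambda>x. x * \<kappa> w"]
    by (simp add: H0_def H_def K_def distrib_right sum_distrib_right mult.assoc)
  have cs: "continuous_on (ball 0 r) H0" "\<And>j. continuous_on (ball 0 r) (H j)" "continuous_on (ball 0 r) K"
    unfolding H0_def[abs_def] H_def[abs_def] K_def[abs_def] by (intro cgT h0 h[rule_format] fh)+
  have hs: "\<And>w. (\<lambda>\<zeta>. H0 (\<zeta> *s w)) holomorphic_on {\<zeta>. \<zeta> *s w \<in> ball 0 r}"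
    "\<And>w j. (\<lambda>\<zeta>. H j (\<zeta> *s w)) holomorphic_on {\<zeta>. \<zeta> *s w \<in> ball 0 r}"
    "\<And>w. (\<lambda>\<zeta>. K (\<zeta> *s w)) holomorphic_on {\<zeta>. \<zeta> *s w \<in> ball 0 r}"
    unfolding H0_def H_def K_def by (intro hgT h0 h[rule_format] fh)+
  note loc = local_energy_inequalities[OF cs hs divK near \<eta> \<tau> small(1)[OF order_refl] e01, where s=s]
  have eqL: "((cmod (h0 (a + T w)))\<^sup>2 + (\<Sum>j\<in>UNIV. (cmod (h j (a + T w)))\<^sup>2) - (cmod (f (a + T w)))\<^sup>2 / (1 + (norm w)\<^sup>2)) * ((cmod (\<kappa> w))\<^sup>2 * e w)
     = ((cmod (H0 w))\<^sup>2 + (\<Sum>j\<in>UNIV. (cmod (H j w))\<^sup>2) - (cmod (K w))\<^sup>2 / (1 + (norm w)\<^sup>2)) * e w" for w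
    by (simp add: H0_def H_def K_def norm_mult power_mult_distrib sum_distrib_left algebra_simps)
  have eqR: "(cmod (f (a + T w)))\<^sup>2 * ((cmod (\<kappa> w))\<^sup>2 * e w) = (cmod (K w))\<^sup>2 * e w" for w
    by (simp add: K_def norm_mult power_mult_distrib)
  have "RR \<ge> 0"
    unfolding RR_def set_lebesgue_integral_def using \<tau> \<eta>
    by (intro integral_nonneg_AE AE_I2 scaleR_nonneg_nonneg divide_nonneg_nonneg add_nonneg_nonneg zero_le_power) auto
  then have pos: "0 \<le> kk * RR" "0 \<le> C / (1 + r\<^sup>2) ^ s" using kk C by auto
  have "ennreal (kk * LL) \<le> ennreal (1 / real N) * (ennreal (kk * RR) + ennreal (C / (1 + r\<^sup>2) ^ s))"
  proof -
    have "ennreal (kk * LL) \<le> (\<integral>\<^sup>+w\<in>ball 0 r. ennreal (((cmod (H0 w))\<^sup>2 + (\<Sum>j\<in>UNIV. (cmod (H j w))\<^sup>2) - (cmod (K w))\<^sup>2 / (1 + (norm w)\<^sup>2)) * e w / (1 + (norm w)\<^sup>2) ^ s) \<partial>lborel)"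
      unfolding kk_def LL_def by (rule loc(1))
    also have "\<dots> \<le> ennreal (1 / real N) * ((\<integral>\<^sup>+w\<in>ball 0 r. ennreal ((cmod (K w))\<^sup>2 * e w / (1 + (norm w)\<^sup>2) ^ Suc s) \<partial>lborel)
           + ennreal (C / (1 + r\<^sup>2) ^ s))"
      using est unfolding eqL eqR .
    also have "\<dots> \<le> ennreal (1 / real N) * (ennreal (kk * RR) + ennreal (C / (1 + r\<^sup>2) ^ s))"
      unfolding kk_def RR_def by (intro mult_left_mono add_right_mono loc(2)) auto
    finally show ?thesis .
  qed
  also have "\<dots> = ennreal (1 / real N * (kk * RR + C / (1 + r\<^sup>2) ^ s))"
    unfolding ennreal_plus[OF pos, symmetric] using pos by (intro ennreal_mult[symmetric]) auto
  finally have "kk * LL \<le> 1 / real N * (kk * RR + C / (1 + r\<^sup>2) ^ s)"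
    by (rule ennreal_le_iff[THEN iffD1, rotated]) (use pos in auto)
  then have "real N * (kk * LL) \<le> kk * RR + C / (1 + r\<^sup>2) ^ s"
    using N by (simp add: field_simps)
  moreover have "kk * (RR + C / kk / (1 + r\<^sup>2) ^ s) < kk * (real N * LL)"
    using contra kk unfolding RR_def LL_def s_def by (rule mult_strict_left_mono)
  moreover have "kk * (RR + C / kk / (1 + r\<^sup>2) ^ s) = kk * RR + C / (1 + r\<^sup>2) ^ s"
    using kk by (simp add: distrib_left)
  ultimately show False by (simp add: mult.left_commute)
qed

theorem theorem1p3:
  fixes D :: "(complex ^ 'n) set" and \<phi> :: "complex ^ 'n \<Rightarrow> real"
  assumes "open D" and "connected D" and "D \<noteq> {}" and "bounded D"
    and "\<phi> C2_on D"
    and "\<exists>f \<in> weighted_bergman D \<phi>. (\<exists>z\<in>D. f z \<noteq> 0) \<and> skoda_divisible D \<phi> f"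
  shows "\<phi> plurisubharmonic_on D"
proof -
  obtain u' u'' where d1: "\<And>x. x \<in> D \<Longrightarrow> (\<phi> has_derivative blinfun_apply (u' x)) (at x)"
    and d2: "\<And>x. x \<in> D \<Longrightarrow> (u' has_derivative blinfun_apply (u'' x)) (at x)"
    and c2: "continuous_on D u''"
    using assms(5) unfolding C2_on_def by blast
  obtain f z0 where fA: "f \<in> weighted_bergman D \<phi>" and z0: "z0 \<in> D" "f z0 \<noteq> 0" and sk: "skoda_divisible D \<phi> f"
    using assms(6) by blast
  have fh: "f holomorphic_fun_on D" using fA by (simp add: weighted_bergman_def)
  have levi: "levi_part (u'' x) w \<ge> 0" if x: "x \<in> D" for x w
  proof (rule ccontr)
    assume neg: "\<not> ?thesis"
    define U where "U = D \<inter> (\<lambda>z. levi_part (u'' z) w) -` {..<0}"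
    note blc = bounded_bilinear.continuous_on[OF bounded_bilinear_blinfun_apply]
    have "continuous_on D (\<lambda>z. levi_part (u'' z) w)"
      unfolding levi_part_def by (intro continuous_intros blc c2) auto
    then have "open U" unfolding U_def by (rule continuous_open_preimage[OF _ assms(1)]) simp
    moreover have "x \<in> U" using neg x by (simp add: U_def)
    moreover have "f z = 0" if "z \<in> U" for z
    proof (rule ccontr)
      assume "f z \<noteq> 0"
      moreover have "z \<in> D" "levi_part (u'' z) w < 0" using that by (auto simp: U_def)
      ultimately show False
        using levi_part_nonneg_at_nonzero[OF assms(1,4) d1 d2 sk fA, of z w] by auto
    qed
    ultimately have "f z0 = 0"
      using holomorphic_fun_identity[OF assms(1,2) fh, of U z0] z0 by (auto simp: U_def)
    with z0 show False by simp
  qed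
  show ?thesis
  proof (rule plurisubharmonic_on_if_levi_nonneg[OF d1 d2 c2])
    show "u'' x w w + u'' x (\<i> *s w) (\<i> *s w) \<ge> 0" if "x \<in> D" for x w
      using levi[OF that, of w] by (simp add: levi_part_def)
  qed
qed

end
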